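(* Assume that $P$ is an ergodic $\Xi$-invariant probability measure on $\widetilde\Omega$ such that $\int_{\widetilde\Omega}N_1(\tilde\omega)\,dP(\tilde\omega)<\infty$. Then for $P$-almost all $\tilde\omega\in\widetilde\Omega$ the pressure $p^{\tilde\omega}(\alpha)$ exists for all $\alpha\in[0,\infty)$ and is independent of $\tilde\omega$ (i.e. there is one function $p:[0,\infty)\to\mathbb R$ such that for $P$-almost all $\tilde\omega$, $p^{\tilde\omega}(\alpha)=p(\alpha)$ for all $\alpha\ge0$). Furthermore, $p^{\tilde\omega}$ is strictly decreasing and there exists a unique $\alpha_0$ such that $p^{\tilde\omega}(\alpha_0)=0$ for $P$-almost all $\tilde\omega\in\widetilde\Omega$.
   Context: $\mathbb N=\{1,2,\dots\}$, $D\in\mathbb N$. Code trees. Let $\Lambda$ be an index set and for each $\lambda\in\Lambda$ let $M_\lambda\in\mathbb N$, with $M=\sup_\lambda M_\lambda<\infty$. For $\lambda\in\Lambda$, $1\le i\le M_\lambda$ let $T_i^\lambda:\mathbb R^D\to\mathbb R^D$ be a fixed non-singular linear map. Standing assumption: there are numbers $0<\underline\sigma\le\overline\sigma<1$ such that $\underline\sigma\le\sigma_D(T_i^\lambda)\le\sigma_1(T_i^\lambda)\le\overline\sigma$ for all $\lambda,i$, where $\sigma_1(T)\ge\dots\ge\sigma_D(T)$ denote the singular values of $T$. Let $I=\{1,\dots,M\}$; $I^0$ consists of the empty word $\emptyset$; $|\tau|=k$ for $\tau\in I^k$. For a function $\omega:\bigcup_{k\ge0}I^k\to\Lambda$ let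 $\Sigma_*^\omega\subset\bigcup_{k\ge0}I^k$ be the unique set such that $\emptyset\in\Sigma_*^\omega$; if $i_1\cdots i_k\in\Sigma_*^\omega$ and $\omega(i_1\cdots i_k)=\lambda$ then $i_1\cdots i_kl\in\Sigma_*^\omega$ if and only if $l\le M_\lambda$; and if $i_1\cdots i_k\notin\Sigma_*^\omega$ then $i_1\cdots i_kl\notin\Sigma_*^\omega$ for all $l$. The restriction of $\omega$ to $\Sigma_*^\omega$ is called a code tree; $\Omega$ is the set of all code trees. For $\mathbf i_k=i_1\cdots i_k\in\Sigma_*^\omega$ put $T_{\mathbf i_k}^\omega=T_{i_1}^{\omega(\emptyset)}T_{i_2}^{\omega(i_1)}\cdots T_{i_k}^{\omega(i_1\cdots i_{k-1})}$. Pressure. For a non-singular linear $T$ with singular values $\sigma_1\ge\dots\ge\sigma_D>0$ let $\Phi^\alpha(T)=\sigma_1\cdots\sigma_{m-1}\sigma_m^{\alpha-m+1}$ if $0\le\alpha<D$, where $m$ is the integer with $m-1\le\alpha<m$, and $\Phi^\alpha(T)=\sigma_1\cdots\sigma_{D-1}\sigma_D^{\alpha-D+1}$ if $\alpha\ge D$. For $k\in\mathbb N$, $\alpha\ge0$ let $S^\omega(k,\alpha)=\sum\Phi^\alpha(T_{\mathbf i_k}^\omega)$, the sum over all words $\mathbf i_k\in\Sigma_*^\omega$ of length $k$. The pressure is $p^\omega(\alpha)=\lim_{k\to\infty}\frac1k\log S^\omega(k,\alpha)$, said to exist when the limit exists. Neck levels. $\widetilde\Omega$ is the set of $\tilde\omega=(\omega,N)\in\Omega\times\mathbb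 N^{\mathbb N}$ such that $N_m<N_{m+1}$ for all $m$, and whenever $\mathbf i,\mathbf i'$ are words of length $N_m$ and $\mathbf j$ is a finite (possibly empty) word with $\mathbf i\mathbf j,\mathbf i'\in\Sigma_*^\omega$, then $\mathbf i'\mathbf j\in\Sigma_*^\omega$ and $\omega(\mathbf i\mathbf j)=\omega(\mathbf i'\mathbf j)$ (all sub code trees rooted at level $N_m$ are identical). $N_m(\tilde\omega)=N_m$ for $\tilde\omega=(\omega,N)$. The shift $\Xi:\widetilde\Omega\to\widetilde\Omega$ is $\Xi(\omega,N)=(\hat\omega,\hat N)$ with $\hat N_m=N_{m+1}-N_1$ and $\hat\omega(\mathbf j)=\omega(\mathbf i\mathbf j)$ for any $\mathbf i\in\Sigma_*^\omega$ with $|\mathbf i|=N_1$. $\widetilde\Omega$ has the topology generated by the cylinders $[(\omega,N)_m]=\{(\hat\omega,\hat N)\in\widetilde\Omega:\hat N_i=N_i\ \forall i\le m,\ \hat\omega(\tau)=\omega(\tau)\text{ for all }\tau\text{ with }|\tau|<N_m\}$, $m\in\mathbb N$, and the corresponding Borel $\sigma$-algebra. For $\tilde\omega=(\omega,N)$, $p^{\tilde\omega}=p^\omega$. *)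

theory Defs
  imports "HOL-Probability.Probability"
begin

section \<open>Singular values\<close>

text \<open>
  The singular values of \<open>T\<close> are the square roots of the eigenvalues of \<open>T\<^sup>* T\<close>, repeated according
  to multiplicity and listed in decreasing order. Since \<open>T\<^sup>* T\<close> is self-adjoint, the multiplicity of
  an eigenvalue is the dimension of its eigenspace.
\<close>

definition gram_eigenspace :: "('a::euclidean_space \<Rightarrow> 'a) \<Rightarrow> real \<Rightarrow> 'a set" where
  "gram_eigenspace T e = {x. adjoint T (T x) = e *\<^sub>R x}"

definition gram_eigenvalues :: "('a::euclidean_space \<Rightarrow> 'a) \<Rightarrow> real set" where
  "gram_eigenvalues T = {e. \<exists>x\<in>gram_eigenspace T e. x \<noteq> 0}"

definition singular_values :: "('a::euclidean_space \<Rightarrow> 'a) \<Rightarrow> real list" where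
  "singular_values T =
     rev (sorted_list_of_multiset
       (\<Sum>e\<in>gram_eigenvalues T. replicate_mset (dim (gram_eigenspace T e)) (sqrt e)))"

text \<open>One-based, so that \<open>singular_value T 1\<close> is the largest one.\<close>

definition singular_value :: "('a::euclidean_space \<Rightarrow> 'a) \<Rightarrow> nat \<Rightarrow> real" where
  "singular_value T i = singular_values T ! (i - 1)"

definition sv_function :: "real \<Rightarrow> ('a::euclidean_space \<Rightarrow> 'a) \<Rightarrow> real" where
  "sv_function \<alpha> T =
     (if \<alpha> < real DIM('a)
      then let m = nat \<lfloor>\<alpha>\<rfloor> + 1
           in (\<Prod>i\<in>{1..<m}. singular_value T i) * singular_value T m powr (\<alpha> - real m + 1)
      else (\<Prod>i\<in>{1..<DIM('a)}. singular_value T i)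
             * singular_value T DIM('a) powr (\<alpha> - real DIM('a) + 1))"


section \<open>Code trees\<close>

text \<open>
  \<open>Mb \<lambda>\<close> is the number of maps in the family with index \<open>\<lambda>\<close>. Words are lists over the alphabet
  \<open>{1..M}\<close> with \<open>M = sup\<^sub>\<lambda> Mb \<lambda>\<close>; the supremum is meaningful when \<open>Mb ` \<Lambda>\<close> is bounded above.
\<close>

definition words :: "'l set \<Rightarrow> ('l \<Rightarrow> nat) \<Rightarrow> nat list set" where
  "words \<Lambda> Mb = lists {1..(SUP l\<in>\<Lambda>. Mb l)}"

inductive_set admissible :: "('l \<Rightarrow> nat) \<Rightarrow> (nat list \<Rightarrow> 'l) \<Rightarrow> nat list set"
  for Mb :: "'l \<Rightarrow> nat" and f :: "nat list \<Rightarrow> 'l" where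
  Nil: "[] \<in> admissible Mb f"
| snoc: "\<lbrakk>w \<in> admissible Mb f; 1 \<le> l; l \<le> Mb (f w)\<rbrakk> \<Longrightarrow> w @ [l] \<in> admissible Mb f"

lemma admissible_snoc_iff:
  "w @ [l] \<in> admissible Mb f \<longleftrightarrow> w \<in> admissible Mb f \<and> 1 \<le> l \<and> l \<le> Mb (f w)"
  by (auto intro: admissible.snoc elim: admissible.cases)

lemma admissible_subset_words:
  assumes "bdd_above (Mb ` \<Lambda>)" and "f \<in> words \<Lambda> Mb \<rightarrow> \<Lambda>"
  shows "admissible Mb f \<subseteq> words \<Lambda> Mb"
proof
  fix w assume "w \<in> admissible Mb f"
  then show "w \<in> words \<Lambda> Mb"
  proof induction
    case Nil
    then show ?case by (simp add: words_def)
  next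
    case (snoc w l)
    have "f w \<in> \<Lambda>" using snoc.IH assms(2) by blast
    then have "Mb (f w) \<le> (SUP l\<in>\<Lambda>. Mb l)" using assms(1) by (rule cSUP_upper)
    then show ?case using snoc by (auto simp: words_def)
  qed
qed

text \<open>
  A code tree is the restriction of some \<open>f\<close> to its set of admissible words; it is a partial map
  whose domain is that set of words.
\<close>

definition code_trees :: "'l set \<Rightarrow> ('l \<Rightarrow> nat) \<Rightarrow> (nat list \<rightharpoonup> 'l) set" where
  "code_trees \<Lambda> Mb = {(\<lambda>w. Some (f w)) |` admissible Mb f | f. f \<in> words \<Lambda> Mb \<rightarrow> \<Lambda>}"

text \<open>\<open>word_map T \<omega> [i\<^sub>1, \<dots>, i\<^sub>k]\<close> is the composition of the maps \<open>T (\<omega> [i\<^sub>1, \<dots>, i\<^sub>j]) i\<^sub>j\<^sub>+\<^sub>1\<close>, \<open>0 \<le> j < k\<close>.\<close>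

definition word_map ::
  "('l \<Rightarrow> nat \<Rightarrow> 'a \<Rightarrow> 'a) \<Rightarrow> (nat list \<rightharpoonup> 'l) \<Rightarrow> nat list \<Rightarrow> 'a \<Rightarrow> 'a" where
  "word_map T \<omega> w = foldr (\<lambda>j g. T (the (\<omega> (take j w))) (w ! j) \<circ> g) [0..<length w] id"


section \<open>Pressure\<close>

definition level_sum ::
  "('l \<Rightarrow> nat \<Rightarrow> 'a::euclidean_space \<Rightarrow> 'a) \<Rightarrow> (nat list \<rightharpoonup> 'l) \<Rightarrow> nat \<Rightarrow> real \<Rightarrow> real" where
  "level_sum T \<omega> k \<alpha> = (\<Sum>w | w \<in> dom \<omega> \<and> length w = k. sv_function \<alpha> (word_map T \<omega> w))"

definition pressure_exists ::
  "('l \<Rightarrow> nat \<Rightarrow> 'a::euclidean_space \<Rightarrow> 'a) \<Rightarrow> (nat list \<rightharpoonup> 'l) \<Rightarrow> real \<Rightarrow> bool" where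
  "pressure_exists T \<omega> \<alpha> \<longleftrightarrow> convergent (\<lambda>k. 1 / real k * ln (level_sum T \<omega> k \<alpha>))"

definition pressure ::
  "('l \<Rightarrow> nat \<Rightarrow> 'a::euclidean_space \<Rightarrow> 'a) \<Rightarrow> (nat list \<rightharpoonup> 'l) \<Rightarrow> real \<Rightarrow> real" where
  "pressure T \<omega> \<alpha> = lim (\<lambda>k. 1 / real k * ln (level_sum T \<omega> k \<alpha>))"


section \<open>Neck levels\<close>

text \<open>
  The sequence \<open>(N\<^sub>m)\<close> with \<open>m \<ge> 1\<close> of positive integers is encoded as a function on all of \<open>nat\<close> with
  the convention \<open>N 0 = 0\<close>; strict monotonicity then includes \<open>N 1 \<ge> 1\<close>.
\<close>

definition neck_trees :: "'l set \<Rightarrow> ('l \<Rightarrow> nat) \<Rightarrow> ((nat list \<rightharpoonup> 'l) \<times> (nat \<Rightarrow> nat)) set" where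
  "neck_trees \<Lambda> Mb =
     {(\<omega>, N). \<omega> \<in> code_trees \<Lambda> Mb \<and> N 0 = 0 \<and> strict_mono N \<and>
        (\<forall>m\<ge>1. \<forall>i i' j. length i = N m \<longrightarrow> length i' = N m \<longrightarrow> i @ j \<in> dom \<omega> \<longrightarrow> i' \<in> dom \<omega> \<longrightarrow>
           i' @ j \<in> dom \<omega> \<and> \<omega> (i @ j) = \<omega> (i' @ j))}"

text \<open>On \<open>neck_trees\<close> the result does not depend on the chosen word of length \<open>N 1\<close>.\<close>

definition neck_shift ::
  "(nat list \<rightharpoonup> 'l) \<times> (nat \<Rightarrow> nat) \<Rightarrow> (nat list \<rightharpoonup> 'l) \<times> (nat \<Rightarrow> nat)" where
  "neck_shift = (\<lambda>(\<omega>, N).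
     (\<lambda>j. \<omega> ((SOME i. i \<in> dom \<omega> \<and> length i = N 1) @ j), \<lambda>m. N (m + 1) - N 1))"

text \<open>
  Agreement is agreement of partial maps, so that trees in the same cylinder also have the same
  words of length less than \<open>N m\<close>.
\<close>

definition neck_cylinder ::
  "'l set \<Rightarrow> ('l \<Rightarrow> nat) \<Rightarrow> (nat list \<rightharpoonup> 'l) \<times> (nat \<Rightarrow> nat) \<Rightarrow> nat
     \<Rightarrow> ((nat list \<rightharpoonup> 'l) \<times> (nat \<Rightarrow> nat)) set" where
  "neck_cylinder \<Lambda> Mb = (\<lambda>(\<omega>, N) m.
     {(\<omega>', N') \<in> neck_trees \<Lambda> Mb.
        (\<forall>i\<in>{1..m}. N' i = N i) \<and> (\<forall>w. length w < N m \<longrightarrow> \<omega>' w = \<omega> w)})"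

definition neck_topology ::
  "'l set \<Rightarrow> ('l \<Rightarrow> nat) \<Rightarrow> ((nat list \<rightharpoonup> 'l) \<times> (nat \<Rightarrow> nat)) topology" where
  "neck_topology \<Lambda> Mb =
     topology_generated_by {neck_cylinder \<Lambda> Mb x m | x m. x \<in> neck_trees \<Lambda> Mb \<and> m \<ge> 1}"

lemma topspace_neck_topology: "topspace (neck_topology \<Lambda> Mb) = neck_trees \<Lambda> Mb"
proof -
  have "x \<in> neck_cylinder \<Lambda> Mb x 1" if "x \<in> neck_trees \<Lambda> Mb" for x
    using that by (cases x) (auto simp: neck_cylinder_def)
  moreover have "neck_cylinder \<Lambda> Mb x m \<subseteq> neck_trees \<Lambda> Mb" for x m
    by (cases x) (auto simp: neck_cylinder_def)
  ultimately show ?thesis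
    unfolding neck_topology_def topology_generated_by_topspace by fastforce
qed

definition neck_borel ::
  "'l set \<Rightarrow> ('l \<Rightarrow> nat) \<Rightarrow> ((nat list \<rightharpoonup> 'l) \<times> (nat \<Rightarrow> nat)) measure" where
  "neck_borel \<Lambda> Mb = sigma (neck_trees \<Lambda> Mb) {U. openin (neck_topology \<Lambda> Mb) U}"


section \<open>Invariance and ergodicity\<close>

definition invariant_measure :: "('b \<Rightarrow> 'b) \<Rightarrow> 'b measure \<Rightarrow> bool" where
  "invariant_measure S P \<longleftrightarrow> (\<forall>A\<in>sets P. emeasure P (S -` A \<inter> space P) = emeasure P A)"

definition ergodic_measure :: "('b \<Rightarrow> 'b) \<Rightarrow> 'b measure \<Rightarrow> bool" where
  "ergodic_measure S P \<longleftrightarrow>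
     (\<forall>A\<in>sets P. S -` A \<inter> space P = A \<longrightarrow> emeasure P A = 0 \<or> emeasure P (space P - A) = 0)"

end

theory Submission
  imports Defs
begin

text \<open>
  The singular value function \<open>\<Phi>\<^sup>\<alpha>\<close> is submultiplicative for \<open>\<alpha> < D\<close>, by Horn's inequality for the products
  of the \<open>k\<close> largest singular values, and supermultiplicative for \<open>\<alpha> \<ge> D\<close>. Since all subtrees at a neck
  level coincide, \<open>ln S(N\<^sub>m, \<alpha>)\<close> is therefore subadditive or superadditive along the orbit of the shift,
  and Kingman's theorem gives its almost sure linear growth rate, while \<open>N\<^sub>m / m\<close> converges by Birkhoff's
  theorem. Between two neck levels \<open>ln S(k, \<alpha>)\<close> changes by at most a constant times the gap, which
  is \<open>o(m)\<close>, so the pressure exists for each \<open>\<alpha>\<close> outside a null set. The slopes of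
  \<open>\<alpha> \<mapsto> ln S(k, \<alpha>) / k\<close> lie between \<open>ln \<sigma>l\<close> and \<open>ln \<sigma>u < 0\<close>, so rational \<open>\<alpha>\<close> suffice, and the limit is
  strictly decreasing with exactly one zero.
\<close>

section \<open>Singular values\<close>

text \<open>Horn's inequality is the norm bound for exterior powers; it is reached here from the
  min-max principle and the determinant alone. A diagonal map is factored into a scalar and steps
  that shrink only the axes beyond some index; for each step the determinant says exactly how much
  the full product of singular values loses. \<open>ergodic_measure\<close> speaks of sets that
  equal their preimage, so the growth hypotheses are arranged to make the level sets of a limsup
  strictly invariant. One upper bound, for nonnegative superadditive sequences, then does most of
  the work: both halves of Birkhoff's theorem and the lower half of Kingman's come from applying it
  to suitable complements, and the upper half of Kingman's from averaging over windows.
  \<open>ln S\<close> itself has no such monotonicity. Adding \<open>C\<close> times the neck level,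
  with \<open>C = ln M - \<alpha> * ln \<sigma>l\<close> a bound for the change of
  \<open>ln S\<close> per level, supplies nonnegativity, monotonicity and invariance at once, and
  the added term has a known limit.\<close>

definition orthonormal_basis :: "(nat \<Rightarrow> 'a::euclidean_space) \<Rightarrow> bool" where
  "orthonormal_basis b \<longleftrightarrow>
     (\<forall>i<DIM('a). \<forall>j<DIM('a). b i \<bullet> b j = (if i = j then 1 else 0))"

lemma orthonormal_basis_inner:
  fixes b :: "nat \<Rightarrow> 'a::euclidean_space"
  assumes "orthonormal_basis b" "i < DIM('a)" "j < DIM('a)"
  shows "b i \<bullet> b j = (if i = j then 1 else 0)"
  using assms by (simp add: orthonormal_basis_def)

lemma orthonormal_basis_dim_span:
  fixes b :: "nat \<Rightarrow> 'a::euclidean_space"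
  assumes b: "orthonormal_basis b" and I: "I \<subseteq> {..<DIM('a)}"
  shows "dim (span (b ` I)) = card I"
proof -
  have *: "b i \<bullet> b j = (if i = j then 1 else 0)" if "i \<in> I" "j \<in> I" for i j
    by (rule orthonormal_basis_inner[OF b]) (use that I in auto)
  have inj: "inj_on b I"
    by (rule inj_onI) (metis * zero_neq_one)
  have "pairwise orthogonal (b ` I)"
    unfolding pairwise_def orthogonal_def using * by auto
  moreover have "0 \<notin> b ` I"
    using * by (metis image_iff inner_zero_left zero_neq_one)
  ultimately have "independent (b ` I)"
    by (intro pairwise_orthogonal_independent)
  then show ?thesis
    by (simp add: dim_eq_card_independent card_image[OF inj])
qed

lemma orthonormal_basis_span_coord:
  fixes b :: "nat \<Rightarrow> 'a::euclidean_space"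
  assumes b: "orthonormal_basis b" and I: "I \<subseteq> {..<DIM('a)}"
    and x: "x \<in> span (b ` I)" and j: "j < DIM('a)" "j \<notin> I"
  shows "x \<bullet> b j = 0"
  using x
proof (induction rule: span_induct_alt)
  case (step c x y)
  then show ?case
    using orthonormal_basis_inner[OF b _ j(1)] I j(2) by (fastforce simp: inner_add_left)
qed simp

lemma orthonormal_basis_expand:
  fixes b :: "nat \<Rightarrow> 'a::euclidean_space"
  assumes b: "orthonormal_basis b"
  shows "x = (\<Sum>i<DIM('a). (x \<bullet> b i) *\<^sub>R b i)"
proof -
  define y where "y = x - (\<Sum>i<DIM('a). (x \<bullet> b i) *\<^sub>R b i)"
  have "dim (span (b ` {..<DIM('a)})) = DIM('a)"
    using orthonormal_basis_dim_span[OF b, of "{..<DIM('a)}"] by simp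
  then have full: "span (b ` {..<DIM('a)}) = UNIV"
    by (simp add: dim_eq_full)
  have "y \<bullet> b j = 0" if "j < DIM('a)" for j
  proof -
    have "(\<Sum>i<DIM('a). (x \<bullet> b i) * (b i \<bullet> b j)) = (\<Sum>i<DIM('a). if i = j then x \<bullet> b j else 0)"
      using orthonormal_basis_inner[OF b _ that] by (intro sum.cong) auto
    then show ?thesis
      using that by (simp add: y_def inner_diff_left inner_sum_left)
  qed
  then have "b ` {..<DIM('a)} \<subseteq> {z. y \<bullet> z = 0}"
    by auto
  then have "span (b ` {..<DIM('a)}) \<subseteq> {z. y \<bullet> z = 0}"
    by (rule span_minimal) (rule subspace_hyperplane)
  then have "y \<bullet> y = 0"
    using full by blast
  then show ?thesis
    by (simp add: y_def)
qed

lemma orthonormal_basis_norm: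
  fixes b :: "nat \<Rightarrow> 'a::euclidean_space"
  assumes b: "orthonormal_basis b"
  shows "(norm x)\<^sup>2 = (\<Sum>i<DIM('a). (x \<bullet> b i)\<^sup>2)"
proof -
  have "(norm x)\<^sup>2 = x \<bullet> (\<Sum>i<DIM('a). (x \<bullet> b i) *\<^sub>R b i)"
    by (subst orthonormal_basis_expand[OF b, of x, symmetric]) (simp add: power2_norm_eq_inner)
  then show ?thesis
    by (simp add: inner_sum_right power2_eq_square)
qed

lemma orthonormal_basis_linear:
  fixes b :: "nat \<Rightarrow> 'a::euclidean_space"
  assumes b: "orthonormal_basis b" and f: "linear f"
  shows "f x = (\<Sum>i<DIM('a). (x \<bullet> b i) *\<^sub>R f (b i))"
  by (subst orthonormal_basis_expand[OF b, of x])
    (simp add: linear_sum[OF f] linear_cmul[OF f])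

text \<open>The eigenvector maximises the Rayleigh quotient on the unit sphere of \<open>S\<close>.\<close>

lemma selfadjoint_eigenvector:
  fixes f :: "'a::euclidean_space \<Rightarrow> 'a"
  assumes f: "linear f" and sa: "\<And>x y. f x \<bullet> y = x \<bullet> f y"
    and S: "subspace S" "f ` S \<subseteq> S" and z: "z \<in> S" "z \<noteq> 0"
  shows "\<exists>v\<in>S. norm v = 1 \<and> f v = (v \<bullet> f v) *\<^sub>R v"
proof -
  have "compact (S \<inter> sphere 0 1)"
    by (simp add: closed_subspace[OF S(1)] closed_Int_compact)
  moreover have "z /\<^sub>R norm z \<in> S \<inter> sphere 0 1"
    using z S(1) by (simp add: subspace_scale)
  then have "S \<inter> sphere 0 1 \<noteq> {}"
    by blast
  moreover have "continuous_on (S \<inter> sphere 0 1) (\<lambda>x. x \<bullet> f x)"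
    by (intro continuous_intros linear_continuous_on linear_conv_bounded_linear[THEN iffD1] f)
  ultimately obtain v where v: "v \<in> S" "norm v = 1"
    and vmax: "\<And>y. y \<in> S \<Longrightarrow> norm y = 1 \<Longrightarrow> y \<bullet> f y \<le> v \<bullet> f v"
    using continuous_attains_sup[of "S \<inter> sphere 0 1" "\<lambda>x. x \<bullet> f x"]
    by (metis Int_iff mem_sphere_0)
  define e where "e = v \<bullet> f v"
  have vv: "v \<bullet> v = 1"
    using v(2) by (simp add: norm_eq_1)
  have max: "y \<bullet> f y \<le> e * (y \<bullet> y)" if "y \<in> S" for y
  proof (cases "y = 0")
    case False
    have "(y /\<^sub>R norm y) \<bullet> f (y /\<^sub>R norm y) \<le> e"
      unfolding e_def using that False S(1) by (intro vmax) (auto simp: subspace_scale)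
    then have "(y \<bullet> f y) / (norm y)\<^sup>2 \<le> e"
      by (simp add: linear_cmul[OF f] power2_eq_square divide_inverse mult_ac)
    then show ?thesis
      using False by (simp add: divide_le_eq power2_norm_eq_inner)
  qed (simp add: linear_0[OF f])
  \<comment> \<open>The residual of the eigenvalue equation. It lies in \<open>S\<close> and is
    orthogonal to \<open>v\<close>, so \<open>v\<close> perturbed by multiples of \<open>y\<close>
    may be compared with the maximiser.\<close>
  define y where "y = f v - e *\<^sub>R v"
  have yS: "y \<in> S"
    using v(1) S unfolding y_def by (intro subspace_diff subspace_scale) auto
  have yv: "v \<bullet> y = 0"
    by (simp add: y_def inner_diff_right vv e_def)
  have a: "f v \<bullet> y = y \<bullet> y"
    by (metis add_0 add_diff_cancel_left' diff_add_cancel inner_add_left inner_commute inner_scaleR_left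
        mult_zero_right y_def yv)
  have quad: "2 * t * (y \<bullet> y) \<le> t\<^sup>2 * (e * (y \<bullet> y) - y \<bullet> f y)" for t
  proof -
    have "(v + t *\<^sub>R y) \<bullet> f (v + t *\<^sub>R y) \<le> e * ((v + t *\<^sub>R y) \<bullet> (v + t *\<^sub>R y))"
      using v(1) yS S(1) by (intro max subspace_add subspace_scale)
    moreover have "(v + t *\<^sub>R y) \<bullet> f (v + t *\<^sub>R y) = e + 2 * t * (y \<bullet> y) + t\<^sup>2 * (y \<bullet> f y)"
      using a sa[of v y] by (simp add: linear_add[OF f] linear_cmul[OF f] inner_add_left
          inner_add_right e_def power2_eq_square inner_commute algebra_simps)
    moreover have "(v + t *\<^sub>R y) \<bullet> (v + t *\<^sub>R y) = 1 + t\<^sup>2 * (y \<bullet> y)"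
      using yv vv by (simp add: inner_add_left inner_add_right power2_eq_square inner_commute)
    ultimately have "e + 2 * t * (y \<bullet> y) + t\<^sup>2 * (y \<bullet> f y) \<le> e * (1 + t\<^sup>2 * (y \<bullet> y))"
      by (simp only:)
    then show ?thesis
      by (simp add: algebra_simps)
  qed
  have "y \<bullet> y \<le> 0"
  proof (rule ccontr)
    assume "\<not> y \<bullet> y \<le> 0"
    then have pos: "y \<bullet> y > 0"
      by (simp only: not_le)
    \<comment> \<open>The coefficient of \<open>t\<^sup>2\<close> in \<open>quad\<close>. Taking
      \<open>t = 1\<close> shows that it is positive; at \<open>t = y \<bullet> y / c\<close> the
      left side of \<open>quad\<close> is then twice the right side, which is positive.\<close>
    define c where "c = e * (y \<bullet> y) - y \<bullet> f y"
    have c0: "c > 0"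
      using quad[of 1] pos unfolding c_def power_one mult_1 mult_1_right by linarith
    have "2 * (y \<bullet> y / c) * (y \<bullet> y) \<le> (y \<bullet> y / c)\<^sup>2 * c"
      using quad[of "y \<bullet> y / c"] by (simp add: c_def)
    also have "(y \<bullet> y / c)\<^sup>2 * c = (y \<bullet> y / c) * (y \<bullet> y)"
      using c0 by (simp add: power2_eq_square)
    finally show False
      using mult_pos_pos[OF divide_pos_pos[OF pos c0] pos] by linarith
  qed
  then have "y = 0"
    using inner_ge_zero[of y] by (metis inner_eq_zero_iff order_antisym)
  then show ?thesis
    using v unfolding y_def e_def by (intro bexI[of _ v]) auto
qed

text \<open>The spectral theorem, stated for an invariant subspace so that induction on the
  dimension applies: by self-adjointness, the vectors of \<open>S\<close> orthogonal to an
  eigenvector again form an invariant subspace.\<close>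

lemma selfadjoint_eigenbasis:
  fixes f :: "'a::euclidean_space \<Rightarrow> 'a"
  assumes f: "linear f" and sa: "\<And>x y. f x \<bullet> y = x \<bullet> f y"
    and S: "subspace S" "f ` S \<subseteq> S"
  shows "\<exists>B\<subseteq>S. span B = S \<and> (\<forall>b\<in>B. \<forall>c\<in>B. b \<bullet> c = (if b = c then 1 else 0)) \<and>
           (\<forall>b\<in>B. f b = (b \<bullet> f b) *\<^sub>R b)"
  using S
proof (induction "dim S" arbitrary: S rule: less_induct)
  case less
  show ?case
  proof (cases "S \<subseteq> {0}")
    case True
    then have "S = {0}"
      using subspace_0[OF less.prems(1)] by auto
    then show ?thesis
      by (intro exI[of _ "{}"]) auto
  next
    case False
    then obtain v where v: "v \<in> S" "norm v = 1" "f v = (v \<bullet> f v) *\<^sub>R v"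
      using selfadjoint_eigenvector[OF f sa less.prems] by blast
    have vv: "v \<bullet> v = 1"
      using v(2) by (simp add: norm_eq_1)
    define S' where "S' = S \<inter> {y. v \<bullet> y = 0}"
    have sub: "subspace S'"
      unfolding S'_def by (intro subspace_inter less.prems(1) subspace_hyperplane)
    have inv: "f ` S' \<subseteq> S'"
    proof -
      have "v \<bullet> f y = 0" if "v \<bullet> y = 0" for y
        by (metis inner_scaleR_left mult_zero_right sa that v(3))
      then show ?thesis
        using less.prems(2) by (auto simp: S'_def)
    qed
    have "v \<notin> S'"
      by (simp add: S'_def vv)
    then have "S' \<subset> S"
      using v(1) by (metis S'_def Int_lower1 psubsetI)
    then have "span S' \<subset> span S"
      using sub less.prems(1) span_eq_iff by metis
    then have "dim S' < dim S"
      by (rule dim_psubset)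
    from less.hyps[OF this sub inv] obtain B where B: "B \<subseteq> S'" "span B = S'"
      "\<And>b c. b \<in> B \<Longrightarrow> c \<in> B \<Longrightarrow> b \<bullet> c = (if b = c then 1 else 0)"
      "\<And>b. b \<in> B \<Longrightarrow> f b = (b \<bullet> f b) *\<^sub>R b"
      by blast
    have vB: "v \<bullet> b = 0" "b \<bullet> v = 0" if "b \<in> B" for b
      using B(1) that by (auto simp: S'_def inner_commute)
    have vnB: "v \<notin> B"
      using B(1) \<open>v \<notin> S'\<close> by blast
    have "span (insert v B) = S"
    proof
      show "span (insert v B) \<subseteq> S"
        using B(1) v(1) by (intro span_minimal less.prems(1)) (auto simp: S'_def)
      show "S \<subseteq> span (insert v B)"
      proof
        fix x assume x: "x \<in> S"
        have "x - (v \<bullet> x) *\<^sub>R v \<in> S'"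
          using x v(1) less.prems(1) vv
          by (auto simp: S'_def inner_diff_right intro!: subspace_diff subspace_scale)
        then show "x \<in> span (insert v B)"
          using B(2) by (auto simp: span_breakdown_eq)
      qed
    qed
    moreover have "insert v B \<subseteq> S"
      using B(1) v(1) by (auto simp: S'_def)
    ultimately show ?thesis
      using B(3,4) vB v(3) vv vnB by (intro exI[of _ "insert v B"]) auto
  qed
qed

section \<open>Singular values read off from an orthonormal eigenbasis\<close>

lemma gram_selfadjoint:
  fixes T :: "'a::euclidean_space \<Rightarrow> 'a"
  assumes T: "linear T"
  shows "linear (\<lambda>x. adjoint T (T x))" "adjoint T (T x) \<bullet> y = x \<bullet> adjoint T (T y)"
    "x \<bullet> adjoint T (T y) = T x \<bullet> T y"
proof -
  show "linear (\<lambda>x. adjoint T (T x))"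
    using linear_compose[OF T adjoint_linear[OF T]] by (simp add: comp_def)
qed (simp_all add: adjoint_clauses[OF T])

text \<open>Eigenvectors for different eigenvalues are orthogonal, so the eigenspace of
  \<open>e\<close> is spanned by the basis vectors with eigenvalue \<open>e\<close> and its
  dimension counts them. Sorting \<open>bs\<close> by key, not just the numbers, keeps track of the
  eigenvector that belongs to each value.\<close>

lemma singular_values_eigenbasis:
  fixes T :: "'a::euclidean_space \<Rightarrow> 'a"
  assumes T: "linear T"
    and B: "span B = UNIV" "\<And>b c. b \<in> B \<Longrightarrow> c \<in> B \<Longrightarrow> b \<bullet> c = (if b = c then 1 else 0)"
    and ev: "\<And>b. b \<in> B \<Longrightarrow> adjoint T (T b) = eg b *\<^sub>R b"
    and bs: "distinct bs" "set bs = B"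
  shows "singular_values T = rev (map (\<lambda>b. sqrt (eg b)) (sort_key (\<lambda>b. sqrt (eg b)) bs))"
proof -
  let ?A = "\<lambda>x. adjoint T (T x)"
  note A = gram_selfadjoint[OF T]
  have fin: "finite B"
    using bs(2) by auto
  have nz: "b \<noteq> 0" if "b \<in> B" for b
    using B(2)[OF that that] by auto
  have indep: "independent B'" if "B' \<subseteq> B" for B'
    using that B(2) nz
    by (intro pairwise_orthogonal_independent) (auto simp: pairwise_def orthogonal_def subset_iff)
  have expand: "x = (\<Sum>b\<in>B. (x \<bullet> b) *\<^sub>R b)" for x
  proof -
    define y where "y = x - (\<Sum>b\<in>B. (x \<bullet> b) *\<^sub>R b)"
    have "y \<bullet> c = 0" if "c \<in> B" for c
    proof -
      have "(\<Sum>b\<in>B. (x \<bullet> b) * (b \<bullet> c)) = (\<Sum>b\<in>B. if b = c then x \<bullet> c else 0)"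
        using B(2) that by (intro sum.cong) auto
      then show ?thesis
        using fin that by (simp add: y_def inner_diff_left inner_sum_left)
    qed
    then have "span B \<subseteq> {z. y \<bullet> z = 0}"
      by (intro span_minimal subspace_hyperplane) auto
    then have "y \<bullet> y = 0"
      using B(1) by blast
    then show ?thesis
      by (simp add: y_def)
  qed
  have eig: "gram_eigenspace T e = span {b\<in>B. eg b = e}" for e
  proof
    show "gram_eigenspace T e \<subseteq> span {b\<in>B. eg b = e}"
    proof
      fix x assume "x \<in> gram_eigenspace T e"
      then have x: "?A x = e *\<^sub>R x"
        by (simp add: gram_eigenspace_def)
      have "x \<bullet> b = 0" if "b \<in> B" "eg b \<noteq> e" for b
      proof -
        have "e * (x \<bullet> b) = eg b * (x \<bullet> b)"
          using A(2)[of x b] x ev[OF that(1)] by simp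
        then show ?thesis
          using that(2) by auto
      qed
      then have "x = (\<Sum>b\<in>{b\<in>B. eg b = e}. (x \<bullet> b) *\<^sub>R b)"
        using fin by (subst expand, intro sum.mono_neutral_right) auto
      also have "\<dots> \<in> span {b\<in>B. eg b = e}"
        by (intro span_sum span_scale span_base)
      finally show "x \<in> span {b\<in>B. eg b = e}" .
    qed
    show "span {b\<in>B. eg b = e} \<subseteq> gram_eigenspace T e"
    proof (rule span_minimal)
      show "{b\<in>B. eg b = e} \<subseteq> gram_eigenspace T e"
        using ev by (auto simp: gram_eigenspace_def)
      show "subspace (gram_eigenspace T e)"
        using linear_0[OF A(1)] linear_add[OF A(1)] linear_cmul[OF A(1)]
        by (auto simp: subspace_def gram_eigenspace_def scaleR_add_right mult.commute)
    qed
  qed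
  have dime: "dim (gram_eigenspace T e) = card {b\<in>B. eg b = e}" for e
    unfolding eig by (subst dim_span) (auto intro!: dim_eq_card_independent indep)
  have evs: "gram_eigenvalues T = eg ` B"
  proof
    show "gram_eigenvalues T \<subseteq> eg ` B"
    proof
      fix e assume "e \<in> gram_eigenvalues T"
      then have "span {b\<in>B. eg b = e} \<noteq> {0}"
        by (auto simp: gram_eigenvalues_def eig)
      then have "{b\<in>B. eg b = e} \<noteq> {}"
        by (metis span_empty)
      then show "e \<in> eg ` B" by auto
    qed
    show "eg ` B \<subseteq> gram_eigenvalues T"
      using nz ev by (auto simp: gram_eigenvalues_def gram_eigenspace_def)
  qed
  \<comment> \<open>A replicated value is a sum of singletons over the fibre of \<open>eg\<close>,
    so the double sum collapses to a sum over \<open>B\<close>.\<close>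
  have "(\<Sum>e\<in>gram_eigenvalues T. replicate_mset (dim (gram_eigenspace T e)) (sqrt e))
      = (\<Sum>e\<in>eg ` B. \<Sum>b\<in>{b\<in>B. eg b = e}. {#sqrt (eg b)#})"
  proof -
    have "replicate_mset (card X) c = (\<Sum>b\<in>X. {#c#})" if "finite X" for X :: "'a set" and c :: real
      using that by induction auto
    then show ?thesis
      using fin by (simp add: evs dime)
  qed
  also have "\<dots> = (\<Sum>b\<in>B. {#sqrt (eg b)#})"
    using sum.image_gen[OF fin, of "\<lambda>b. {#sqrt (eg b)#}" eg] by simp
  also have "\<dots> = mset (map (\<lambda>b. sqrt (eg b)) (sort_key (\<lambda>b. sqrt (eg b)) bs))"
  proof -
    have "(\<Sum>b\<in>set l. {#sqrt (eg b)#}) = mset (map (\<lambda>b. sqrt (eg b)) l)" if "distinct l" for l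
      using that by (induction l) auto
    from this[OF bs(1)] show ?thesis
      by (simp add: bs(2))
  qed
  finally show ?thesis
    unfolding singular_values_def
    by (simp only: sorted_list_of_multiset_mset) (simp add: sorted_sort_id)
qed

text \<open>The interface to the definition by a sorted list: from here on, arguments about singular
  values start from this ordered basis of right singular vectors. The zero-based index
  \<open>i\<close> belongs to the one-based \<open>Suc i\<close>.\<close>

theorem singular_value_basis:
  fixes T :: "'a::euclidean_space \<Rightarrow> 'a"
  assumes T: "linear T"
  obtains b where "orthonormal_basis b"
    "\<And>i. i < DIM('a) \<Longrightarrow> adjoint T (T (b i)) = (singular_value T (Suc i))\<^sup>2 *\<^sub>R b i"
    "\<And>i j. i \<le> j \<Longrightarrow> j < DIM('a) \<Longrightarrow> singular_value T (Suc j) \<le> singular_value T (Suc i)"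
    "\<And>i. i < DIM('a) \<Longrightarrow> 0 \<le> singular_value T (Suc i)"
proof -
  let ?A = "\<lambda>x. adjoint T (T x)"
  note A = gram_selfadjoint[OF T]
  obtain B where B: "span B = UNIV"
    "\<And>b c. b \<in> B \<Longrightarrow> c \<in> B \<Longrightarrow> b \<bullet> c = (if b = c then 1 else 0)"
    "\<And>b. b \<in> B \<Longrightarrow> ?A b = (b \<bullet> ?A b) *\<^sub>R b"
    using selfadjoint_eigenbasis[OF A(1,2) subspace_UNIV] by auto
  define eg where "eg b = b \<bullet> ?A b" for b
  have "pairwise orthogonal B" "0 \<notin> B"
    using B(2) by (auto simp: pairwise_def orthogonal_def) (metis inner_zero_left zero_neq_one)
  then have indep: "independent B"
    by (rule pairwise_orthogonal_independent)
  then have fin: "finite B"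
    using independent_bound by blast
  have card: "card B = DIM('a)"
    using dim_eq_card_independent[OF indep] B(1) dim_eq_full[of B] by simp
  obtain bs where bs: "distinct bs" "set bs = B"
    using finite_distinct_list[OF fin] by blast
  define L where "L = rev (sort_key (\<lambda>b. sqrt (eg b)) bs)"
  have sv: "singular_values T = map (\<lambda>b. sqrt (eg b)) L"
    using singular_values_eigenbasis[OF T B(1,2) _ bs, of eg] B(3) by (simp add: L_def eg_def rev_map)
  have L: "set L = B" "distinct L" "length L = DIM('a)"
    using bs card by (auto simp: L_def distinct_card[symmetric])
  have svi: "singular_value T (Suc i) = sqrt (eg (L ! i))" if "i < DIM('a)" for i
    using that L(3) by (simp add: singular_value_def sv)
  have ev0: "eg b \<ge> 0" for b
    by (simp add: eg_def A(3))
  have LB: "L ! i \<in> B" if "i < DIM('a)" for i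
    using that L by auto
  have sorted: "sorted (rev (map (\<lambda>b. sqrt (eg b)) L))"
    by (simp add: L_def rev_map)
  show thesis
  proof
    show "orthonormal_basis (\<lambda>i. L ! i)"
      using B(2) LB L(2,3) by (auto simp: orthonormal_basis_def nth_eq_iff_index_eq)
    show "?A (L ! i) = (singular_value T (Suc i))\<^sup>2 *\<^sub>R L ! i" if "i < DIM('a)" for i
      using B(3)[OF LB[OF that]] svi[OF that] ev0[of "L ! i"] by (simp add: eg_def)
    show "singular_value T (Suc j) \<le> singular_value T (Suc i)" if "i \<le> j" "j < DIM('a)" for i j
      using sorted_rev_nth_mono[OF sorted that(1)] that L(3) by (simp add: svi)
    show "0 \<le> singular_value T (Suc i)" if "i < DIM('a)" for i
      using ev0 by (simp add: svi[OF that])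
  qed
qed

section \<open>Min-max comparison of singular values\<close>

lemma norm_singular_value_basis:
  fixes T :: "'a::euclidean_space \<Rightarrow> 'a"
  assumes T: "linear T" and b: "orthonormal_basis b"
    and ev: "\<And>i. i < DIM('a) \<Longrightarrow> adjoint T (T (b i)) = (s i)\<^sup>2 *\<^sub>R b i"
  shows "(norm (T x))\<^sup>2 = (\<Sum>i<DIM('a). (s i)\<^sup>2 * (x \<bullet> b i)\<^sup>2)"
proof -
  note A = gram_selfadjoint[OF T]
  have "(norm (T x))\<^sup>2 = x \<bullet> adjoint T (T x)"
    by (simp add: A(3) power2_norm_eq_inner)
  also have "adjoint T (T x) = (\<Sum>i<DIM('a). (x \<bullet> b i) *\<^sub>R ((s i)\<^sup>2 *\<^sub>R b i))"
    using orthonormal_basis_linear[OF b A(1), of x] ev by simp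
  finally show ?thesis
    by (simp add: inner_sum_right power2_eq_square mult_ac)
qed

text \<open>
  Min-max principle: \<open>R\<close> maps the span of the first \<open>i\<close> right singular vectors of \<open>A\<close> to a space that
  meets the span of the right singular vectors \<open>i, i + 1, \<dots>\<close> of \<open>B\<close>.
\<close>

theorem singular_value_le:
  fixes A B R :: "'a::euclidean_space \<Rightarrow> 'a"
  assumes A: "linear A" and B: "linear B" and R: "linear R" "inj R"
    and c: "0 \<le> c" and r: "0 \<le> r"
    and le: "\<And>x. norm (A x) \<le> c * norm (B (R x))" and Rle: "\<And>x. norm (R x) \<le> r * norm x"
    and i: "1 \<le> i" "i \<le> DIM('a)"
  shows "singular_value A i \<le> c * r * singular_value B i"
proof -
  obtain k where k: "i = Suc k" "k < DIM('a)"
    using i by (metis Suc_le_eq One_nat_def Suc_pred')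
  obtain a where a: "orthonormal_basis a"
    "\<And>i. i < DIM('a) \<Longrightarrow> adjoint A (A (a i)) = (singular_value A (Suc i))\<^sup>2 *\<^sub>R a i"
    "\<And>i j. i \<le> j \<Longrightarrow> j < DIM('a) \<Longrightarrow> singular_value A (Suc j) \<le> singular_value A (Suc i)"
    "\<And>i. i < DIM('a) \<Longrightarrow> 0 \<le> singular_value A (Suc i)"
    using singular_value_basis[OF A] by blast
  obtain b where b: "orthonormal_basis b"
    "\<And>i. i < DIM('a) \<Longrightarrow> adjoint B (B (b i)) = (singular_value B (Suc i))\<^sup>2 *\<^sub>R b i"
    "\<And>i j. i \<le> j \<Longrightarrow> j < DIM('a) \<Longrightarrow> singular_value B (Suc j) \<le> singular_value B (Suc i)"
    "\<And>i. i < DIM('a) \<Longrightarrow> 0 \<le> singular_value B (Suc i)"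
    using singular_value_basis[OF B] by blast
  define V where "V = span (a ` {..k})"
  define W where "W = span (b ` {k..<DIM('a)})"
  have dV: "dim V = Suc k"
    unfolding V_def using k by (subst orthonormal_basis_dim_span[OF a(1)]) auto
  have dW: "dim W = DIM('a) - k"
    unfolding W_def using k by (subst orthonormal_basis_dim_span[OF b(1)]) auto
  have dRV: "dim (R ` V) = Suc k"
    using dim_image_eq[OF R(1)] R(2) dV by (metis inj_on_subset subset_UNIV)
  have sRV: "subspace (R ` V)"
    unfolding V_def by (intro linear_subspace_image R(1) subspace_span)
  \<comment> \<open>The dimensions \<open>Suc k\<close> and \<open>DIM('a) - k\<close> add up to one
    more than that of the whole space, so the two subspaces share a nonzero vector.\<close>
  have "dim {x + y |x y. x \<in> R ` V \<and> y \<in> W} + dim (R ` V \<inter> W) = Suc k + (DIM('a) - k)"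
    using dim_sums_Int[OF sRV, of W] dRV dW by (simp add: W_def)
  moreover have "dim {x + y |x y. x \<in> R ` V \<and> y \<in> W} \<le> DIM('a)"
    by (rule dim_subset_UNIV)
  ultimately have "dim (R ` V \<inter> W) \<noteq> 0"
    using k by linarith
  then obtain y where y: "y \<in> R ` V" "y \<in> W" "y \<noteq> 0"
    by (auto simp: dim_eq_0)
  then obtain x where x: "x \<in> V" "y = R x"
    by blast
  have x0: "x \<noteq> 0"
    using y(3) x(2) linear_0[OF R(1)] by auto
  \<comment> \<open>On \<open>V\<close> only coordinates \<open>j \<le> k\<close> occur, whose
    singular values are at least the one of index \<open>i\<close>; \<open>upper\<close> is the dual
    argument on \<open>W\<close>.\<close>
  have lower: "singular_value A i * norm x \<le> norm (A x)"
  proof (rule power2_le_imp_le)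
    have "(singular_value A i * norm x)\<^sup>2 = (\<Sum>j<DIM('a). (singular_value A i)\<^sup>2 * (x \<bullet> a j)\<^sup>2)"
      by (simp add: power_mult_distrib orthonormal_basis_norm[OF a(1)] sum_distrib_left)
    also have "\<dots> \<le> (\<Sum>j<DIM('a). (singular_value A (Suc j))\<^sup>2 * (x \<bullet> a j)\<^sup>2)"
    proof (rule sum_mono)
      fix j assume j: "j \<in> {..<DIM('a)}"
      show "(singular_value A i)\<^sup>2 * (x \<bullet> a j)\<^sup>2 \<le> (singular_value A (Suc j))\<^sup>2 * (x \<bullet> a j)\<^sup>2"
      proof (cases "j \<le> k")
        case True
        then show ?thesis
          using a(3)[OF True k(2)] a(4)[OF k(2)] k(1) by (intro mult_right_mono power_mono) auto
      next
        case False
        then have "x \<bullet> a j = 0"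
          using x(1) j k unfolding V_def by (intro orthonormal_basis_span_coord[OF a(1), of "{..k}"]) auto
        then show ?thesis by simp
      qed
    qed
    also have "\<dots> = (norm (A x))\<^sup>2"
      using norm_singular_value_basis[OF A a(1,2)] by simp
    finally show "(singular_value A i * norm x)\<^sup>2 \<le> (norm (A x))\<^sup>2" .
  qed simp
  have upper: "norm (B y) \<le> singular_value B i * norm y"
  proof (rule power2_le_imp_le)
    have "(norm (B y))\<^sup>2 = (\<Sum>j<DIM('a). (singular_value B (Suc j))\<^sup>2 * (y \<bullet> b j)\<^sup>2)"
      using norm_singular_value_basis[OF B b(1,2)] by simp
    also have "\<dots> \<le> (\<Sum>j<DIM('a). (singular_value B i)\<^sup>2 * (y \<bullet> b j)\<^sup>2)"
    proof (rule sum_mono)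
      fix j assume j: "j \<in> {..<DIM('a)}"
      show "(singular_value B (Suc j))\<^sup>2 * (y \<bullet> b j)\<^sup>2 \<le> (singular_value B i)\<^sup>2 * (y \<bullet> b j)\<^sup>2"
      proof (cases "k \<le> j")
        case True
        then show ?thesis
          using b(3)[OF True] b(4)[of j] j k(1) by (intro mult_right_mono power_mono) auto
      next
        case False
        then have "y \<bullet> b j = 0"
          using y(2) j k unfolding W_def
          by (intro orthonormal_basis_span_coord[OF b(1), of "{k..<DIM('a)}"]) auto
        then show ?thesis by simp
      qed
    qed
    also have "\<dots> = (singular_value B i * norm y)\<^sup>2"
      by (simp add: power_mult_distrib orthonormal_basis_norm[OF b(1)] sum_distrib_left)
    finally show "(norm (B y))\<^sup>2 \<le> (singular_value B i * norm y)\<^sup>2" .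
    show "0 \<le> singular_value B i * norm y"
      using b(4)[OF k(2)] k(1) by simp
  qed
  have "singular_value A i * norm x \<le> c * norm (B y)"
    using lower le[of x] unfolding x(2) by (rule order_trans)
  also have "\<dots> \<le> c * (singular_value B i * norm y)"
    using upper c by (rule mult_left_mono)
  also have "\<dots> \<le> c * (singular_value B i * (r * norm x))"
    using Rle[of x] x(2) c b(4)[OF k(2)] k(1) by (intro mult_left_mono) auto
  finally have "singular_value A i * norm x \<le> (c * r * singular_value B i) * norm x"
    by (simp add: mult_ac)
  then show ?thesis
    using x0 by simp
qed

lemma singular_value_mono:
  fixes T :: "'a::euclidean_space \<Rightarrow> 'a"
  assumes "linear T" "1 \<le> i" "i \<le> j" "j \<le> DIM('a)"
  shows "singular_value T j \<le> singular_value T i"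
proof -
  have b: "\<And>i j. i \<le> j \<Longrightarrow> j < DIM('a) \<Longrightarrow> singular_value T (Suc j) \<le> singular_value T (Suc i)"
    by (rule singular_value_basis[OF assms(1)])
  obtain i' j' where "i = Suc i'" "j = Suc j'"
    using assms(2,3) by (metis One_nat_def Suc_le_D le_trans)
  then show ?thesis
    using b[of i' j'] assms(3,4) by simp
qed

text \<open>The images of the right singular vectors are orthogonal, because the inner product of
  \<open>T x\<close> and \<open>T y\<close> is that of \<open>x\<close> with the Gram map at
  \<open>y\<close>. Injectivity makes them nonzero, and normalising them gives the left singular
  vectors \<open>c\<close>.\<close>

lemma singular_value_decomposition:
  fixes T :: "'a::euclidean_space \<Rightarrow> 'a"
  assumes T: "linear T" "inj T"
  obtains b c where "orthonormal_basis b" "orthonormal_basis c"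
    "\<And>i. i < DIM('a) \<Longrightarrow> T (b i) = singular_value T (Suc i) *\<^sub>R c i"
    "\<And>i. i < DIM('a) \<Longrightarrow> 0 < singular_value T (Suc i)"
proof -
  obtain b where b: "orthonormal_basis b"
    "\<And>i. i < DIM('a) \<Longrightarrow> adjoint T (T (b i)) = (singular_value T (Suc i))\<^sup>2 *\<^sub>R b i"
    "\<And>i j. i \<le> j \<Longrightarrow> j < DIM('a) \<Longrightarrow> singular_value T (Suc j) \<le> singular_value T (Suc i)"
    "\<And>i. i < DIM('a) \<Longrightarrow> 0 \<le> singular_value T (Suc i)"
    using singular_value_basis[OF T(1)] by blast
  have ip: "T (b i) \<bullet> T (b j) = (if i = j then (singular_value T (Suc j))\<^sup>2 else 0)"
    if "i < DIM('a)" "j < DIM('a)" for i j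
    using gram_selfadjoint(3)[OF T(1), of "b i" "b j"] b(2)[OF that(2)]
      orthonormal_basis_inner[OF b(1) that] by auto
  have pos: "0 < singular_value T (Suc i)" if "i < DIM('a)" for i
  proof -
    have "b i \<noteq> 0"
      using orthonormal_basis_inner[OF b(1) that that] by auto
    then have "T (b i) \<noteq> 0"
      using T by (metis linear_injective_0)
    then have "singular_value T (Suc i) \<noteq> 0"
      using ip[OF that that] by auto
    then show ?thesis
      using b(4)[OF that] by simp
  qed
  define c where "c i = T (b i) /\<^sub>R singular_value T (Suc i)" for i
  have "orthonormal_basis c"
    unfolding orthonormal_basis_def
  proof (intro allI impI)
    fix i j assume ij: "i < DIM('a)" "j < DIM('a)"
    show "c i \<bullet> c j = (if i = j then 1 else 0)"
      using ip[OF ij] pos[OF ij(1)] by (auto simp: c_def power2_eq_square field_simps)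
  qed
  moreover have "T (b i) = singular_value T (Suc i) *\<^sub>R c i" if "i < DIM('a)" for i
    using pos[OF that] by (simp add: c_def)
  ultimately show thesis
    using that[OF b(1)] pos by blast
qed

lemma singular_value_pos:
  fixes T :: "'a::euclidean_space \<Rightarrow> 'a"
  assumes T: "linear T" "inj T" and i: "1 \<le> i" "i \<le> DIM('a)"
  shows "0 < singular_value T i"
proof -
  have "0 < singular_value T (Suc j)" if "j < DIM('a)" for j
    by (rule singular_value_decomposition[OF T]) (use that in blast)
  from this[of "i - 1"] show ?thesis
    using i by simp
qed

lemma norm_le_singular_value:
  fixes T :: "'a::euclidean_space \<Rightarrow> 'a"
  assumes T: "linear T"
  shows "norm (T x) \<le> singular_value T 1 * norm x"
    and "singular_value T DIM('a) * norm x \<le> norm (T x)"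
proof -
  obtain b where b: "orthonormal_basis b"
    "\<And>i. i < DIM('a) \<Longrightarrow> adjoint T (T (b i)) = (singular_value T (Suc i))\<^sup>2 *\<^sub>R b i"
    "\<And>i j. i \<le> j \<Longrightarrow> j < DIM('a) \<Longrightarrow> singular_value T (Suc j) \<le> singular_value T (Suc i)"
    "\<And>i. i < DIM('a) \<Longrightarrow> 0 \<le> singular_value T (Suc i)"
    using singular_value_basis[OF T] by blast
  have D: "0 < DIM('a)" by simp
  then have SD: "Suc (DIM('a) - 1) = DIM('a)" by simp
  note nT = norm_singular_value_basis[OF T b(1,2), of x]
  show "norm (T x) \<le> singular_value T 1 * norm x"
  proof (rule power2_le_imp_le)
    have "(norm (T x))\<^sup>2 \<le> (\<Sum>i<DIM('a). (singular_value T 1)\<^sup>2 * (x \<bullet> b i)\<^sup>2)"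
      using b(3)[of 0] b(4) by (subst nT) (auto intro!: sum_mono mult_right_mono power_mono)
    then show "(norm (T x))\<^sup>2 \<le> (singular_value T 1 * norm x)\<^sup>2"
      by (simp add: power_mult_distrib orthonormal_basis_norm[OF b(1)] sum_distrib_left)
    show "0 \<le> singular_value T 1 * norm x"
      using b(4)[OF D] by simp
  qed
  show "singular_value T DIM('a) * norm x \<le> norm (T x)"
  proof (rule power2_le_imp_le)
    have "(\<Sum>i<DIM('a). (singular_value T DIM('a))\<^sup>2 * (x \<bullet> b i)\<^sup>2) \<le> (norm (T x))\<^sup>2"
      using b(3)[of _ "DIM('a) - 1"] b(4)[of "DIM('a) - 1"] SD
      by (subst nT) (auto intro!: sum_mono mult_right_mono power_mono)
    then show "(singular_value T DIM('a) * norm x)\<^sup>2 \<le> (norm (T x))\<^sup>2"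
      by (simp add: power_mult_distrib orthonormal_basis_norm[OF b(1)] sum_distrib_left)
  qed simp
qed

text \<open>Four instances of \<open>singular_value_le\<close>. The upper bounds absorb the outer
  factor into \<open>c\<close> or take the inner one as \<open>R\<close>; the lower bounds undo a
  factor, since a map stretches every vector at least by its smallest singular value, the last one
  with \<open>R = inv U\<close>.\<close>

lemma singular_value_compose:
  fixes T U :: "'a::euclidean_space \<Rightarrow> 'a"
  assumes T: "linear T" "bij T" and U: "linear U" "bij U" and i: "1 \<le> i" "i \<le> DIM('a)"
  shows "singular_value (T \<circ> U) i \<le> singular_value T 1 * singular_value U i"
    and "singular_value (T \<circ> U) i \<le> singular_value U 1 * singular_value T i"
    and "singular_value T DIM('a) * singular_value U i \<le> singular_value (T \<circ> U) i"
    and "singular_value U DIM('a) * singular_value T i \<le> singular_value (T \<circ> U) i"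
proof -
  have TU: "linear (T \<circ> U)"
    by (intro linear_compose T U)
  have pos: "0 < singular_value T j" "0 < singular_value U j" if "1 \<le> j" "j \<le> DIM('a)" for j
    using T U that by (auto intro!: singular_value_pos simp: bij_is_inj)
  have pT: "0 < singular_value T 1" "0 < singular_value T DIM('a)"
    and pU: "0 < singular_value U 1" "0 < singular_value U DIM('a)"
    using pos by (auto simp: Suc_leI)
  show "singular_value (T \<circ> U) i \<le> singular_value T 1 * singular_value U i"
    using singular_value_le[OF TU U(1) linear_id inj_on_id _ _ _ _ i, of "singular_value T 1" 1]
      norm_le_singular_value(1)[OF T(1)] pT by simp
  show "singular_value (T \<circ> U) i \<le> singular_value U 1 * singular_value T i"
    using singular_value_le[OF TU T(1) U(1) bij_is_inj[OF U(2)] _ _ _ _ i, of 1 "singular_value U 1"]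
      norm_le_singular_value(1)[OF U(1)] pU by simp
  have "singular_value U i \<le> inverse (singular_value T DIM('a)) * 1 * singular_value (T \<circ> U) i"
  proof (rule singular_value_le[OF U(1) TU linear_id inj_on_id _ _ _ _ i])
    show "norm (U x) \<le> inverse (singular_value T DIM('a)) * norm ((T \<circ> U) (id x))" for x
      using norm_le_singular_value(2)[OF T(1), of "U x"] pT by (simp add: field_simps)
  qed (use pT in auto)
  then show "singular_value T DIM('a) * singular_value U i \<le> singular_value (T \<circ> U) i"
    using pT by (simp add: field_simps)
  have iU: "U (inv U x) = x" for x
    using U(2) by (simp add: bij_is_surj surj_f_inv_f)
  have "singular_value T i \<le> 1 * inverse (singular_value U DIM('a)) * singular_value (T \<circ> U) i"
  proof (rule singular_value_le[OF T(1) TU _ _ _ _ _ _ i])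
    show "linear (inv U)"
      using U by (simp add: inj_linear_imp_inv_linear bij_is_inj)
    show "inj (inv U)"
      using U(2) by (simp add: bij_imp_bij_inv bij_is_inj)
    show "norm (inv U x) \<le> inverse (singular_value U DIM('a)) * norm x" for x
      using norm_le_singular_value(2)[OF U(1), of "inv U x"] pU iU by (simp add: field_simps)
  qed (use pU iU in auto)
  then show "singular_value U DIM('a) * singular_value T i \<le> singular_value (T \<circ> U) i"
    using pU by (simp add: field_simps)
qed

section \<open>Diagonal maps, determinants and Horn's inequality\<close>

definition diag_map :: "(nat \<Rightarrow> 'a::euclidean_space) \<Rightarrow> (nat \<Rightarrow> real) \<Rightarrow> 'a \<Rightarrow> 'a" where
  "diag_map c d x = (\<Sum>i<DIM('a). (d i * (x \<bullet> c i)) *\<^sub>R c i)"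

lemma diag_map_linear: "linear (diag_map c d)"
  unfolding diag_map_def
  by (intro linearI) (simp_all add: inner_add_left algebra_simps sum.distrib scaleR_sum_right)

context
  fixes c :: "nat \<Rightarrow> 'a::euclidean_space"
  assumes c: "orthonormal_basis c"
begin

lemma diag_map_inner:
  assumes "j < DIM('a)"
  shows "diag_map c d x \<bullet> c j = d j * (x \<bullet> c j)"
proof -
  have "diag_map c d x \<bullet> c j = (\<Sum>i<DIM('a). if i = j then d j * (x \<bullet> c j) else 0)"
    unfolding diag_map_def inner_sum_left
    using orthonormal_basis_inner[OF c _ assms] by (intro sum.cong) auto
  then show ?thesis
    using assms by simp
qed

lemma diag_map_basis:
  assumes "j < DIM('a)"
  shows "diag_map c d (c j) = d j *\<^sub>R c j"
proof -
  have "diag_map c d (c j) = (\<Sum>i<DIM('a). if i = j then d j *\<^sub>R c j else 0)"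
    unfolding diag_map_def
    using orthonormal_basis_inner[OF c assms] by (intro sum.cong) auto
  then show ?thesis
    using assms by simp
qed

lemma diag_map_cong:
  "(\<And>i. i < DIM('a) \<Longrightarrow> d i = d' i) \<Longrightarrow> diag_map c d = diag_map c d'"
  by (rule ext) (simp add: diag_map_def)

lemma diag_map_compose: "diag_map c d \<circ> diag_map c d' = diag_map c (\<lambda>i. d i * d' i)"
proof
  fix x
  show "(diag_map c d \<circ> diag_map c d') x = diag_map c (\<lambda>i. d i * d' i) x"
    unfolding comp_def diag_map_def[of c d] diag_map_def[of c "\<lambda>i. d i * d' i"]
    by (intro sum.cong) (auto simp: diag_map_inner)
qed

lemma diag_map_const: "diag_map c (\<lambda>_. r) x = r *\<^sub>R x"
  unfolding diag_map_def
  by (subst (2) orthonormal_basis_expand[OF c, of x]) (simp add: scaleR_sum_right)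

lemma norm_diag_map_le:
  assumes "\<And>i. i < DIM('a) \<Longrightarrow> \<bar>d i\<bar> \<le> r"
  shows "norm (diag_map c d x) \<le> r * norm x"
proof (rule power2_le_imp_le)
  have r: "r \<ge> 0"
    using assms[of 0] by simp
  have "(norm (diag_map c d x))\<^sup>2 = (\<Sum>i<DIM('a). (d i)\<^sup>2 * (x \<bullet> c i)\<^sup>2)"
    by (simp add: orthonormal_basis_norm[OF c] diag_map_inner power_mult_distrib)
  also have "\<dots> \<le> (\<Sum>i<DIM('a). r\<^sup>2 * (x \<bullet> c i)\<^sup>2)"
    using assms r by (intro sum_mono mult_right_mono) (auto simp: abs_le_square_iff[symmetric])
  finally show "(norm (diag_map c d x))\<^sup>2 \<le> (r * norm x)\<^sup>2"
    by (simp add: power_mult_distrib orthonormal_basis_norm[OF c] sum_distrib_left)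
  show "0 \<le> r * norm x"
    using r by simp
qed

lemma diag_map_inverse:
  assumes "\<And>i. i < DIM('a) \<Longrightarrow> d i \<noteq> 0"
  shows "diag_map c d (diag_map c (\<lambda>i. inverse (d i)) x) = x"
    and "diag_map c (\<lambda>i. inverse (d i)) (diag_map c d x) = x"
proof -
  have "diag_map c d \<circ> diag_map c (\<lambda>i. inverse (d i)) = diag_map c (\<lambda>_. 1)"
    "diag_map c (\<lambda>i. inverse (d i)) \<circ> diag_map c d = diag_map c (\<lambda>_. 1)"
    unfolding diag_map_compose using assms by (auto intro!: diag_map_cong)
  then show "diag_map c d (diag_map c (\<lambda>i. inverse (d i)) x) = x"
    "diag_map c (\<lambda>i. inverse (d i)) (diag_map c d x) = x"
    by (metis comp_apply diag_map_const scaleR_one)+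
qed

lemma diag_map_bij:
  assumes "\<And>i. i < DIM('a) \<Longrightarrow> d i \<noteq> 0"
  shows "bij (diag_map c d)"
  by (rule o_bij[of "diag_map c (\<lambda>i. inverse (d i))"])
    (use diag_map_inverse[OF assms] in \<open>auto simp: fun_eq_iff\<close>)

end

text \<open>With the basis vectors as columns, \<open>C b\<close> and \<open>C c\<close> are
  orthogonal matrices, and \<open>matrix T ** C b = C c ** S\<close> with \<open>S\<close> diagonal.
  The bijection \<open>h\<close> transfers the numbering of the bases to the finite index
  type.\<close>

lemma abs_det_orthonormal:
  fixes T :: "real^'n \<Rightarrow> real^'n"
  assumes T: "linear T" and b: "orthonormal_basis b" and c: "orthonormal_basis c"
    and Tb: "\<And>i. i < CARD('n) \<Longrightarrow> T (b i) = s i *\<^sub>R c i"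
  shows "\<bar>det (matrix T)\<bar> = (\<Prod>i<CARD('n). \<bar>s i\<bar>)"
proof -
  obtain h :: "'n \<Rightarrow> nat" where h: "bij_betw h UNIV {..<CARD('n)}"
    using ex_bij_betw_finite_nat[of "UNIV :: 'n set"] by (auto simp: atLeast0LessThan)
  have hlt: "h j < CARD('n)" for j
    using h by (auto simp: bij_betw_def)
  have hinj: "h i = h j \<longleftrightarrow> i = j" for i j
    using h by (auto simp: bij_betw_def inj_eq)
  define C :: "(nat \<Rightarrow> real^'n) \<Rightarrow> real^'n^'n" where "C a = (\<chi> i j. a (h j) $ i)" for a
  have detC: "\<bar>det (C a)\<bar> = 1" if "orthonormal_basis a" for a
  proof -
    have "transpose (C a) ** C a = mat 1"
      using orthonormal_basis_inner[OF that] hlt hinj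
      by (simp add: vec_eq_iff matrix_matrix_mult_def transpose_def C_def mat_def inner_vec_def)
    then have "orthogonal_matrix (C a)"
      by (simp add: orthogonal_matrix)
    then show ?thesis
      using det_orthogonal_matrix by fastforce
  qed
  define S :: "real^'n^'n" where "S = (\<chi> i j. if i = j then s (h j) else 0)"
  have "matrix T ** C b = C c ** S"
  proof -
    have "(matrix T ** C b) $ i $ j = T (b (h j)) $ i" for i j
    proof -
      have "(matrix T ** C b) $ i $ j = (matrix T *v b (h j)) $ i"
        by (simp add: matrix_matrix_mult_def matrix_vector_mult_def C_def)
      also have "matrix T *v b (h j) = T (b (h j))"
        by (simp add: matrix_vector_mul(2)[OF T] T)
      finally show ?thesis .
    qed
    moreover have "(C c ** S) $ i $ j = s (h j) * c (h j) $ i" for i j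
      by (simp add: matrix_matrix_mult_def C_def S_def if_distrib cong: if_cong)
    ultimately show ?thesis
      using Tb hlt by (simp add: vec_eq_iff)
  qed
  then have "\<bar>det (matrix T)\<bar> = \<bar>det S\<bar>"
    using detC[OF b] detC[OF c] by (metis abs_mult det_mul mult.commute mult_1)
  also have "\<dots> = (\<Prod>j\<in>UNIV. \<bar>s (h j)\<bar>)"
    by (simp add: det_diagonal S_def abs_prod)
  also have "\<dots> = (\<Prod>i<CARD('n). \<bar>s i\<bar>)"
    by (rule prod.reindex_bij_betw[OF h])
  finally show ?thesis .
qed

text \<open>For \<open>k \<le> DIM('a)\<close> this is the operator norm of the \<open>k\<close>-th
  exterior power of \<open>T\<close>.\<close>

definition singular_prod :: "nat \<Rightarrow> ('a::euclidean_space \<Rightarrow> 'a) \<Rightarrow> real" where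
  "singular_prod k T = (\<Prod>i<k. singular_value T (Suc i))"

lemma abs_det_singular_prod:
  fixes T :: "real^'n \<Rightarrow> real^'n"
  assumes T: "linear T" "inj T"
  shows "\<bar>det (matrix T)\<bar> = singular_prod CARD('n) T"
proof -
  obtain b c where bc: "orthonormal_basis b" "orthonormal_basis c"
    "\<And>i. i < DIM(real^'n) \<Longrightarrow> T (b i) = singular_value T (Suc i) *\<^sub>R c i"
    "\<And>i. i < DIM(real^'n) \<Longrightarrow> 0 < singular_value T (Suc i)"
    using singular_value_decomposition[OF T] by blast
  show ?thesis
    unfolding singular_prod_def using bc(3,4)
    by (subst abs_det_orthonormal[OF T(1) bc(1,2)]) (auto intro!: prod.cong abs_of_pos)
qed

text \<open>The full product is the absolute determinant, so Horn's inequality is an equality here.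
  This equality later converts lower bounds on the last singular values into upper bounds on the
  first ones.\<close>

lemma singular_prod_full:
  fixes T U :: "real^'n \<Rightarrow> real^'n"
  assumes "linear T" "bij T" "linear U" "bij U"
  shows "singular_prod CARD('n) (T \<circ> U) = singular_prod CARD('n) T * singular_prod CARD('n) U"
  using assms
  by (simp add: abs_det_singular_prod[symmetric] bij_is_inj linear_compose inj_compose
      matrix_compose det_mul abs_mult)

lemma singular_prod_split:
  fixes T :: "'a::euclidean_space \<Rightarrow> 'a"
  assumes "k \<le> n"
  shows "singular_prod n T = singular_prod k T * (\<Prod>i\<in>{k..<n}. singular_value T (Suc i))"
  unfolding singular_prod_def
  using assms prod.atLeastLessThan_concat[of 0 k n "\<lambda>i. singular_value T (Suc i)"]
  by (simp add: atLeast0LessThan)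

text \<open>
  A map equal to \<open>1\<close> on the first \<open>r\<close> axes and to \<open>q \<le> 1\<close> on the others is a contraction, which
  settles \<open>k \<le> r\<close>. For \<open>k > r\<close> it shrinks the last singular values at most by \<open>q\<close>, while its effect
  on the product of all of them is known from the determinant.
\<close>

lemma singular_prod_diag_step:
  fixes T :: "real^'n \<Rightarrow> real^'n" and r :: nat
  assumes T: "linear T" "bij T" and c: "orthonormal_basis c" and q: "0 < q" "q \<le> 1"
    and k: "k \<le> CARD('n)"
  defines "E \<equiv> diag_map c (\<lambda>i. if i < r then 1 else q)"
  shows "singular_prod k (T \<circ> E) \<le> q ^ (k - r) * singular_prod k T"
proof -
  let ?n = "CARD('n)"
  have E: "linear E" "bij E"
    unfolding E_def using q by (intro diag_map_linear diag_map_bij c; auto split: if_splits)+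
  have TE: "linear (T \<circ> E)" "bij (T \<circ> E)"
    using T E by (auto intro!: linear_compose bij_comp)
  have posT: "0 < singular_value T (Suc i)" if "i < ?n" for i
    using singular_value_pos[OF T(1) bij_is_inj[OF T(2)], of "Suc i"] that by simp
  have posTE: "0 < singular_value (T \<circ> E) (Suc i)" if "i < ?n" for i
    using singular_value_pos[OF TE(1) bij_is_inj[OF TE(2)], of "Suc i"] that by simp
  have le: "singular_value (T \<circ> E) (Suc i) \<le> singular_value T (Suc i)" if "i < ?n" for i
    using singular_value_le[OF TE(1) T(1) E(1) bij_is_inj[OF E(2)], of 1 1 "Suc i"]
      norm_diag_map_le[OF c, of "\<lambda>i. if i < r then 1 else q" 1] q that by (simp add: E_def)
  show ?thesis
  proof (cases "k \<le> r")
    case True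
    have "singular_prod k (T \<circ> E) \<le> singular_prod k T"
      unfolding singular_prod_def using le posTE k by (intro prod_mono) (auto simp: less_imp_le)
    then show ?thesis
      using True by simp
  next
    case False
    define E' where "E' = diag_map c (\<lambda>i. inverse (if i < r then 1 else q))"
    have E': "E (E' x) = x" for x
      unfolding E_def E'_def using q by (intro diag_map_inverse[OF c]) auto
    have bijE': "linear E'" "inj E'"
      unfolding E'_def using q by (intro diag_map_linear bij_is_inj diag_map_bij c; auto split: if_splits)+
    \<comment> \<open>\<open>T\<close> is \<open>T \<circ> E\<close> precomposed with
      \<open>E'\<close>, which stretches by at most \<open>inverse q\<close>.\<close>
    have ge: "q * singular_value T (Suc i) \<le> singular_value (T \<circ> E) (Suc i)" if "i < ?n" for i
    proof -
      have "singular_value T (Suc i) \<le> 1 * inverse q * singular_value (T \<circ> E) (Suc i)"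
      proof (rule singular_value_le[OF T(1) TE(1) bijE'])
        show "norm (E' x) \<le> inverse q * norm x" for x
          unfolding E'_def using q by (intro norm_diag_map_le[OF c]) (auto simp: one_le_inverse)
      qed (use q that E' in auto)
      then show ?thesis
        using q by (simp add: field_simps)
    qed
    have "\<bar>det (matrix E)\<bar> = (\<Prod>i<?n. if i < r then 1 else q)"
      using q by (subst abs_det_orthonormal[OF E(1) c c, of "\<lambda>i. if i < r then 1 else q"])
        (auto simp: E_def diag_map_basis[OF c] intro!: prod.cong)
    also have "\<dots> = (\<Prod>i<r. 1) * (\<Prod>i\<in>{r..<?n}. q)"
    proof -
      have "{..<?n} = {..<r} \<union> {r..<?n}" using False k by auto
      then show ?thesis
        by (simp add: prod.union_disjoint ivl_disj_int)
    qed
    finally have detE: "singular_prod ?n E = q ^ (?n - r)"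
      by (simp add: abs_det_singular_prod E bij_is_inj)
    let ?tT = "\<Prod>i\<in>{k..<?n}. singular_value T (Suc i)"
    let ?tTE = "\<Prod>i\<in>{k..<?n}. singular_value (T \<circ> E) (Suc i)"
    \<comment> \<open>With \<open>n = CARD('n)\<close>: the full product drops by exactly
      \<open>q ^ (n - r)\<close>, and its last \<open>n - k\<close> factors drop by no more than
      \<open>q ^ (n - k)\<close>. The first \<open>k\<close> factors must therefore account for the
      remaining \<open>q ^ (k - r)\<close>.\<close>
    have "singular_prod k (T \<circ> E) * (q ^ (?n - k) * ?tT) \<le> singular_prod k (T \<circ> E) * ?tTE"
    proof (rule mult_left_mono)
      have "q ^ (?n - k) * ?tT = (\<Prod>i\<in>{k..<?n}. q * singular_value T (Suc i))"
        by (simp add: prod.distrib)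
      also have "\<dots> \<le> ?tTE"
        using ge posT q by (intro prod_mono) (auto simp: less_imp_le)
      finally show "q ^ (?n - k) * ?tT \<le> ?tTE" .
      show "0 \<le> singular_prod k (T \<circ> E)"
        unfolding singular_prod_def using posTE k by (intro prod_nonneg) (auto simp: less_imp_le)
    qed
    also have "\<dots> = singular_prod ?n (T \<circ> E)"
      using singular_prod_split[OF k] by metis
    also have "\<dots> = q ^ (?n - r) * (singular_prod k T * ?tT)"
      unfolding singular_prod_full[OF T E] detE by (subst singular_prod_split[OF k]) (rule mult.commute)
    also have "q ^ (?n - r) = q ^ (k - r) * q ^ (?n - k)"
      using False k by (simp add: power_add[symmetric])
    finally have "singular_prod k (T \<circ> E) * (q ^ (?n - k) * ?tT)
        \<le> (q ^ (k - r) * singular_prod k T) * (q ^ (?n - k) * ?tT)"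
      by (simp only: mult_ac)
    moreover have "0 < q ^ (?n - k) * ?tT"
      using q posT by (intro mult_pos_pos prod_pos) auto
    ultimately show ?thesis
      by (simp add: mult_le_cancel_right)
  qed
qed

text \<open>Induction on \<open>m\<close> for the sequence frozen after index \<open>m\<close>, with
  entries \<open>d (min i m)\<close>. For \<open>m = 0\<close> the map is a scalar; passing to
  \<open>Suc m\<close> multiplies the axes beyond \<open>m\<close> by the ratio
  \<open>d (Suc m) / d m \<le> 1\<close>, which is a step with \<open>r = Suc m\<close>. Freezing at
  \<open>CARD('n)\<close> leaves the map unchanged.\<close>

lemma singular_prod_diag:
  fixes T :: "real^'n \<Rightarrow> real^'n"
  assumes T: "linear T" "bij T" and c: "orthonormal_basis c"
    and d: "\<And>i. 0 < d i" "\<And>i j. i \<le> j \<Longrightarrow> d j \<le> d i" and k: "k \<le> CARD('n)"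
  shows "singular_prod k (T \<circ> diag_map c d) \<le> (\<Prod>i<k. d i) * singular_prod k T"
proof -
  have posT: "0 < singular_value T (Suc i)" if "i < CARD('n)" for i
    using singular_value_pos[OF T(1) bij_is_inj[OF T(2)], of "Suc i"] that by simp
  have *: "singular_prod k (T \<circ> diag_map c (\<lambda>i. d (min i m))) \<le> (\<Prod>i<k. d (min i m)) * singular_prod k T"
    for m
  proof (induction m)
    case 0
    let ?F = "diag_map c (\<lambda>_. d 0)"
    have F: "linear ?F" "bij ?F"
      using d(1)[of 0] by (auto intro!: diag_map_linear diag_map_bij c)
    have "singular_value (T \<circ> ?F) (Suc i) \<le> d 0 * singular_value T (Suc i)" if "i < k" for i
      using singular_value_le[OF linear_compose[OF F(1) T(1)] T(1) F(1) bij_is_inj[OF F(2)], of 1 "d 0" "Suc i"]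
        that k d(1)[of 0] by (simp add: diag_map_const[OF c])
    moreover have "0 < singular_value (T \<circ> ?F) (Suc i)" if "i < k" for i
      using singular_value_pos[of "T \<circ> ?F" "Suc i"] T F that k
      by (simp add: linear_compose bij_is_inj inj_compose)
    ultimately have "singular_prod k (T \<circ> ?F) \<le> (\<Prod>i<k. d 0 * singular_value T (Suc i))"
      unfolding singular_prod_def by (intro prod_mono) (auto simp: less_imp_le)
    also have "\<dots> = (\<Prod>i<k. d (min i 0)) * singular_prod k T"
      by (simp add: singular_prod_def prod.distrib)
    finally show ?case
      by (simp only: min_0R)
  next
    case (Suc m)
    let ?F = "diag_map c (\<lambda>i. d (min i m))"
    define q where "q = d (Suc m) / d m"
    have q: "0 < q" "q \<le> 1"
      using d(1)[of m] d(1)[of "Suc m"] d(2)[of m "Suc m"] by (auto simp: q_def)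
    let ?e = "\<lambda>i. if i < Suc m then 1 else q"
    have de: "d (min i m) * ?e i = d (min i (Suc m))" for i
      using d(1)[of m] by (auto simp: q_def min_def)
    have F: "linear ?F" "bij ?F"
      using d(1) by (auto intro!: diag_map_linear diag_map_bij c simp: less_imp_neq[symmetric])
    have "T \<circ> diag_map c (\<lambda>i. d (min i (Suc m))) = (T \<circ> ?F) \<circ> diag_map c ?e"
      by (simp only: comp_assoc diag_map_compose[OF c] de)
    then have "singular_prod k (T \<circ> diag_map c (\<lambda>i. d (min i (Suc m))))
        \<le> q ^ (k - Suc m) * singular_prod k (T \<circ> ?F)"
      using singular_prod_diag_step[OF linear_compose[OF F(1) T(1)] bij_comp[OF F(2) T(2)] c q k, of "Suc m"]
      by simp
    also have "\<dots> \<le> q ^ (k - Suc m) * ((\<Prod>i<k. d (min i m)) * singular_prod k T)"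
      by (intro mult_left_mono Suc.IH) (use q in auto)
    also have "q ^ (k - Suc m) = (\<Prod>i<k. ?e i)"
    proof -
      have "(\<Prod>i<k. ?e i) = (\<Prod>i\<in>{Suc m..<k}. q)"
        by (intro prod.mono_neutral_cong_right) auto
      then show ?thesis by simp
    qed
    also have "\<dots> * ((\<Prod>i<k. d (min i m)) * singular_prod k T)
        = (\<Prod>i<k. d (min i (Suc m))) * singular_prod k T"
      by (simp only: de[symmetric] prod.distrib mult_ac)
    finally show ?case .
  qed
  have "diag_map c (\<lambda>i. d (min i CARD('n))) = diag_map c d"
    by (intro diag_map_cong) (auto simp: min_def c)
  moreover have "(\<Prod>i<k. d (min i CARD('n))) = (\<Prod>i<k. d i)"
    using k by (intro prod.cong) auto
  ultimately show ?thesis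
    using *[of "CARD('n)"] by simp
qed

text \<open>Horn's inequality; \<open>U\<close> is a diagonal map after an isometry \<open>Q\<close> by its polar decomposition.\<close>

theorem singular_prod_mult_le:
  fixes T U :: "real^'n \<Rightarrow> real^'n"
  assumes T: "linear T" "bij T" and U: "linear U" "bij U" and k: "k \<le> CARD('n)"
  shows "singular_prod k (T \<circ> U) \<le> singular_prod k T * singular_prod k U"
proof -
  let ?n = "CARD('n)"
  obtain b c where bc: "orthonormal_basis b" "orthonormal_basis c"
    "\<And>i. i < DIM(real^'n) \<Longrightarrow> U (b i) = singular_value U (Suc i) *\<^sub>R c i"
    "\<And>i. i < DIM(real^'n) \<Longrightarrow> 0 < singular_value U (Suc i)"
    using singular_value_decomposition[OF U(1) bij_is_inj[OF U(2)]] by blast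
  \<comment> \<open>Continued as a constant beyond the last index, because
    \<open>singular_prod_diag\<close> asks for a positive decreasing sequence on all of
    \<open>nat\<close>.\<close>
  define d where "d i = singular_value U (Suc (min i (?n - 1)))" for i
  \<comment> \<open>Takes the right singular vectors of \<open>U\<close> to the left ones, hence
    preserves norms.\<close>
  define Q where "Q x = (\<Sum>i<?n. (x \<bullet> b i) *\<^sub>R c i)" for x
  have Qc: "Q x \<bullet> c j = x \<bullet> b j" if "j < ?n" for x j
  proof -
    have "Q x \<bullet> c j = (\<Sum>i<?n. if i = j then x \<bullet> b j else 0)"
      unfolding Q_def inner_sum_left
      using orthonormal_basis_inner[OF bc(2), of _ j] that by (intro sum.cong) auto
    then show ?thesis
      using that by simp
  qed
  have Q: "linear Q"
    unfolding Q_def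
    by (intro linearI) (simp_all add: inner_add_left algebra_simps sum.distrib scaleR_sum_right)
  have "(norm (Q x))\<^sup>2 = (norm x)\<^sup>2" for x
    using Qc by (simp add: orthonormal_basis_norm[OF bc(1), of x] orthonormal_basis_norm[OF bc(2), of "Q x"])
  then have normQ: "norm (Q x) = norm x" for x
    by (simp add: power2_eq_iff_nonneg)
  have injQ: "inj Q"
    using Q normQ by (auto simp: linear_injective_0) (metis norm_eq_zero)
  have pos: "0 < d i" for i
  proof -
    have "min i (?n - 1) < DIM(real^'n)"
      using le_less_trans[OF min.cobounded2, of "?n - 1" ?n i] by simp
    then show ?thesis
      unfolding d_def by (rule bc(4))
  qed
  have anti: "d j \<le> d i" if "i \<le> j" for i j
    unfolding d_def by (intro singular_value_mono U) (use that in \<open>auto simp: min_def Suc_le_eq intro: le_less_trans\<close>)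
  have dU: "d i = singular_value U (Suc i)" if "i < ?n" for i
    using that by (auto simp: d_def min_def)
  have UQ: "U x = diag_map c d (Q x)" for x
    using bc(3) dU
    by (simp add: orthonormal_basis_linear[OF bc(1) U(1), of x] diag_map_def Qc mult.commute)
  have F: "linear (diag_map c d)" "bij (diag_map c d)"
    using pos by (auto intro!: diag_map_linear diag_map_bij bc simp: less_imp_neq[symmetric])
  \<comment> \<open>Precomposing with the norm-preserving \<open>Q\<close> does not raise a singular
    value, by the min-max comparison with both constants equal to 1.\<close>
  have "singular_value (T \<circ> U) (Suc i) \<le> singular_value (T \<circ> diag_map c d) (Suc i)" if "i < k" for i
    using singular_value_le[OF linear_compose[OF U(1) T(1)] linear_compose[OF F(1) T(1)] Q injQ, of 1 1 "Suc i"]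
      that k by (simp add: UQ normQ)
  moreover have "0 < singular_value (T \<circ> U) (Suc i)" if "i < k" for i
    using singular_value_pos[of "T \<circ> U" "Suc i"] T U that k
    by (simp add: linear_compose bij_is_inj inj_compose)
  ultimately have "singular_prod k (T \<circ> U) \<le> singular_prod k (T \<circ> diag_map c d)"
    unfolding singular_prod_def by (intro prod_mono) (auto simp: less_imp_le)
  also have "\<dots> \<le> (\<Prod>i<k. d i) * singular_prod k T"
    by (intro singular_prod_diag T bc pos anti k)
  also have "(\<Prod>i<k. d i) = singular_prod k U"
    unfolding singular_prod_def using dU k by (intro prod.cong) auto
  finally show ?thesis
    by (simp only: mult.commute)
qed

section \<open>The singular value function\<close>

text \<open>The exponent of the singular value with (zero-based) index \<open>i\<close> in \<open>sv_function \<alpha>\<close> in dimension \<open>n\<close>.\<close>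

definition sv_exponent :: "nat \<Rightarrow> real \<Rightarrow> nat \<Rightarrow> real" where
  "sv_exponent n \<alpha> i = (if Suc i = n then max 0 (\<alpha> - real i) else max 0 (min 1 (\<alpha> - real i)))"

lemma sv_exponent_nonneg: "0 \<le> sv_exponent n \<alpha> i"
  by (simp add: sv_exponent_def)

lemma sv_exponent_mono: "\<alpha> \<le> \<beta> \<Longrightarrow> sv_exponent n \<alpha> i \<le> sv_exponent n \<beta> i"
  by (auto simp: sv_exponent_def max_def min_def)

lemma sum_sv_exponent:
  assumes "0 < n" "0 \<le> \<alpha>"
  shows "(\<Sum>i<n. sv_exponent n \<alpha> i) = \<alpha>"
proof -
  obtain m where m: "n = Suc m"
    using assms(1) gr0_implies_Suc by blast
  have "(\<Sum>i<k. max 0 (min 1 (\<alpha> - real i))) = min \<alpha> (real k)" for k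
    using assms(2) by (induction k) auto
  moreover have "(\<Sum>i<n. sv_exponent n \<alpha> i) = (\<Sum>i<m. max 0 (min 1 (\<alpha> - real i))) + max 0 (\<alpha> - real m)"
    by (simp add: m sv_exponent_def)
  ultimately show ?thesis
    by auto
qed

text \<open>Merges both cases of the definition into one product. The exponents are nonnegative,
  increase with \<open>\<alpha>\<close> and add up to \<open>\<alpha>\<close>, so bounds on singular
  values carry over factor by factor, with no case distinction at integers or at the
  dimension.\<close>

lemma sv_function_eq_prod:
  fixes T :: "'a::euclidean_space \<Rightarrow> 'a"
  assumes T: "linear T" "bij T" and \<alpha>: "0 \<le> \<alpha>"
  shows "sv_function \<alpha> T = (\<Prod>i<DIM('a). singular_value T (Suc i) powr sv_exponent DIM('a) \<alpha> i)"
proof -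
  let ?n = "DIM('a)" and ?s = "\<lambda>i. singular_value T (Suc i)"
  have pos: "0 < ?s i" if "i < ?n" for i
    using singular_value_pos[OF T(1) bij_is_inj[OF T(2)], of "Suc i"] that by simp
  have shift: "(\<Prod>i\<in>{1..<Suc k}. singular_value T i) = (\<Prod>i<k. ?s i)" for k
    using prod.shift_bounds_Suc_ivl[of "singular_value T" 0 k] by (simp add: atLeast0LessThan)
  show ?thesis
  proof (cases "\<alpha> < real ?n")
    case True
    define m where "m = nat \<lfloor>\<alpha>\<rfloor>"
    have m: "real m \<le> \<alpha>" "\<alpha> < real m + 1"
      using \<alpha> by (auto simp: m_def)
    have mn: "m < ?n"
      using m True by linarith
    have "sv_function \<alpha> T = (\<Prod>i<m. ?s i) * ?s m powr (\<alpha> - real m)"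
      using True shift[of m] by (simp add: sv_function_def Let_def m_def)
    also have "(\<Prod>i<m. ?s i) = (\<Prod>i<m. ?s i powr sv_exponent ?n \<alpha> i)"
      using pos mn m by (intro prod.cong) (auto simp: sv_exponent_def less_imp_le)
    also have "\<alpha> - real m = sv_exponent ?n \<alpha> m"
      using m by (simp add: sv_exponent_def)
    also have "(\<Prod>i<m. ?s i powr sv_exponent ?n \<alpha> i) * ?s m powr sv_exponent ?n \<alpha> m
        = (\<Prod>i<Suc m. ?s i powr sv_exponent ?n \<alpha> i)"
      by simp
    also have "\<dots> = (\<Prod>i<?n. ?s i powr sv_exponent ?n \<alpha> i)"
    proof (rule prod.mono_neutral_left)
      have "sv_exponent ?n \<alpha> i = 0" if "m < i" for i
        using that m by (simp add: sv_exponent_def)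
      \<comment> \<open>Positivity of the singular values matters here, since
        \<open>0 powr 0\<close> is \<open>0\<close>.\<close>
      then show "\<forall>i\<in>{..<?n} - {..<Suc m}. ?s i powr sv_exponent ?n \<alpha> i = 1"
        using pos by (auto simp: less_imp_neq[symmetric])
    qed (use mn in auto)
    finally show ?thesis .
  next
    case False
    obtain m where m: "?n = Suc m"
      using gr0_implies_Suc[OF DIM_positive] by blast
    have "sv_function \<alpha> T = (\<Prod>i<m. ?s i) * ?s m powr (\<alpha> - real m)"
      using False shift[of m] by (simp add: sv_function_def m)
    also have "(\<Prod>i<m. ?s i) = (\<Prod>i<m. ?s i powr sv_exponent ?n \<alpha> i)"
      using pos False m by (intro prod.cong) (auto simp: sv_exponent_def less_imp_le)
    also have "\<alpha> - real m = sv_exponent ?n \<alpha> m"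
      using m False by (simp add: sv_exponent_def)
    finally show ?thesis
      by (simp add: m)
  qed
qed

lemma sv_function_pos:
  fixes T :: "'a::euclidean_space \<Rightarrow> 'a"
  assumes T: "linear T" "bij T" and \<alpha>: "0 \<le> \<alpha>"
  shows "0 < sv_function \<alpha> T"
  unfolding sv_function_eq_prod[OF assms]
proof (rule prod_pos)
  fix i assume "i \<in> {..<DIM('a)}"
  then show "0 < singular_value T (Suc i) powr sv_exponent DIM('a) \<alpha> i"
    using singular_value_pos[OF T(1) bij_is_inj[OF T(2)], of "Suc i"] by simp
qed

lemma sv_function_0: "sv_function 0 (T :: 'a::euclidean_space \<Rightarrow> 'a) = 1"
  if "linear T" "bij T"
proof -
  have "sv_exponent DIM('a) 0 i = 0" for i
    by (simp add: sv_exponent_def)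
  then show ?thesis
    using singular_value_pos[OF that(1) bij_is_inj[OF that(2)]]
    by (auto simp: sv_function_eq_prod[OF that] less_imp_neq[symmetric] Suc_le_eq intro!: prod.neutral)
qed

text \<open>Since the exponents add up to \<open>\<alpha>\<close>, a common factor \<open>c\<close>
  comes out of the product as \<open>c powr \<alpha>\<close>.\<close>

lemma sv_function_le:
  fixes A B :: "'a::euclidean_space \<Rightarrow> 'a"
  assumes A: "linear A" "bij A" and B: "linear B" "bij B" and \<alpha>: "0 \<le> \<alpha>" and c: "0 < c"
    and le: "\<And>i. 1 \<le> i \<Longrightarrow> i \<le> DIM('a) \<Longrightarrow> singular_value A i \<le> c * singular_value B i"
  shows "sv_function \<alpha> A \<le> c powr \<alpha> * sv_function \<alpha> B"
proof -
  let ?n = "DIM('a)"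
  have pos: "0 < singular_value A (Suc i)" "0 < singular_value B (Suc i)" if "i < ?n" for i
    using singular_value_pos[OF A(1) bij_is_inj[OF A(2)], of "Suc i"]
      singular_value_pos[OF B(1) bij_is_inj[OF B(2)], of "Suc i"] that by auto
  have "sv_function \<alpha> A \<le> (\<Prod>i<?n. (c * singular_value B (Suc i)) powr sv_exponent ?n \<alpha> i)"
    unfolding sv_function_eq_prod[OF A \<alpha>]
    using le pos by (intro prod_mono) (auto intro!: powr_mono2 sv_exponent_nonneg simp: less_imp_le)
  also have "\<dots> = (\<Prod>i<?n. c powr sv_exponent ?n \<alpha> i * singular_value B (Suc i) powr sv_exponent ?n \<alpha> i)"
    using c pos by (intro prod.cong) (auto simp: powr_mult less_imp_le)
  also have "\<dots> = c powr (\<Sum>i<?n. sv_exponent ?n \<alpha> i) * sv_function \<alpha> B"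
    using c unfolding sv_function_eq_prod[OF B \<alpha>] by (simp add: prod.distrib powr_sum)
  finally show ?thesis
    by (simp add: sum_sv_exponent[OF DIM_positive \<alpha>])
qed

text \<open>Passing from \<open>\<alpha>\<close> to \<open>\<beta>\<close> raises the exponents by
  nonnegative amounts that add up to \<open>\<beta> - \<alpha>\<close>, and every singular value
  lies between \<open>l\<close> and \<open>u\<close>. This is the source of the slope bounds for the
  pressure.\<close>

lemma sv_function_exponent_bounds:
  fixes T :: "'a::euclidean_space \<Rightarrow> 'a"
  assumes T: "linear T" "bij T" and \<alpha>: "0 \<le> \<alpha>" "\<alpha> \<le> \<beta>" and l: "0 < l"
    and bd: "l \<le> singular_value T DIM('a)" "singular_value T 1 \<le> u"
  shows "l powr (\<beta> - \<alpha>) * sv_function \<alpha> T \<le> sv_function \<beta> T"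
    and "sv_function \<beta> T \<le> u powr (\<beta> - \<alpha>) * sv_function \<alpha> T"
proof -
  let ?n = "DIM('a)"
  define e where "e i = sv_exponent ?n \<beta> i - sv_exponent ?n \<alpha> i" for i
  have e: "0 \<le> e i" for i
    using sv_exponent_mono[OF \<alpha>(2)] by (simp add: e_def)
  have sum_e: "(\<Sum>i<?n. e i) = \<beta> - \<alpha>"
    using \<alpha> unfolding e_def sum_subtractf
    by (simp add: sum_sv_exponent[OF DIM_positive[where ?'a = 'a]])
  have pos: "0 < singular_value T (Suc i)" if "i < ?n" for i
    using singular_value_pos[OF T(1) bij_is_inj[OF T(2)], of "Suc i"] that by simp
  have b: "l \<le> singular_value T (Suc i)" "singular_value T (Suc i) \<le> u" if "i < ?n" for i
    using singular_value_mono[OF T(1), of "Suc i" ?n] singular_value_mono[OF T(1), of 1 "Suc i"] bd that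
    by auto
  have u: "0 < u"
    using b[of 0] l by auto
  have eq: "sv_function \<beta> T = (\<Prod>i<?n. singular_value T (Suc i) powr e i) * sv_function \<alpha> T"
    using \<alpha> pos unfolding sv_function_eq_prod[OF T \<alpha>(1)]
    by (subst sv_function_eq_prod[OF T])
      (auto simp: prod.distrib[symmetric] powr_add[symmetric] e_def intro!: prod.cong)
  have "l powr (\<beta> - \<alpha>) \<le> (\<Prod>i<?n. singular_value T (Suc i) powr e i)"
    unfolding sum_e[symmetric] using l b(1) e
    by (simp add: powr_sum) (intro prod_mono, auto intro!: powr_mono2 simp: less_imp_le)
  then show "l powr (\<beta> - \<alpha>) * sv_function \<alpha> T \<le> sv_function \<beta> T"
    unfolding eq using sv_function_pos[OF T \<alpha>(1)] by (intro mult_right_mono) auto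
  have "(\<Prod>i<?n. singular_value T (Suc i) powr e i) \<le> u powr (\<beta> - \<alpha>)"
    unfolding sum_e[symmetric] using u b(2) e pos
    by (simp add: powr_sum) (intro prod_mono, auto intro!: powr_mono2 simp: less_imp_le)
  then show "sv_function \<beta> T \<le> u powr (\<beta> - \<alpha>) * sv_function \<alpha> T"
    unfolding eq using sv_function_pos[OF T \<alpha>(1)] by (intro mult_right_mono) auto
qed

lemma sv_function_compose_bounds:
  fixes T U :: "'a::euclidean_space \<Rightarrow> 'a"
  assumes T: "linear T" "bij T" and U: "linear U" "bij U" and \<alpha>: "0 \<le> \<alpha>"
  shows "sv_function \<alpha> (T \<circ> U) \<le> singular_value T 1 powr \<alpha> * sv_function \<alpha> U"
    and "sv_function \<alpha> (T \<circ> U) \<le> singular_value U 1 powr \<alpha> * sv_function \<alpha> T"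
    and "singular_value T DIM('a) powr \<alpha> * sv_function \<alpha> U \<le> sv_function \<alpha> (T \<circ> U)"
    and "singular_value U DIM('a) powr \<alpha> * sv_function \<alpha> T \<le> sv_function \<alpha> (T \<circ> U)"
proof -
  have TU: "linear (T \<circ> U)" "bij (T \<circ> U)"
    by (intro linear_compose bij_comp T U)+
  have p1: "0 < singular_value T 1" "0 < singular_value U 1"
    "0 < singular_value T DIM('a)" "0 < singular_value U DIM('a)"
    using T U by (auto intro!: singular_value_pos bij_is_inj simp: Suc_leI)
  note sc = singular_value_compose[OF T U]
  show "sv_function \<alpha> (T \<circ> U) \<le> singular_value T 1 powr \<alpha> * sv_function \<alpha> U"
    by (rule sv_function_le[OF TU U \<alpha> p1(1) sc(1)])
  show "sv_function \<alpha> (T \<circ> U) \<le> singular_value U 1 powr \<alpha> * sv_function \<alpha> T"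
    by (rule sv_function_le[OF TU T \<alpha> p1(2) sc(2)])
  have inv: "inverse c powr \<alpha> = inverse (c powr \<alpha>)" for c :: real
    by (simp add: inverse_powr)
  have "sv_function \<alpha> U \<le> inverse (singular_value T DIM('a)) powr \<alpha> * sv_function \<alpha> (T \<circ> U)"
    using p1 sc(3) by (intro sv_function_le TU U \<alpha>) (auto simp: field_simps)
  then show "singular_value T DIM('a) powr \<alpha> * sv_function \<alpha> U \<le> sv_function \<alpha> (T \<circ> U)"
    using p1 unfolding inv by (simp add: field_simps)
  have "sv_function \<alpha> T \<le> inverse (singular_value U DIM('a)) powr \<alpha> * sv_function \<alpha> (T \<circ> U)"
    using p1 sc(4) by (intro sv_function_le TU T \<alpha>) (auto simp: field_simps)
  then show "singular_value U DIM('a) powr \<alpha> * sv_function \<alpha> T \<le> sv_function \<alpha> (T \<circ> U)"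
    using p1 unfolding inv by (simp add: field_simps)
qed

text \<open>
  For \<open>\<alpha> < D\<close> the function is a geometric mean of two products \<open>singular_prod\<close>, hence submultiplicative.
\<close>

theorem sv_function_submult:
  fixes T U :: "real^'n \<Rightarrow> real^'n"
  assumes T: "linear T" "bij T" and U: "linear U" "bij U" and \<alpha>: "0 \<le> \<alpha>" "\<alpha> < real CARD('n)"
  shows "sv_function \<alpha> (T \<circ> U) \<le> sv_function \<alpha> T * sv_function \<alpha> U"
proof -
  let ?n = "CARD('n)"
  define m where "m = nat \<lfloor>\<alpha>\<rfloor>"
  define t where "t = \<alpha> - real m"
  have t: "0 \<le> t" "t < 1"
    using \<alpha> unfolding t_def m_def by (simp, linarith)
  have mn: "m < ?n"
    using \<alpha> t unfolding t_def by linarith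
  have TU: "linear (T \<circ> U)" "bij (T \<circ> U)"
    by (intro linear_compose bij_comp T U)+
  have pos: "0 < singular_prod k A" if "k \<le> ?n" "linear A" "bij A" for k and A :: "real^'n \<Rightarrow> real^'n"
    unfolding singular_prod_def using that by (intro prod_pos) (auto intro!: singular_value_pos bij_is_inj)
  \<comment> \<open>With \<open>m\<close> the integer part and \<open>t\<close> the fractional part
    of \<open>\<alpha>\<close>, the first \<open>m\<close> singular values occur in both products,
    with total weight 1, and the next one only in the second, with weight \<open>t\<close>.\<close>
  have eq: "sv_function \<alpha> A = singular_prod m A powr (1 - t) * singular_prod (Suc m) A powr t"
    if A: "linear A" "bij A" for A :: "real^'n \<Rightarrow> real^'n"
  proof -
    have sm: "0 < singular_value A (Suc m)"
      using A mn by (auto intro!: singular_value_pos bij_is_inj)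
    have pm: "0 < singular_prod m A"
      using mn A by (intro pos) auto
    have "(\<Prod>i\<in>{1..<Suc m}. singular_value A i) = singular_prod m A"
      using prod.shift_bounds_Suc_ivl[of "singular_value A" 0 m]
      by (simp add: atLeast0LessThan singular_prod_def)
    then have "sv_function \<alpha> A = singular_prod m A * singular_value A (Suc m) powr t"
      using \<alpha> by (simp add: sv_function_def Let_def m_def[symmetric] t_def)
    also have "singular_prod m A = singular_prod m A powr (1 - t) * singular_prod m A powr t"
      using pm by (simp add: powr_add[symmetric])
    finally show ?thesis
      using pm sm by (simp add: singular_prod_def powr_mult less_imp_le mult_ac)
  qed
  have "sv_function \<alpha> (T \<circ> U) \<le> (singular_prod m T * singular_prod m U) powr (1 - t)
      * (singular_prod (Suc m) T * singular_prod (Suc m) U) powr t"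
    unfolding eq[OF TU] using mn t pos[of _ T] pos[of _ U] pos[of _ "T \<circ> U"] TU T U
    by (intro mult_mono powr_mono2 singular_prod_mult_le mult_nonneg_nonneg) (auto simp: less_imp_le)
  also have "\<dots> = sv_function \<alpha> T * sv_function \<alpha> U"
    using mn pos[of m T] pos[of m U] pos[of "Suc m" T] pos[of "Suc m" U] T U
    by (simp add: eq powr_mult less_imp_le mult_ac)
  finally show ?thesis .
qed

text \<open>
  Beyond the dimension the determinant is multiplied by a power of the smallest singular value, which
  is supermultiplicative.
\<close>

theorem sv_function_supermult:
  fixes T U :: "real^'n \<Rightarrow> real^'n"
  assumes T: "linear T" "bij T" and U: "linear U" "bij U" and \<alpha>: "real CARD('n) \<le> \<alpha>"
  shows "sv_function \<alpha> T * sv_function \<alpha> U \<le> sv_function \<alpha> (T \<circ> U)"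
proof -
  let ?n = "CARD('n)" and ?l = "\<lambda>A :: real^'n \<Rightarrow> real^'n. singular_value A CARD('n)"
  have TU: "linear (T \<circ> U)" "bij (T \<circ> U)"
    by (intro linear_compose bij_comp T U)+
  have pos: "0 < ?l A" "0 < singular_prod ?n A" if "linear A" "bij A" for A :: "real^'n \<Rightarrow> real^'n"
    using that unfolding singular_prod_def
    by (auto intro!: prod_pos singular_value_pos bij_is_inj simp: Suc_leI)
  have eq: "sv_function \<alpha> A = singular_prod ?n A * ?l A powr (\<alpha> - real ?n)"
    if A: "linear A" "bij A" for A :: "real^'n \<Rightarrow> real^'n"
  proof -
    obtain m where m: "?n = Suc m"
      using gr0_implies_Suc[of ?n] by auto
    have "(\<Prod>i\<in>{1..<Suc m}. singular_value A i) = singular_prod m A"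
      using prod.shift_bounds_Suc_ivl[of "singular_value A" 0 m]
      by (simp add: atLeast0LessThan singular_prod_def)
    then have "sv_function \<alpha> A = singular_prod m A * ?l A powr (\<alpha> - real ?n + 1)"
      using \<alpha> by (simp add: sv_function_def m)
    also have "?l A powr (\<alpha> - real ?n + 1) = ?l A powr (\<alpha> - real ?n) * ?l A"
      using pos(1)[OF A] by (simp add: powr_add)
    finally show ?thesis
      by (simp add: singular_prod_def m mult_ac)
  qed
  have "?l T * ?l U \<le> ?l (T \<circ> U)"
    using singular_value_compose(3)[OF T U, of ?n] by (simp add: Suc_leI)
  then have "(?l T * ?l U) powr (\<alpha> - real ?n) \<le> ?l (T \<circ> U) powr (\<alpha> - real ?n)"
    using \<alpha> pos[OF T] pos[OF U] by (intro powr_mono2) (auto simp: less_imp_le)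
  then show ?thesis
    using pos[OF T] pos[OF U]
    by (simp add: eq T U TU singular_prod_full[OF T U] powr_mult less_imp_le mult_ac)
qed

lemma singular_value_id:
  assumes "1 \<le> i" "i \<le> DIM('a)"
  shows "singular_value (id :: 'a::euclidean_space \<Rightarrow> 'a) i = 1"
proof -
  obtain k where k: "i = Suc k" "k < DIM('a)"
    using assms by (metis Suc_le_eq One_nat_def Suc_pred')
  obtain b :: "nat \<Rightarrow> 'a" where b: "orthonormal_basis b"
    "\<And>i. i < DIM('a) \<Longrightarrow> adjoint id (id (b i)) = (singular_value (id :: 'a \<Rightarrow> 'a) (Suc i))\<^sup>2 *\<^sub>R b i"
    "\<And>i j. i \<le> j \<Longrightarrow> j < DIM('a) \<Longrightarrow> singular_value (id :: 'a \<Rightarrow> 'a) (Suc j) \<le> singular_value (id :: 'a \<Rightarrow> 'a) (Suc i)"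
    "\<And>i. i < DIM('a) \<Longrightarrow> 0 \<le> singular_value (id :: 'a \<Rightarrow> 'a) (Suc i)"
    using singular_value_basis[OF linear_id] by blast
  have "b k \<bullet> adjoint id (id (b k)) = b k \<bullet> b k"
    using gram_selfadjoint(3)[OF linear_id, of "b k" "b k"] by simp
  then have "(singular_value (id :: 'a \<Rightarrow> 'a) i)\<^sup>2 = 1"
    using b(2)[OF k(2)] orthonormal_basis_inner[OF b(1) k(2) k(2)] k(1) by simp
  then show ?thesis
    using b(4)[OF k(2)] k(1) by (auto simp: power2_eq_1_iff)
qed

lemma sv_function_id: "0 \<le> \<alpha> \<Longrightarrow> sv_function \<alpha> (id :: 'a::euclidean_space \<Rightarrow> 'a) = 1"
  by (subst sv_function_eq_prod[OF linear_id bij_id])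
    (auto simp: singular_value_id Suc_le_eq intro!: prod.neutral)

section \<open>Ergodic theorems\<close>

locale ergodic_system = prob_space M for M :: "'a measure" +
  fixes S :: "'a \<Rightarrow> 'a"
  assumes S_measurable [measurable]: "S \<in> M \<rightarrow>\<^sub>M M"
    and S_invariant: "invariant_measure S M"
    and S_ergodic: "ergodic_measure S M"
begin

lemma funpow_measurable [measurable]: "(S ^^ n) \<in> M \<rightarrow>\<^sub>M M"
  by (induction n) auto

lemma S_space: "x \<in> space M \<Longrightarrow> S x \<in> space M"
  by (rule measurable_space[OF S_measurable])

lemma funpow_space: "x \<in> space M \<Longrightarrow> (S ^^ n) x \<in> space M"
  by (rule measurable_space[OF funpow_measurable])

lemma distr_funpow: "distr M M (S ^^ n) = M"
proof (induction n)
  case 0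
  show ?case
    by (rule measure_eqI) (auto simp: emeasure_distr intro!: arg_cong[of _ _ "emeasure M"] dest: sets.sets_into_space)
next
  case (Suc n)
  have "distr M M S = M"
    using S_invariant by (intro measure_eqI) (auto simp: emeasure_distr invariant_measure_def)
  then have "distr M M (S ^^ n \<circ> S) = distr M M (S ^^ n)"
    using distr_distr[of "S ^^ n" M M S M] by simp
  then show ?case
    using Suc by (simp only: funpow_Suc_right)
qed

lemma
  fixes f :: "'a \<Rightarrow> real"
  assumes f: "integrable M f"
  shows integrable_funpow: "integrable M (\<lambda>x. f ((S ^^ n) x))"
    and integral_funpow: "(\<integral>x. f ((S ^^ n) x) \<partial>M) = (\<integral>x. f x \<partial>M)"
proof -
  have fm [measurable]: "f \<in> borel_measurable M"
    using f by simp
  show "integrable M (\<lambda>x. f ((S ^^ n) x))"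
    using integrable_distr_eq[of "S ^^ n" M M f] f by (simp add: distr_funpow)
  show "(\<integral>x. f ((S ^^ n) x) \<partial>M) = (\<integral>x. f x \<partial>M)"
    using integral_distr[of "S ^^ n" M M f] by (simp add: distr_funpow)
qed

text \<open>
  The covering argument of Katznelson and Weiss: along an orbit, blocks on which \<open>g\<close> grows at
  rate \<open>d\<close> start at all times outside a set of small density.
\<close>

lemma superadditive_growth:
  fixes g :: "nat \<Rightarrow> 'a \<Rightarrow> real"
  assumes g_int: "\<And>m. integrable M (g m)" and g_nonneg: "\<And>m x. x \<in> space M \<Longrightarrow> 0 \<le> g m x"
    and g_super: "\<And>m n x. x \<in> space M \<Longrightarrow> g m x + g n ((S ^^ m) x) \<le> g (m + n) x"
    and c: "\<And>m. (\<integral>x. g m x \<partial>M) \<le> c * real m"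
    and fast: "AE x in M. \<exists>n\<ge>1. d * real n < g n x" and d: "0 \<le> d"
  shows "d \<le> c"
proof -
  have [measurable]: "g m \<in> borel_measurable M" for m
    using g_int by auto
  \<comment> \<open>The starting points of fast blocks of length at most \<open>K\<close>. The bound
    on the length is what keeps the loss at the end of an orbit segment bounded.\<close>
  define G where "G K = {x \<in> space M. \<exists>n\<in>{1..K}. d * real n < g n x}" for K
  have [measurable]: "G K \<in> sets M" for K
    unfolding G_def by measurable
  have cover: "d * (\<Sum>j<m. indicator (G K) ((S ^^ j) x)) - d * real K \<le> g m x"
    if "x \<in> space M" for m K x
    using that
  proof (induction m arbitrary: x rule: less_induct)
    case (less m)
    define I :: "nat \<Rightarrow> real" where "I j = indicator (G K) ((S ^^ j) x)" for j
    have I1: "I j \<le> 1" for j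
      by (simp add: I_def indicator_def)
    have split: "(\<Sum>j<m. I j) = (\<Sum>j<n. I j) + (\<Sum>j<m - n. indicator (G K) ((S ^^ j) ((S ^^ n) x)))"
      if "n \<le> m" for n
    proof -
      have "(\<Sum>j<m. I j) = (\<Sum>j<n. I j) + (\<Sum>j\<in>{n..<m}. I j)"
        using sum.atLeastLessThan_concat[of 0 n m I] that by (simp add: atLeast0LessThan)
      also have "(\<Sum>j\<in>{n..<m}. I j) = (\<Sum>j<m - n. I (j + n))"
        using sum.shift_bounds_nat_ivl[of I 0 n "m - n"] that by (simp add: atLeast0LessThan)
      also have "\<dots> = (\<Sum>j<m - n. indicator (G K) ((S ^^ j) ((S ^^ n) x)))"
        by (simp add: I_def funpow_add)
      finally show ?thesis .
    qed
    have sum_le: "(\<Sum>j<n. I j) \<le> real n" for n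
      using sum_bounded_above[of "{..<n}" I 1] I1 by simp
    \<comment> \<open>A greedy walk along the orbit: stop when at most \<open>K\<close> steps
      remain, at a cost of at most \<open>d * real K\<close>; jump over a fast block if one starts
      here; otherwise move one step, from a point outside \<open>G K\<close> that contributes
      nothing to the sum.\<close>
    consider "m \<le> K" | n where "K < m" "n \<in> {1..K}" "d * real n < g n x" | "K < m" "x \<notin> G K"
      using less.prems by (force simp: G_def)
    then show ?case
    proof cases
      case 1
      have "d * (\<Sum>j<m. I j) \<le> d * real K"
        using sum_le[of m] 1 d by (intro mult_left_mono) auto
      then show ?thesis
        using g_nonneg[OF less.prems, of m] by (simp add: I_def)
    next
      case (2 n)
      let ?y = "(S ^^ n) x"
      have "d * (\<Sum>j<m - n. indicator (G K) ((S ^^ j) ?y)) - d * real K \<le> g (m - n) ?y"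
        using 2 by (intro less.IH funpow_space less.prems) auto
      moreover have "g n x + g (m - n) ?y \<le> g m x"
        using g_super[OF less.prems, of n "m - n"] 2 by simp
      moreover have "d * (\<Sum>j<n. I j) \<le> d * real n"
        using sum_le[of n] d by (rule mult_left_mono)
      moreover have "d * (\<Sum>j<m. I j) = d * (\<Sum>j<n. I j) + d * (\<Sum>j<m - n. indicator (G K) ((S ^^ j) ?y))"
        using split[of n] 2 by (simp add: distrib_left)
      ultimately show ?thesis
        using 2(3) by (simp add: I_def)
    next
      case 3
      let ?y = "(S ^^ 1) x"
      have "d * (\<Sum>j<m - 1. indicator (G K) ((S ^^ j) ?y)) - d * real K \<le> g (m - 1) ?y"
        using 3 by (intro less.IH funpow_space less.prems) auto
      moreover have "g 1 x + g (m - 1) ?y \<le> g m x"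
        using g_super[OF less.prems, of 1 "m - 1"] 3 by simp
      moreover have "(\<Sum>j<m. I j) = (\<Sum>j<m - 1. indicator (G K) ((S ^^ j) ?y))"
        using split[of 1] 3 by (simp add: I_def)
      ultimately show ?thesis
        using g_nonneg[OF less.prems, of 1] by (simp add: I_def)
    qed
  qed
  have prob_le: "d * prob (G K) \<le> c" for K
  proof -
    \<comment> \<open>By invariance each term of the sum integrates to \<open>prob (G K)\<close>.
      The error \<open>d * real K\<close> does not depend on \<open>m\<close> and disappears in the
      rate as \<open>m\<close> grows.\<close>
    have bound: "d * prob (G K) * real m - d * real K \<le> c * real m" for m
    proof -
      have Iint: "integrable M (indicator (G K) :: 'a \<Rightarrow> real)"
        by (auto simp: less_top[symmetric])
      have int: "integrable M (\<lambda>x. indicator (G K) ((S ^^ j) x) :: real)" for j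
        by (rule integrable_funpow[OF Iint])
      have "(\<integral>x. d * (\<Sum>j<m. indicator (G K) ((S ^^ j) x)) - d * real K \<partial>M) \<le> (\<integral>x. g m x \<partial>M)"
        using int g_int cover by (intro integral_mono) auto
      also have "(\<integral>x. d * (\<Sum>j<m. indicator (G K) ((S ^^ j) x)) - d * real K \<partial>M)
          = d * (\<Sum>j<m. \<integral>x. indicator (G K) ((S ^^ j) x) \<partial>M) - d * real K"
        using int by (simp add: prob_space)
      also have "(\<Sum>j<m. \<integral>x. indicator (G K) ((S ^^ j) x) \<partial>M) = real m * prob (G K)"
        by (simp add: integral_funpow[OF Iint])
      finally show ?thesis
        using c[of m] by (simp add: mult_ac)
    qed
    show ?thesis
    proof (rule ccontr)
      assume "\<not> d * prob (G K) \<le> c"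
      then obtain m where "d * real K / (d * prob (G K) - c) < real m"
        using reals_Archimedean2 by blast
      then show False
        using bound[of m] \<open>\<not> d * prob (G K) \<le> c\<close> by (simp add: field_simps)
    qed
  qed
  \<comment> \<open>By \<open>fast\<close>, the sets \<open>G K\<close> increase to a set of full
    measure.\<close>
  have "(\<lambda>K. prob (G K)) \<longlonglongrightarrow> prob (\<Union>K. G K)"
    by (intro finite_Lim_measure_incseq incseq_SucI) (force simp: G_def)+
  moreover have "prob (\<Union>K. G K) = 1"
  proof (rule prob_eq_1[THEN iffD2])
    show "AE x in M. x \<in> (\<Union>K. G K)"
      using fast AE_space by eventually_elim (force simp: G_def)
  qed measurable
  ultimately have lim: "(\<lambda>K. d * prob (G K)) \<longlonglongrightarrow> d * 1"
    by (intro tendsto_intros) simp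
  have "d * 1 \<le> c"
    by (rule LIMSEQ_le_const2[OF lim]) (use prob_le in blast)
  then show ?thesis
    by simp
qed

text \<open>The set \<open>B d\<close> where the upper growth rate exceeds \<open>d\<close> is
  strictly invariant: \<open>g_super\<close> together with \<open>0 \<le> g 1 x\<close> carries
  growth from \<open>S x\<close> to \<open>x\<close>, and \<open>g_upper\<close> carries it back at
  the cost of \<open>k x\<close>. By ergodicity it is null or of full measure, and full measure for
  \<open>d > c\<close> contradicts \<open>superadditive_growth\<close>.\<close>

lemma superadditive_limsup_le:
  fixes g :: "nat \<Rightarrow> 'a \<Rightarrow> real"
  assumes g_int: "\<And>m. integrable M (g m)" and g_nonneg: "\<And>m x. x \<in> space M \<Longrightarrow> 0 \<le> g m x"
    and g_super: "\<And>m n x. x \<in> space M \<Longrightarrow> g m x + g n ((S ^^ m) x) \<le> g (m + n) x"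
    and g_upper: "\<And>m x. x \<in> space M \<Longrightarrow> g (Suc m) x \<le> k x + g m (S x)"
    and c: "\<And>m. (\<integral>x. g m x \<partial>M) \<le> c * real m"
  shows "AE x in M. \<forall>e>c. \<forall>\<^sub>F m in sequentially. g m x \<le> e * real m"
proof -
  have [measurable]: "g m \<in> borel_measurable M" for m
    using g_int by auto
  have c0: "0 \<le> c"
    using c[of 1] integral_nonneg_AE[of "g 1" M] g_nonneg by fastforce
  \<comment> \<open>The condition limsup \<open>> d\<close> is written with countably many rates
    above \<open>d\<close> to make it measurable.\<close>
  define B where "B d = {x \<in> space M. \<exists>n::nat. \<exists>\<^sub>F m in sequentially. (d + 1 / real (Suc n)) * real m < g m x}"
    for d
  have BI: "x \<in> B d"
    if x: "x \<in> space M" and e: "d < e" "\<exists>\<^sub>F m in sequentially. e * real m < g m x" for x d e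
  proof -
    obtain n where "inverse (real (Suc n)) < e - d"
      using reals_Archimedean[of "e - d"] e(1) by auto
    then have "d + 1 / real (Suc n) \<le> e"
      by (simp add: inverse_eq_divide)
    then have "\<exists>\<^sub>F m in sequentially. (d + 1 / real (Suc n)) * real m < g m x"
      by (intro frequently_mono[OF _ e(2)])
        (meson le_less_trans mult_right_mono of_nat_0_le_iff)
    then show ?thesis
      using x by (auto simp: B_def)
  qed
  have BE: "\<exists>e>d. \<exists>\<^sub>F m in sequentially. e * real m < g m x" if xB: "x \<in> B d" for x d
  proof -
    obtain n where "\<exists>\<^sub>F m in sequentially. (d + 1 / real (Suc n)) * real m < g m x"
      using xB by (auto simp: B_def)
    then show ?thesis
      by (intro exI[of _ "d + 1 / real (Suc n)"]) simp
  qed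
  have B_sets: "B d \<in> sets M" for d
    unfolding B_def frequently_sequentially by measurable
  have large: "\<forall>\<^sub>F m in sequentially. a \<le> e * real m" if "0 < e" for a e :: real
  proof -
    obtain n where "a / e < real n"
      using reals_Archimedean2 by blast
    then have "a \<le> e * real m" if "n \<le> m" for m
      using that \<open>0 < e\<close> by (simp add: field_simps) (smt (verit) mult_left_mono of_nat_mono)
    then show ?thesis
      by (auto simp: eventually_sequentially)
  qed
  have B_inv: "S x \<in> B d \<longleftrightarrow> x \<in> B d" if x: "x \<in> space M" for x d
  proof
    assume "S x \<in> B d"
    then obtain e where e: "d < e" "\<exists>\<^sub>F m in sequentially. e * real m < g m (S x)"
      using BE by blast
    \<comment> \<open>A rate strictly between \<open>d\<close> and \<open>e\<close>: the surplus
      \<open>(e - e') * real m\<close> eventually exceeds the bounded error of moving between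
      \<open>m\<close> and \<open>Suc m\<close>.\<close>
    define e' where "e' = (d + e) / 2"
    have e': "d < e'" "e' < e"
      using e(1) by (auto simp: e'_def)
    have "\<exists>\<^sub>F m in sequentially. e' * real (Suc m) < g (Suc m) x"
    proof (rule frequently_rev_mp[OF e(2)], rule eventually_mono[OF large[of "e - e'" e']])
      show "e' \<le> (e - e') * real m \<Longrightarrow> e * real m < g m (S x) \<longrightarrow> e' * real (Suc m) < g (Suc m) x" for m
        using g_super[OF x, of 1 m] g_nonneg[OF x, of 1] by (auto simp: algebra_simps)
    qed (use e' in simp)
    then have "\<exists>\<^sub>F m in sequentially. e' * real m < g m x"
      unfolding frequently_def eventually_sequentially_Suc[of "\<lambda>m. \<not> e' * real m < g m x"] .
    then show "x \<in> B d"
      using BI[OF x e'(1)] by simp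
  next
    assume "x \<in> B d"
    then obtain e where e: "d < e" "\<exists>\<^sub>F m in sequentially. e * real m < g m x"
      using BE by blast
    define e' where "e' = (d + e) / 2"
    have e': "d < e'" "e' < e"
      using e(1) by (auto simp: e'_def)
    have "\<exists>\<^sub>F m in sequentially. e * real (Suc m) < g (Suc m) x"
      using e(2) unfolding frequently_def
      by (subst eventually_sequentially_Suc[of "\<lambda>m. \<not> e * real m < g m x"])
    then have "\<exists>\<^sub>F m in sequentially. e' * real m < g m (S x)"
    proof (rule frequently_rev_mp, intro eventually_mono[OF large[of "e - e'" "k x - e"]])
      show "k x - e \<le> (e - e') * real m \<Longrightarrow> e * real (Suc m) < g (Suc m) x \<longrightarrow> e' * real m < g m (S x)" for m
        using g_upper[OF x, of m] by (auto simp: algebra_simps)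
    qed (use e' in simp)
    then show "S x \<in> B d"
      using BI[OF S_space[OF x] e'(1)] by simp
  qed
  have null: "AE x in M. x \<notin> B d" if "c < d" for d
  proof -
    have "B d \<subseteq> space M"
      by (auto simp: B_def)
    then have "S -` B d \<inter> space M = B d"
      using B_inv by blast
    then consider "emeasure M (B d) = 0" | "emeasure M (space M - B d) = 0"
      using S_ergodic B_sets by (auto simp: ergodic_measure_def)
    then show ?thesis
    proof cases
      case 1
      then show ?thesis
        using B_sets by (intro AE_not_in) auto
    next
      case 2
      then have "AE x in M. x \<notin> space M - B d"
        using B_sets by (intro AE_not_in) auto
      then have "AE x in M. \<exists>n\<ge>1. d * real n < g n x"
        using AE_space
      proof eventually_elim
        case (elim x)
        then obtain e where e: "d < e" "\<exists>\<^sub>F m in sequentially. e * real m < g m x"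
          using BE by blast
        then obtain n where n: "n \<ge> 1" "e * real n < g n x"
          unfolding frequently_sequentially by blast
        then have "d * real n < g n x"
          using e(1) by (meson le_less_trans less_imp_le mult_right_mono of_nat_0_le_iff)
        then show ?case
          using n(1) by blast
      qed
      then have "d \<le> c"
        using c0 that by (intro superadditive_growth[OF g_int g_nonneg g_super c]) auto
      then show ?thesis
        using that by simp
    qed
  qed
  \<comment> \<open>Countably many rates decreasing to \<open>c\<close> give one null set that
    serves every \<open>e > c\<close>.\<close>
  have "AE x in M. \<forall>n. x \<notin> B (c + 1 / real (Suc n))"
    unfolding AE_all_countable by (intro allI null) simp
  then show ?thesis
    using AE_space
  proof eventually_elim
    case (elim x)
    show ?case
    proof (intro allI impI)
      fix e assume "c < e"
      then obtain n where "inverse (real (Suc n)) < e - c"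
        using reals_Archimedean[of "e - c"] by auto
      then have "c + 1 / real (Suc n) < e"
        by (simp add: inverse_eq_divide)
      with elim BI[of x "c + 1 / real (Suc n)" e] show "\<forall>\<^sub>F m in sequentially. g m x \<le> e * real m"
        by (auto simp: frequently_def not_less)
    qed
  qed
qed

section \<open>Birkhoff sums and the convergence of their averages\<close>

lemma birkhoff_sum_Suc:
  "(\<Sum>j<Suc m. f ((S ^^ j) x)) = f x + (\<Sum>j<m. f ((S ^^ j) (S x)))"
  by (subst sum.lessThan_Suc_shift) (simp add: funpow_swap1)

lemma birkhoff_sum_add:
  "(\<Sum>j<m + n. f ((S ^^ j) x)) = (\<Sum>j<m. f ((S ^^ j) x)) + (\<Sum>j<n. f ((S ^^ j) ((S ^^ m) x)))"
proof -
  have "{..<m + n} = {..<m} \<union> {m..<m + n}" by auto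
  then have "(\<Sum>j<m + n. f ((S ^^ j) x)) = (\<Sum>j<m. f ((S ^^ j) x)) + (\<Sum>j\<in>{m..<m + n}. f ((S ^^ j) x))"
    by (simp add: sum.union_disjoint ivl_disj_int)
  also have "(\<Sum>j\<in>{m..<m + n}. f ((S ^^ j) x)) = (\<Sum>j<n. f ((S ^^ (j + m)) x))"
    using sum.shift_bounds_nat_ivl[of "\<lambda>j. f ((S ^^ j) x)" 0 m n] by (simp add: atLeast0LessThan add.commute)
  finally show ?thesis
    by (simp add: funpow_add)
qed

lemma integral_birkhoff_sum:
  fixes f :: "'a \<Rightarrow> real"
  assumes f: "integrable M f"
  shows "integrable M (\<lambda>x. \<Sum>j<m. f ((S ^^ j) x))"
    and "(\<integral>x. (\<Sum>j<m. f ((S ^^ j) x)) \<partial>M) = real m * (\<integral>x. f x \<partial>M)"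
  using integrable_funpow[OF f] integral_funpow[OF f] by auto

text \<open>Birkhoff sums are additive, so both growth hypotheses hold with equality, and their
  integrals grow at the rate of the integral of \<open>f\<close>.\<close>

lemma birkhoff_limsup_le:
  fixes f :: "'a \<Rightarrow> real"
  assumes f: "integrable M f" "\<And>x. x \<in> space M \<Longrightarrow> 0 \<le> f x"
  shows "AE x in M. \<forall>e>(\<integral>x. f x \<partial>M). \<forall>\<^sub>F m in sequentially. (\<Sum>j<m. f ((S ^^ j) x)) \<le> e * real m"
proof (rule superadditive_limsup_le[where k = f])
  show "0 \<le> (\<Sum>j<m. f ((S ^^ j) x))" if "x \<in> space M" for m x
    using that by (intro sum_nonneg f funpow_space)
qed (simp_all add: integral_birkhoff_sum[OF f(1)] birkhoff_sum_add birkhoff_sum_Suc del: sum.lessThan_Suc)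

text \<open>The lower half follows from the upper half for \<open>n - min f n\<close>, which is
  nonnegative and integrable: an upper bound for its averages is a lower bound for those of
  \<open>min f n\<close>, hence of \<open>f\<close>. The integrals of the truncations tend to that
  of \<open>f\<close> by dominated convergence.\<close>

theorem birkhoff:
  fixes f :: "'a \<Rightarrow> real"
  assumes f: "integrable M f" "\<And>x. x \<in> space M \<Longrightarrow> 0 \<le> f x"
  shows "AE x in M. (\<lambda>m. (\<Sum>j<m. f ((S ^^ j) x)) / real m) \<longlonglongrightarrow> (\<integral>x. f x \<partial>M)"
proof -
  let ?E = "\<integral>x. f x \<partial>M"
  have [measurable]: "f \<in> borel_measurable M"
    using f(1) by simp
  define h where "h n x = min (f x) (real n)" for n x
  have h_int: "integrable M (h n)" for n
    unfolding h_def by (rule Bochner_Integration.integrable_bound[OF f(1)]) (use f(2) in auto)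
  have h_lim: "(\<lambda>n. \<integral>x. h n x \<partial>M) \<longlonglongrightarrow> ?E"
  proof (rule integral_dominated_convergence[where w = f])
    show "AE x in M. (\<lambda>n. h n x) \<longlonglongrightarrow> f x"
    proof (intro AE_I2)
      fix x
      have "\<forall>\<^sub>F n in sequentially. h n x = f x"
        using eventually_ge_at_top[of "nat \<lceil>f x\<rceil>"]
        by eventually_elim (auto simp: h_def min_def nat_le_iff ceiling_le_iff)
      then show "(\<lambda>n. h n x) \<longlonglongrightarrow> f x"
        by (rule tendsto_eventually)
    qed
    show "AE x in M. norm (h n x) \<le> f x" for n
      using f(2) by (intro AE_I2) (auto simp: h_def)
  qed (use f(1) in \<open>auto simp: h_def\<close>)
  have "AE x in M. \<forall>n. \<forall>e>(\<integral>x. real n - h n x \<partial>M). \<forall>\<^sub>F m in sequentially.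
      (\<Sum>j<m. real n - h n ((S ^^ j) x)) \<le> e * real m"
    unfolding AE_all_countable
    by (intro allI birkhoff_limsup_le Bochner_Integration.integrable_diff h_int) (auto simp: h_def)
  moreover have "AE x in M. \<forall>e>?E. \<forall>\<^sub>F m in sequentially. (\<Sum>j<m. f ((S ^^ j) x)) \<le> e * real m"
    using f by (rule birkhoff_limsup_le)
  ultimately show ?thesis
    using AE_space
  proof eventually_elim
    case (elim x)
    show ?case
    proof (rule order_tendstoI)
      fix a assume "?E < a"
      then have "\<forall>\<^sub>F m in sequentially. (\<Sum>j<m. f ((S ^^ j) x)) \<le> (?E + a) / 2 * real m"
        using elim(2)[rule_format, of "(?E + a) / 2"] by simp
      then show "\<forall>\<^sub>F m in sequentially. (\<Sum>j<m. f ((S ^^ j) x)) / real m < a"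
        using eventually_gt_at_top[of 0]
      proof eventually_elim
        case (elim m)
        then have "(\<Sum>j<m. f ((S ^^ j) x)) / real m \<le> (?E + a) / 2"
          by (simp add: divide_le_eq)
        also have "\<dots> < a"
          using \<open>?E < a\<close> by simp
        finally show ?case .
      qed
    next
      fix a assume a: "a < ?E"
      then have "\<forall>\<^sub>F n in sequentially. a < (\<integral>x. h n x \<partial>M)"
        using h_lim by (rule order_tendstoD(1)[rotated])
      then obtain n where n: "a < (\<integral>x. h n x \<partial>M)"
        by (auto simp: eventually_sequentially)
      define e where "e = ((\<integral>x. h n x \<partial>M) - a) / 2"
      have e: "0 < e"
        using n by (simp add: e_def)
      have "(\<integral>x. real n - h n x \<partial>M) = real n - (\<integral>x. h n x \<partial>M)"
        using h_int by (simp add: prob_space)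
      then have "\<forall>\<^sub>F m in sequentially. (\<Sum>j<m. real n - h n ((S ^^ j) x)) \<le> (real n - a - e) * real m"
        using elim(1)[rule_format, of n "real n - a - e"] e n by (simp add: e_def field_simps)
      then show "\<forall>\<^sub>F m in sequentially. a < (\<Sum>j<m. f ((S ^^ j) x)) / real m"
        using eventually_gt_at_top[of 0]
      proof eventually_elim
        case (elim m)
        have "(\<Sum>j<m. h n ((S ^^ j) x)) \<le> (\<Sum>j<m. f ((S ^^ j) x))"
          by (intro sum_mono) (simp add: h_def)
        moreover have "(\<Sum>j<m. real n - h n ((S ^^ j) x)) = real n * real m - (\<Sum>j<m. h n ((S ^^ j) x))"
          by (simp add: sum_subtractf)
        ultimately have "(a + e) * real m \<le> (\<Sum>j<m. f ((S ^^ j) x))"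
          using elim(1) by (simp add: algebra_simps)
        then have "a + e \<le> (\<Sum>j<m. f ((S ^^ j) x)) / real m"
          using elim(2) by (simp add: le_divide_eq)
        then show ?case
          using e by simp
      qed
    qed
  qed
qed

text \<open>
  The two monotonicity assumptions make \<open>limsup f m / m\<close> and \<open>liminf f m / m\<close>
  invariant and allow \<open>f m\<close> to be replaced by the average of \<open>f m, \<dots>, f (m + K - 1)\<close>.
\<close>

theorem kingman:
  fixes f :: "nat \<Rightarrow> 'a \<Rightarrow> real"
  assumes f_meas [measurable]: "\<And>m. f m \<in> borel_measurable M"
    and f1_int: "integrable M (f 1)"
    and f0: "\<And>x. x \<in> space M \<Longrightarrow> f 0 x = 0"
    and f_sub: "\<And>m n x. x \<in> space M \<Longrightarrow> f (m + n) x \<le> f m x + f n ((S ^^ m) x)"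
    and f_Suc: "\<And>m x. x \<in> space M \<Longrightarrow> f m x \<le> f (Suc m) x"
    and f_S: "\<And>m x. x \<in> space M \<Longrightarrow> f m (S x) \<le> f (Suc m) x"
  shows "\<exists>L. AE x in M. (\<lambda>m. f m x / real m) \<longlonglongrightarrow> L"
proof -
  have f_nonneg: "0 \<le> f m x" if "x \<in> space M" for m x
    using that by (induction m) (auto simp: f0 intro: order_trans f_Suc)
  have f_le: "f m x \<le> (\<Sum>j<m. f 1 ((S ^^ j) x))" if "x \<in> space M" for m x
    using that
  proof (induction m)
    case (Suc m)
    then show ?case
      using f_sub[of x m 1] by simp
  qed (simp add: f0)
  have f_int: "integrable M (f m)" for m
    by (rule Bochner_Integration.integrable_bound[OF integral_birkhoff_sum(1)[OF f1_int]])
      (use f_le f_nonneg in \<open>auto intro!: AE_I2 order_trans[OF _ abs_ge_self]\<close>)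
  define a where "a m = (\<integral>x. f m x \<partial>M)" for m
  have a_nonneg: "0 \<le> a m" for m
    unfolding a_def using f_nonneg by (intro integral_nonneg_AE AE_I2)
  \<comment> \<open>The candidate limit. The lower half uses that it lies below every mean rate, the
    upper half that some mean rate comes close to it.\<close>
  define L where "L = (INF m\<in>{1..}. a m / real m)"
  have L_le: "L * real m \<le> a m" for m
  proof (cases "m = 0")
    case False
    have "L \<le> a m / real m"
      unfolding L_def using False a_nonneg by (intro cINF_lower bdd_belowI[of _ 0]) auto
    then show ?thesis
      using False by (simp add: le_divide_eq)
  qed (simp add: a_nonneg)
  define b where "b m x = (\<Sum>j<m. f 1 ((S ^^ j) x))" for m x
  \<comment> \<open>The gap between \<open>f\<close> and its additive majorant \<open>b\<close> is
    nonnegative and superadditive, and its mean grows at rate at most \<open>a 1 - L\<close>. As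
    \<open>b m x / real m\<close> tends to \<open>a 1\<close>, an upper bound on the gap is a lower
    bound on \<open>f\<close>.\<close>
  have lower: "AE x in M. \<forall>e>a 1 - L. \<forall>\<^sub>F m in sequentially. b m x - f m x \<le> e * real m"
  proof (rule superadditive_limsup_le[where k = "f 1"])
    show "integrable M (\<lambda>x. b m x - f m x)" for m
      unfolding b_def using integral_birkhoff_sum(1)[OF f1_int] f_int by auto
    show "0 \<le> b m x - f m x" if "x \<in> space M" for m x
      using f_le[OF that] by (simp add: b_def)
    show "b m x - f m x + (b n ((S ^^ m) x) - f n ((S ^^ m) x)) \<le> b (m + n) x - f (m + n) x"
      if "x \<in> space M" for m n x
      using f_sub[OF that, of m n] by (simp add: b_def birkhoff_sum_add)
    show "b (Suc m) x - f (Suc m) x \<le> f 1 x + (b m (S x) - f m (S x))" if "x \<in> space M" for m x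
      using f_S[OF that, of m] unfolding b_def birkhoff_sum_Suc by simp
    show "(\<integral>x. b m x - f m x \<partial>M) \<le> (a 1 - L) * real m" for m
      using L_le[of m] integral_birkhoff_sum[OF f1_int] f_int
      by (simp add: b_def a_def algebra_simps)
  qed
  have "AE x in M. \<forall>K. (\<lambda>m. (\<Sum>j<m. f K ((S ^^ j) x)) / real m) \<longlonglongrightarrow> a K"
    unfolding AE_all_countable a_def by (intro allI birkhoff f_int f_nonneg)
  with lower have "AE x in M. (\<lambda>m. f m x / real m) \<longlonglongrightarrow> L"
    using AE_space
  proof eventually_elim
    case (elim x)
    note x = elim(3)
    show ?case
    proof (rule order_tendstoI)
      fix l assume l: "l < L"
      define e where "e = (L - l) / 3"
      have e: "0 < e" "l = L - 3 * e"
        using l by (simp_all add: e_def field_simps)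
      have "\<forall>\<^sub>F m in sequentially. b m x - f m x \<le> (a 1 - L + e) * real m"
        using elim(1) e by simp
      moreover have "\<forall>\<^sub>F m in sequentially. a 1 - e < b m x / real m"
        using elim(2) e unfolding b_def by (intro order_tendstoD) auto
      ultimately show "\<forall>\<^sub>F m in sequentially. l < f m x / real m"
        using eventually_gt_at_top[of 0]
      proof eventually_elim
        case (elim m)
        then have "(L - 2 * e) * real m \<le> f m x"
          by (simp add: less_divide_eq algebra_simps)
        then have "L - 2 * e \<le> f m x / real m"
          using elim(3) by (simp add: le_divide_eq)
        then show ?case
          using e by simp
      qed
    next
      fix u assume u: "L < u"
      have "bdd_below ((\<lambda>m. a m / real m) ` {1..})"
        using a_nonneg by (intro bdd_belowI[of _ 0]) auto
      then have "\<exists>K\<in>{1..}. a K / real K < u"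
        using u unfolding L_def by (subst (asm) cINF_less_iff) auto
      then obtain K where K: "1 \<le> K" "a K / real K < u"
        by (elim bexE) simp
      \<comment> \<open>Sum over a window of length \<open>K\<close>. Moving it by one step replaces
        \<open>f m\<close> by \<open>f (m + K)\<close>, so by subadditivity \<open>H\<close> grows
        by at most \<open>f K\<close> at the \<open>m\<close>-th iterate. Using every starting time,
        not only multiples of \<open>K\<close>, avoids the map \<open>S ^^ K\<close>, which need not
        be ergodic.\<close>
      define H where "H m = (\<Sum>r<K. f (m + r) x)" for m
      have **: "H m \<le> H 0 + (\<Sum>j<m. f K ((S ^^ j) x))" for m
      proof (induction m)
        case (Suc m)
        have "H (Suc m) + f m x = (\<Sum>r<Suc K. f (m + r) x)"
          unfolding sum.lessThan_Suc_shift by (simp add: H_def)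
        also have "\<dots> = H m + f (m + K) x"
          by (simp add: H_def)
        finally show ?case
          using Suc f_sub[OF x, of m K] by simp
      qed simp
      have *: "real K * f m x \<le> H m" for m
      proof -
        have "f m x \<le> f (m + r) x" for r
          using lift_Suc_mono_le[of "\<lambda>m. f m x" m "m + r"] f_Suc[OF x] by simp
        then show ?thesis
          using sum_bounded_below[of "{..<K}" "f m x" "\<lambda>r. f (m + r) x"] by (simp add: H_def)
      qed
      have le: "f m x / real m \<le> (H 0 / real m + (\<Sum>j<m. f K ((S ^^ j) x)) / real m) / real K"
        if m: "0 < m" for m
      proof -
        have "real K * f m x \<le> H 0 + (\<Sum>j<m. f K ((S ^^ j) x))"
          using * ** by (rule order_trans)
        then have "real K * f m x / real m \<le> (H 0 + (\<Sum>j<m. f K ((S ^^ j) x))) / real m"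
          by (rule divide_right_mono) simp
        then show ?thesis
          using K(1) by (subst pos_le_divide_eq) (auto simp: add_divide_distrib mult.commute)
      qed
      have "(\<lambda>m. (H 0 / real m + (\<Sum>j<m. f K ((S ^^ j) x)) / real m) / real K) \<longlonglongrightarrow> (0 + a K) / real K"
        using elim(2) K(1)
        by (intro tendsto_intros lim_const_over_n) auto
      then have "\<forall>\<^sub>F m in sequentially. (H 0 / real m + (\<Sum>j<m. f K ((S ^^ j) x)) / real m) / real K < u"
        using K(2) by (intro order_tendstoD(2)) auto
      then show "\<forall>\<^sub>F m in sequentially. f m x / real m < u"
        using eventually_gt_at_top[of 0] by eventually_elim (rule le_less_trans[OF le])
    qed
  qed
  then show ?thesis ..
qed

end

section \<open>Level sums of code trees\<close>

text \<open>Replaces the existentially quantified labelling of all words by local conditions on the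
  partial map, which subtrees inherit. For the converse the labelling is extended beyond the domain
  by the label of the root, which lies in \<open>\<Lambda>\<close>.\<close>

lemma code_trees_iff:
  assumes bdd: "bdd_above (Mb ` \<Lambda>)"
  shows "\<omega> \<in> code_trees \<Lambda> Mb \<longleftrightarrow> [] \<in> dom \<omega> \<and>
    (\<forall>w l. w @ [l] \<in> dom \<omega> \<longleftrightarrow> w \<in> dom \<omega> \<and> 1 \<le> l \<and> l \<le> Mb (the (\<omega> w))) \<and>
    (\<forall>w\<in>dom \<omega>. the (\<omega> w) \<in> \<Lambda>)" (is "?L \<longleftrightarrow> ?R")
proof
  assume ?L
  then obtain f where f: "f \<in> words \<Lambda> Mb \<rightarrow> \<Lambda>" and \<omega>: "\<omega> = (\<lambda>w. Some (f w)) |` admissible Mb f"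
    by (auto simp: code_trees_def)
  have dom: "dom \<omega> = admissible Mb f"
    by (auto simp: \<omega> restrict_map_def split: if_splits)
  have "the (\<omega> w) = f w" if "w \<in> admissible Mb f" for w
    using that by (simp add: \<omega>)
  moreover have "f w \<in> \<Lambda>" if "w \<in> admissible Mb f" for w
    using admissible_subset_words[OF bdd f] f that by auto
  ultimately show ?R
    unfolding dom by (auto simp: admissible_snoc_iff intro: admissible.Nil)
next
  assume R: ?R
  define f where "f w = (if w \<in> dom \<omega> then the (\<omega> w) else the (\<omega> []))" for w
  have "w \<in> dom \<omega> \<longleftrightarrow> w \<in> admissible Mb f" for w
  proof (induction w rule: rev_induct)
    case Nil
    then show ?case using R by (simp add: admissible.Nil)
  next
    case (snoc l w)
    then show ?case using R by (auto simp: admissible_snoc_iff f_def)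
  qed
  then have dom: "admissible Mb f = dom \<omega>"
    by blast
  have "\<omega> = (\<lambda>w. Some (f w)) |` admissible Mb f"
    unfolding dom by (intro ext) (auto simp: restrict_map_def f_def domIff)
  moreover have "f \<in> words \<Lambda> Mb \<rightarrow> \<Lambda>"
    using R by (auto simp: f_def)
  ultimately show ?L
    by (auto simp: code_trees_def)
qed

lemma code_tree_prefix:
  assumes "bdd_above (Mb ` \<Lambda>)" "\<omega> \<in> code_trees \<Lambda> Mb" "u @ v \<in> dom \<omega>"
  shows "u \<in> dom \<omega>"
  using assms(3)
proof (induction v rule: rev_induct)
  case (snoc l v)
  then show ?case
    using assms(1,2) by (simp only: code_trees_iff append_assoc[symmetric])
qed simp

lemma code_tree_subtree:
  assumes "bdd_above (Mb ` \<Lambda>)" "\<omega> \<in> code_trees \<Lambda> Mb" "u \<in> dom \<omega>"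
  shows "(\<lambda>w. \<omega> (u @ w)) \<in> code_trees \<Lambda> Mb"
proof -
  have dom: "w \<in> dom (\<lambda>w. \<omega> (u @ w)) \<longleftrightarrow> u @ w \<in> dom \<omega>" for w
    by (simp add: dom_def)
  show ?thesis
    using assms(2,3) unfolding code_trees_iff[OF assms(1)] dom append_assoc[symmetric] Ball_def
    by (metis append_Nil2)
qed

definition level :: "(nat list \<rightharpoonup> 'l) \<Rightarrow> nat \<Rightarrow> nat list set" where
  "level \<omega> k = {w. w \<in> dom \<omega> \<and> length w = k}"

lemma foldr_comp_append:
  "foldr (\<lambda>j g. F j \<circ> g) (xs @ ys) id = foldr (\<lambda>j g. F j \<circ> g) xs id \<circ> foldr (\<lambda>j g. F j \<circ> g) ys id"
  by (induction xs) (auto simp: comp_assoc)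

text \<open>The cocycle identity: a prefix of \<open>u @ v\<close> that contains \<open>u\<close> is
  a node of the subtree at \<open>u\<close>, where the tail reads its labels.\<close>

lemma word_map_append:
  "word_map T \<omega> (u @ v) = word_map T \<omega> u \<circ> word_map T (\<lambda>w. \<omega> (u @ w)) v"
proof -
  let ?F = "\<lambda>j. T (the (\<omega> (take j (u @ v)))) ((u @ v) ! j)"
  have "[0..<length (u @ v)] = [0..<length u] @ map (\<lambda>j. j + length u) [0..<length v]"
    by (simp add: map_add_upt upt_add_eq_append[of 0, simplified] add.commute)
  then have "word_map T \<omega> (u @ v) = foldr (\<lambda>j g. ?F j \<circ> g) [0..<length u] id
      \<circ> foldr (\<lambda>j g. ?F j \<circ> g) (map (\<lambda>j. j + length u) [0..<length v]) id"
    unfolding word_map_def by (simp only: foldr_comp_append)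
  also have "foldr (\<lambda>j g. ?F j \<circ> g) [0..<length u] id = word_map T \<omega> u"
    unfolding word_map_def by (intro foldr_cong) (auto simp: nth_append)
  also have "foldr (\<lambda>j g. ?F j \<circ> g) (map (\<lambda>j. j + length u) [0..<length v]) id
      = word_map T (\<lambda>w. \<omega> (u @ w)) v"
    unfolding word_map_def foldr_map by (intro foldr_cong) (auto simp: nth_append)
  finally show ?thesis .
qed

lemma word_map_Nil: "word_map T \<omega> [] = id"
  by (simp add: word_map_def)

lemma word_map_single: "word_map T \<omega> [l] = T (the (\<omega> [])) l"
  by (simp add: word_map_def)

lemma word_map_cong:
  assumes "\<And>v. length v < length w \<Longrightarrow> \<omega>' v = \<omega> v"
  shows "word_map T \<omega>' w = word_map T \<omega> w"
  unfolding word_map_def using assms by (intro foldr_cong) auto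

text \<open>Word maps read only proper prefixes, but agreement at length \<open>k\<close> itself is
  needed too: it decides which words of that length lie in the domain. The point is measurability,
  since a level sum depends on finitely many levels.\<close>

lemma level_sum_cong:
  assumes "\<And>v. length v \<le> k \<Longrightarrow> \<omega>' v = \<omega> v"
  shows "level_sum T \<omega>' k \<alpha> = level_sum T \<omega> k \<alpha>"
  unfolding level_sum_def
proof (rule sum.cong)
  show "{w. w \<in> dom \<omega>' \<and> length w = k} = {w. w \<in> dom \<omega> \<and> length w = k}"
    using assms by (auto simp: dom_def)
  show "sv_function \<alpha> (word_map T \<omega>' w) = sv_function \<alpha> (word_map T \<omega> w)"
    if "w \<in> {w. w \<in> dom \<omega> \<and> length w = k}" for w
    using word_map_cong[of w \<omega>' \<omega> T] assms that by auto
qed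

section \<open>Uniform estimates for level sums\<close>

locale code_tree_system =
  fixes \<Lambda> :: "'l set" and Mb :: "'l \<Rightarrow> nat"
    and T :: "'l \<Rightarrow> nat \<Rightarrow> real ^ 'n \<Rightarrow> real ^ 'n" and \<sigma>l \<sigma>u :: real
  assumes Mb_pos: "\<And>l. l \<in> \<Lambda> \<Longrightarrow> 1 \<le> Mb l"
    and Mb_bdd: "bdd_above (Mb ` \<Lambda>)"
    and T_linear: "\<And>l i. l \<in> \<Lambda> \<Longrightarrow> 1 \<le> i \<Longrightarrow> i \<le> Mb l \<Longrightarrow> linear (T l i)"
    and T_nonsing: "\<And>l i. l \<in> \<Lambda> \<Longrightarrow> 1 \<le> i \<Longrightarrow> i \<le> Mb l \<Longrightarrow> bij (T l i)"
    and sigma_range: "0 < \<sigma>l" "\<sigma>l \<le> \<sigma>u" "\<sigma>u < 1"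
    and T_lower: "\<And>l i. l \<in> \<Lambda> \<Longrightarrow> 1 \<le> i \<Longrightarrow> i \<le> Mb l \<Longrightarrow> \<sigma>l \<le> singular_value (T l i) CARD('n)"
    and T_upper: "\<And>l i. l \<in> \<Lambda> \<Longrightarrow> 1 \<le> i \<Longrightarrow> i \<le> Mb l \<Longrightarrow> singular_value (T l i) 1 \<le> \<sigma>u"
begin

abbreviation trees :: "(nat list \<rightharpoonup> 'l) set" where
  "trees \<equiv> code_trees \<Lambda> Mb"

abbreviation S :: "(nat list \<rightharpoonup> 'l) \<Rightarrow> nat \<Rightarrow> real \<Rightarrow> real" where
  "S \<equiv> level_sum T"

definition M :: nat where
  "M = (SUP l\<in>\<Lambda>. Mb l)"

lemmas trees_iff = code_trees_iff[OF Mb_bdd]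
lemmas tree_prefix = code_tree_prefix[OF Mb_bdd]
lemmas tree_subtree = code_tree_subtree[OF Mb_bdd]

lemma
  assumes "\<omega> \<in> trees"
  shows tree_Nil: "[] \<in> dom \<omega>"
    and tree_snoc: "w @ [l] \<in> dom \<omega> \<longleftrightarrow> w \<in> dom \<omega> \<and> 1 \<le> l \<and> l \<le> Mb (the (\<omega> w))"
    and tree_label: "w \<in> dom \<omega> \<Longrightarrow> the (\<omega> w) \<in> \<Lambda>"
  using assms unfolding trees_iff by blast+

lemma M_pos: "\<omega> \<in> trees \<Longrightarrow> 1 \<le> M"
proof -
  assume "\<omega> \<in> trees"
  then have "the (\<omega> []) \<in> \<Lambda>"
    using tree_Nil tree_label by blast
  then show "1 \<le> M"
    unfolding M_def using Mb_pos cSUP_upper[OF _ Mb_bdd] by (meson order_trans)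
qed

lemma
  assumes \<omega>: "\<omega> \<in> trees"
  shows finite_level: "finite (level \<omega> k)" and card_level: "card (level \<omega> k) \<le> M ^ k"
proof -
  have "dom \<omega> \<subseteq> lists {1..M}"
  proof
    fix w show "w \<in> dom \<omega> \<Longrightarrow> w \<in> lists {1..M}"
    proof (induction w rule: rev_induct)
      case (snoc l w)
      then have w: "w \<in> dom \<omega>" "1 \<le> l" "l \<le> Mb (the (\<omega> w))"
        using tree_snoc[OF \<omega>] by auto
      then have "l \<le> M"
        unfolding M_def using cSUP_upper[OF tree_label[OF \<omega> w(1)] Mb_bdd] by linarith
      then show ?case
        using snoc.IH w by simp
    qed simp
  qed
  then have sub: "level \<omega> k \<subseteq> {w. set w \<subseteq> {1..M} \<and> length w = k}"
    by (auto simp: level_def)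
  have fin: "finite {w. set w \<subseteq> {1..M} \<and> length w = k}"
    by (rule finite_lists_length_eq) simp
  show "finite (level \<omega> k)"
    by (rule finite_subset[OF sub fin])
  show "card (level \<omega> k) \<le> M ^ k"
    using card_mono[OF fin sub] by (simp add: card_lists_length_eq)
qed

lemma level_nonempty:
  assumes \<omega>: "\<omega> \<in> trees"
  shows "level \<omega> k \<noteq> {}"
proof (induction k)
  case 0
  then show ?case
    using tree_Nil[OF \<omega>] by (auto simp: level_def)
next
  case (Suc k)
  then obtain w where w: "w \<in> dom \<omega>" "length w = k"
    by (auto simp: level_def)
  then have "w @ [1] \<in> level \<omega> (Suc k)"
    using Mb_pos[OF tree_label[OF \<omega> w(1)]] by (simp add: level_def tree_snoc[OF \<omega>])
  then show ?case
    by blast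
qed

text \<open>Under composition the largest singular value is submultiplicative and the smallest
  supermultiplicative, so each letter costs a factor of at most \<open>\<sigma>u\<close> and at
  least \<open>\<sigma>l\<close>.\<close>

lemma word_map_props:
  assumes \<omega>: "\<omega> \<in> trees" and w: "w \<in> dom \<omega>"
  shows "linear (word_map T \<omega> w) \<and> bij (word_map T \<omega> w) \<and>
    \<sigma>l ^ length w \<le> singular_value (word_map T \<omega> w) CARD('n) \<and>
    singular_value (word_map T \<omega> w) 1 \<le> \<sigma>u ^ length w"
  using w
proof (induction w rule: rev_induct)
  case Nil
  show ?case
    unfolding word_map_Nil
    by (intro conjI linear_id bij_id; subst singular_value_id) (auto simp: Suc_leI)
next
  case (snoc l w)
  let ?W = "word_map T \<omega> w" and ?T = "T (the (\<omega> w)) l"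
  have wl: "w \<in> dom \<omega>" "1 \<le> l" "l \<le> Mb (the (\<omega> w))"
    using snoc.prems tree_snoc[OF \<omega>] by auto
  note lab = tree_label[OF \<omega> wl(1)] wl(2,3)
  have Tl: "linear ?T" "bij ?T" "\<sigma>l \<le> singular_value ?T CARD('n)" "singular_value ?T 1 \<le> \<sigma>u"
    using T_linear[OF lab] T_nonsing[OF lab] T_lower[OF lab] T_upper[OF lab] by auto
  have W: "linear ?W" "bij ?W" "\<sigma>l ^ length w \<le> singular_value ?W CARD('n)"
    "singular_value ?W 1 \<le> \<sigma>u ^ length w"
    using snoc.IH[OF wl(1)] by auto
  have eq: "word_map T \<omega> (w @ [l]) = ?W \<circ> ?T"
    by (simp add: word_map_append word_map_single)
  have posT: "0 < singular_value ?T 1" "0 < singular_value ?T CARD('n)"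
    using Tl by (auto intro!: singular_value_pos bij_is_inj simp: Suc_leI)
  have "\<sigma>l * \<sigma>l ^ length w \<le> singular_value ?T CARD('n) * singular_value ?W CARD('n)"
    using Tl(3) W(3) posT sigma_range by (intro mult_mono) auto
  also have "\<dots> \<le> singular_value (?W \<circ> ?T) CARD('n)"
    using singular_value_compose(4)[OF W(1,2) Tl(1,2), of "CARD('n)"] by (simp add: Suc_leI)
  finally have 1: "\<sigma>l ^ length (w @ [l]) \<le> singular_value (?W \<circ> ?T) CARD('n)"
    by simp
  have "0 < singular_value ?W 1"
    using W by (auto intro!: singular_value_pos bij_is_inj simp: Suc_leI)
  then have "singular_value ?T 1 * singular_value ?W 1 \<le> \<sigma>u * \<sigma>u ^ length w"
    using Tl(4) W(4) posT sigma_range by (intro mult_mono) auto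
  moreover have "singular_value (?W \<circ> ?T) 1 \<le> singular_value ?T 1 * singular_value ?W 1"
    using singular_value_compose(2)[OF W(1,2) Tl(1,2), of 1] by (simp add: Suc_leI)
  ultimately have 2: "singular_value (?W \<circ> ?T) 1 \<le> \<sigma>u ^ length (w @ [l])"
    by simp
  show ?case
    unfolding eq by (intro conjI 1 2 linear_compose bij_comp W(1,2) Tl(1,2))
qed

lemma
  assumes "\<omega> \<in> trees" "w \<in> level \<omega> k"
  shows word_map_linear: "linear (word_map T \<omega> w)"
    and word_map_bij: "bij (word_map T \<omega> w)"
    and word_map_lower: "\<sigma>l ^ k \<le> singular_value (word_map T \<omega> w) CARD('n)"
    and word_map_upper: "singular_value (word_map T \<omega> w) 1 \<le> \<sigma>u ^ k"
  using word_map_props[of \<omega> w] assms by (auto simp: level_def)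

lemma sigma_power: "\<sigma>u ^ k \<le> 1" "0 < \<sigma>l ^ k"
  using sigma_range by (auto intro!: power_le_one)

lemma level_sum_level: "S \<omega> k \<alpha> = (\<Sum>w\<in>level \<omega> k. sv_function \<alpha> (word_map T \<omega> w))"
  by (simp add: level_sum_def level_def)

lemma sv_function_word_pos:
  "\<omega> \<in> trees \<Longrightarrow> w \<in> level \<omega> k \<Longrightarrow> 0 \<le> \<alpha> \<Longrightarrow> 0 < sv_function \<alpha> (word_map T \<omega> w)"
  by (intro sv_function_pos word_map_linear word_map_bij)

lemma level_sum_pos: "\<omega> \<in> trees \<Longrightarrow> 0 \<le> \<alpha> \<Longrightarrow> 0 < S \<omega> k \<alpha>"
  unfolding level_sum_level by (intro sum_pos finite_level level_nonempty sv_function_word_pos)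

lemma level_sum_0: "\<omega> \<in> trees \<Longrightarrow> 0 \<le> \<alpha> \<Longrightarrow> S \<omega> 0 \<alpha> = 1"
proof -
  assume "\<omega> \<in> trees" "0 \<le> \<alpha>"
  then have "level \<omega> 0 = {[]}"
    using tree_Nil by (auto simp: level_def)
  then show "S \<omega> 0 \<alpha> = 1"
    using \<open>0 \<le> \<alpha>\<close> by (simp add: level_sum_level word_map_Nil sv_function_id)
qed

text \<open>Words are cut after \<open>j\<close> letters; the second piece is a word of the subtree
  at the first.\<close>

lemma level_sum_add:
  assumes \<omega>: "\<omega> \<in> trees"
  shows "S \<omega> (j + k) \<alpha> = (\<Sum>u\<in>level \<omega> j. \<Sum>v\<in>level (\<lambda>w. \<omega> (u @ w)) k.
    sv_function \<alpha> (word_map T \<omega> u \<circ> word_map T (\<lambda>w. \<omega> (u @ w)) v))"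
proof -
  have "(\<Sum>u\<in>level \<omega> j. \<Sum>v\<in>level (\<lambda>w. \<omega> (u @ w)) k.
      sv_function \<alpha> (word_map T \<omega> u \<circ> word_map T (\<lambda>w. \<omega> (u @ w)) v))
    = (\<Sum>(u, v)\<in>(SIGMA u:level \<omega> j. level (\<lambda>w. \<omega> (u @ w)) k). sv_function \<alpha> (word_map T \<omega> (u @ v)))"
    using finite_level[OF \<omega>] finite_level[OF tree_subtree[OF \<omega>]]
    by (subst sum.Sigma) (auto simp: level_def word_map_append)
  also have "\<dots> = (\<Sum>w\<in>level \<omega> (j + k). sv_function \<alpha> (word_map T \<omega> w))"
  proof (rule sum.reindex_bij_witness[of _ "\<lambda>w. (take j w, drop j w)" "\<lambda>(u, v). u @ v"])
    fix w assume w: "w \<in> level \<omega> (j + k)"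
    have "take j w \<in> dom \<omega>"
      using tree_prefix[OF \<omega>, of "take j w" "drop j w"] w by (simp add: level_def)
    then show "(take j w, drop j w) \<in> (SIGMA u:level \<omega> j. level (\<lambda>w. \<omega> (u @ w)) k)"
      using w by (auto simp: level_def dom_def)
  qed (auto simp: level_def dom_def)
  finally show ?thesis
    by (simp add: level_sum_level)
qed

text \<open>This rate bounds the change of \<open>ln S\<close> per level in either direction:
  branching raises it by at most \<open>ln M\<close>, and contraction lowers it by at most
  \<open>- \<alpha> * ln \<sigma>l\<close>.\<close>

lemma log_rate_nonneg: "\<omega> \<in> trees \<Longrightarrow> 0 \<le> \<alpha> \<Longrightarrow> 0 \<le> ln (real M) - \<alpha> * ln \<sigma>l"
proof -
  assume "\<omega> \<in> trees" "0 \<le> \<alpha>"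
  moreover have "ln \<sigma>l \<le> 0"
    using sigma_range by simp
  ultimately have "0 \<le> ln (real M)" "\<alpha> * ln \<sigma>l \<le> 0"
    using M_pos[of \<omega>] by (auto simp: mult_nonneg_nonpos)
  then show "0 \<le> ln (real M) - \<alpha> * ln \<sigma>l"
    by simp
qed

lemma ln_ratio_bound:
  assumes \<omega>: "\<omega> \<in> trees" and \<alpha>: "0 \<le> \<alpha>" and pos: "0 < a" "0 < b"
    and lower: "(\<sigma>l ^ k) powr \<alpha> * b \<le> a" and upper: "a \<le> real (M ^ k) * b"
  shows "\<bar>ln a - ln b\<bar> \<le> (ln (real M) - \<alpha> * ln \<sigma>l) * real k"
proof -
  have M: "1 \<le> M"
    by (rule M_pos[OF \<omega>])
  have "ln a \<le> ln (real (M ^ k) * b)"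
    using upper pos by simp
  also have "\<dots> = real k * ln (real M) + ln b"
    using M pos by (simp add: ln_mult ln_realpow)
  finally have 1: "ln a - ln b \<le> real k * ln (real M)"
    by simp
  have "ln ((\<sigma>l ^ k) powr \<alpha> * b) \<le> ln a"
    using lower pos sigma_range by simp
  moreover have "ln ((\<sigma>l ^ k) powr \<alpha> * b) = \<alpha> * (real k * ln \<sigma>l) + ln b"
    using sigma_range pos by (simp add: ln_mult ln_realpow ln_powr)
  ultimately have 2: "\<alpha> * (real k * ln \<sigma>l) \<le> ln a - ln b"
    by simp
  have "\<alpha> * (real k * ln \<sigma>l) \<le> 0" "0 \<le> real k * ln (real M)"
    using \<alpha> sigma_range M by (auto intro!: mult_nonneg_nonpos)
  then show ?thesis
    using 1 2 by (simp add: abs_le_iff algebra_simps)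
qed

text \<open>A word has at most \<open>M ^ k\<close> continuations by \<open>k\<close> letters, none
  of which raises the singular value function, since no singular value exceeds 1. It has at least
  one, which costs at most the factor \<open>(\<sigma>l ^ k) powr \<alpha>\<close>.\<close>

lemma level_sum_extend:
  assumes \<omega>: "\<omega> \<in> trees" and \<alpha>: "0 \<le> \<alpha>"
  shows "\<bar>ln (S \<omega> (j + k) \<alpha>) - ln (S \<omega> j \<alpha>)\<bar> \<le> (ln (real M) - \<alpha> * ln \<sigma>l) * real k"
proof (rule ln_ratio_bound[OF \<omega> \<alpha> level_sum_pos[OF \<omega> \<alpha>] level_sum_pos[OF \<omega> \<alpha>]])
  let ?\<omega> = "\<lambda>u w. \<omega> (u @ w)"
  let ?W = "\<lambda>u. word_map T \<omega> u"
  have sub: "?\<omega> u \<in> trees" if "u \<in> level \<omega> j" for u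
    using that by (intro tree_subtree[OF \<omega>]) (simp add: level_def)
  have summand: "(\<sigma>l ^ k) powr \<alpha> * sv_function \<alpha> (?W u) \<le> sv_function \<alpha> (?W u \<circ> word_map T (?\<omega> u) v)"
    "sv_function \<alpha> (?W u \<circ> word_map T (?\<omega> u) v) \<le> sv_function \<alpha> (?W u)"
    if u: "u \<in> level \<omega> j" and v: "v \<in> level (?\<omega> u) k" for u v
  proof -
    note W = word_map_linear[OF \<omega> u] word_map_bij[OF \<omega> u]
    note V = word_map_linear[OF sub[OF u] v] word_map_bij[OF sub[OF u] v]
    note b = sv_function_compose_bounds[OF W V \<alpha>]
    have pos: "0 \<le> sv_function \<alpha> (?W u)"
      using sv_function_word_pos[OF \<omega> u \<alpha>] by simp
    have "(\<sigma>l ^ k) powr \<alpha> * sv_function \<alpha> (?W u)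
        \<le> singular_value (word_map T (?\<omega> u) v) CARD('n) powr \<alpha> * sv_function \<alpha> (?W u)"
      using word_map_lower[OF sub[OF u] v] sigma_power[of k] \<alpha> pos
      by (intro mult_right_mono powr_mono2) auto
    also have "\<dots> \<le> sv_function \<alpha> (?W u \<circ> word_map T (?\<omega> u) v)"
      using b(4) by simp
    finally show "(\<sigma>l ^ k) powr \<alpha> * sv_function \<alpha> (?W u) \<le> sv_function \<alpha> (?W u \<circ> word_map T (?\<omega> u) v)" .
    have "0 < singular_value (word_map T (?\<omega> u) v) 1"
      by (intro singular_value_pos V bij_is_inj) (auto simp: Suc_leI)
    then have "singular_value (word_map T (?\<omega> u) v) 1 powr \<alpha> \<le> 1"
      using word_map_upper[OF sub[OF u] v] sigma_power[of k] \<alpha> by (intro powr_le1) auto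
    then have "singular_value (word_map T (?\<omega> u) v) 1 powr \<alpha> * sv_function \<alpha> (?W u)
        \<le> 1 * sv_function \<alpha> (?W u)"
      using pos by (rule mult_right_mono)
    then show "sv_function \<alpha> (?W u \<circ> word_map T (?\<omega> u) v) \<le> sv_function \<alpha> (?W u)"
      using b(2) by simp
  qed
  have "(\<sigma>l ^ k) powr \<alpha> * sv_function \<alpha> (?W u)
      \<le> (\<Sum>v\<in>level (?\<omega> u) k. sv_function \<alpha> (?W u \<circ> word_map T (?\<omega> u) v))" if u: "u \<in> level \<omega> j" for u
  proof -
    obtain v where v: "v \<in> level (?\<omega> u) k"
      using level_nonempty[OF sub[OF u]] by blast
    note pos = sv_function_pos[OF linear_compose[OF word_map_linear[OF sub[OF u]] word_map_linear[OF \<omega> u]]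
        bij_comp[OF word_map_bij[OF sub[OF u]] word_map_bij[OF \<omega> u]] \<alpha>]
    have "sv_function \<alpha> (?W u \<circ> word_map T (?\<omega> u) v)
      \<le> (\<Sum>v\<in>level (?\<omega> u) k. sv_function \<alpha> (?W u \<circ> word_map T (?\<omega> u) v))"
      using pos by (intro member_le_sum v finite_level[OF sub[OF u]] less_imp_le) auto
    then show ?thesis
      using summand(1)[OF u v] by linarith
  qed
  then show "(\<sigma>l ^ k) powr \<alpha> * S \<omega> j \<alpha> \<le> S \<omega> (j + k) \<alpha>"
    unfolding level_sum_add[OF \<omega>] level_sum_level[of \<omega> j] sum_distrib_left by (rule sum_mono)
  have "(\<Sum>v\<in>level (?\<omega> u) k. sv_function \<alpha> (?W u \<circ> word_map T (?\<omega> u) v))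
      \<le> real (M ^ k) * sv_function \<alpha> (?W u)" if u: "u \<in> level \<omega> j" for u
  proof -
    have "(\<Sum>v\<in>level (?\<omega> u) k. sv_function \<alpha> (?W u \<circ> word_map T (?\<omega> u) v))
        \<le> real (card (level (?\<omega> u) k)) * sv_function \<alpha> (?W u)"
      using summand(2)[OF u] by (intro sum_bounded_above) auto
    also have "\<dots> \<le> real (M ^ k) * sv_function \<alpha> (?W u)"
      using card_level[OF sub[OF u], of k] sv_function_word_pos[OF \<omega> u \<alpha>]
      by (intro mult_right_mono) (auto simp del: of_nat_power)
    finally show ?thesis .
  qed
  then show "S \<omega> (j + k) \<alpha> \<le> real (M ^ k) * S \<omega> j \<alpha>"
    unfolding level_sum_add[OF \<omega>] level_sum_level[of \<omega> j] sum_distrib_left by (rule sum_mono)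
qed

section \<open>Level sums split at a neck level\<close>

context
  fixes \<omega> \<omega>' :: "nat list \<rightharpoonup> 'l" and j :: nat
  assumes \<omega>: "\<omega> \<in> trees" and \<omega>': "\<omega>' \<in> trees"
    and neck: "\<And>u w. u \<in> level \<omega> j \<Longrightarrow> \<omega> (u @ w) = \<omega>' w"
begin

lemma level_sum_neck:
  "S \<omega> (j + k) \<alpha> = (\<Sum>u\<in>level \<omega> j. \<Sum>v\<in>level \<omega>' k. sv_function \<alpha> (word_map T \<omega> u \<circ> word_map T \<omega>' v))"
  unfolding level_sum_add[OF \<omega>] by (intro sum.cong) (simp_all add: neck)

lemma level_sum_neck_product:
  "S \<omega> j \<alpha> * S \<omega>' k \<alpha> = (\<Sum>u\<in>level \<omega> j. \<Sum>v\<in>level \<omega>' k.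
     sv_function \<alpha> (word_map T \<omega> u) * sv_function \<alpha> (word_map T \<omega>' v))"
  by (simp add: level_sum_level sum_product)

lemma level_sum_neck_submult:
  assumes \<alpha>: "0 \<le> \<alpha>" "\<alpha> < real CARD('n)"
  shows "S \<omega> (j + k) \<alpha> \<le> S \<omega> j \<alpha> * S \<omega>' k \<alpha>"
  unfolding level_sum_neck level_sum_neck_product
  by (intro sum_mono sv_function_submult \<alpha>; (rule word_map_linear word_map_bij; (rule \<omega> \<omega>' | assumption)))

lemma level_sum_neck_supermult:
  assumes \<alpha>: "real CARD('n) \<le> \<alpha>"
  shows "S \<omega> j \<alpha> * S \<omega>' k \<alpha> \<le> S \<omega> (j + k) \<alpha>"
  unfolding level_sum_neck level_sum_neck_product
  by (intro sum_mono sv_function_supermult \<alpha>; (rule word_map_linear word_map_bij; (rule \<omega> \<omega>' | assumption)))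

text \<open>The counterpart of \<open>level_sum_extend\<close> at the root: the same tree
  \<open>\<omega>'\<close> hangs below each of the at most \<open>M ^ j\<close> words of level
  \<open>j\<close>, and a single one of them already gives the lower bound.\<close>

lemma level_sum_neck_shift:
  assumes \<alpha>: "0 \<le> \<alpha>"
  shows "\<bar>ln (S \<omega> (j + k) \<alpha>) - ln (S \<omega>' k \<alpha>)\<bar> \<le> (ln (real M) - \<alpha> * ln \<sigma>l) * real j"
proof (rule ln_ratio_bound[OF \<omega> \<alpha> level_sum_pos[OF \<omega> \<alpha>] level_sum_pos[OF \<omega>' \<alpha>]])
  let ?W = "\<lambda>u. word_map T \<omega> u" and ?V = "\<lambda>v. word_map T \<omega>' v"
  have summand: "(\<sigma>l ^ j) powr \<alpha> * sv_function \<alpha> (?V v) \<le> sv_function \<alpha> (?W u \<circ> ?V v)"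
    "sv_function \<alpha> (?W u \<circ> ?V v) \<le> sv_function \<alpha> (?V v)"
    if u: "u \<in> level \<omega> j" and v: "v \<in> level \<omega>' k" for u v
  proof -
    note W = word_map_linear[OF \<omega> u] word_map_bij[OF \<omega> u]
    note V = word_map_linear[OF \<omega>' v] word_map_bij[OF \<omega>' v]
    note b = sv_function_compose_bounds[OF W V \<alpha>]
    have pos: "0 \<le> sv_function \<alpha> (?V v)"
      using sv_function_word_pos[OF \<omega>' v \<alpha>] by simp
    have "(\<sigma>l ^ j) powr \<alpha> * sv_function \<alpha> (?V v) \<le> singular_value (?W u) CARD('n) powr \<alpha> * sv_function \<alpha> (?V v)"
      using word_map_lower[OF \<omega> u] sigma_power[of j] \<alpha> pos
      by (intro mult_right_mono powr_mono2) auto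
    also have "\<dots> \<le> sv_function \<alpha> (?W u \<circ> ?V v)"
      using b(3) by simp
    finally show "(\<sigma>l ^ j) powr \<alpha> * sv_function \<alpha> (?V v) \<le> sv_function \<alpha> (?W u \<circ> ?V v)" .
    have "0 < singular_value (?W u) 1"
      by (intro singular_value_pos W bij_is_inj) (auto simp: Suc_leI)
    then have "singular_value (?W u) 1 powr \<alpha> \<le> 1"
      using word_map_upper[OF \<omega> u] sigma_power[of j] \<alpha> by (intro powr_le1) auto
    then have "singular_value (?W u) 1 powr \<alpha> * sv_function \<alpha> (?V v) \<le> 1 * sv_function \<alpha> (?V v)"
      using pos by (rule mult_right_mono)
    then show "sv_function \<alpha> (?W u \<circ> ?V v) \<le> sv_function \<alpha> (?V v)"
      using b(1) by simp
  qed
  have sum_summand: "(\<sigma>l ^ j) powr \<alpha> * S \<omega>' k \<alpha> \<le> (\<Sum>v\<in>level \<omega>' k. sv_function \<alpha> (?W u \<circ> ?V v))"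
    "(\<Sum>v\<in>level \<omega>' k. sv_function \<alpha> (?W u \<circ> ?V v)) \<le> S \<omega>' k \<alpha>" if u: "u \<in> level \<omega> j" for u
    unfolding level_sum_level[of \<omega>' k] sum_distrib_left by (intro sum_mono summand u; assumption)+
  obtain u where u: "u \<in> level \<omega> j"
    using level_nonempty[OF \<omega>] by blast
  have nonneg: "0 \<le> (\<Sum>v\<in>level \<omega>' k. sv_function \<alpha> (?W u \<circ> ?V v))" if "u \<in> level \<omega> j" for u
  proof -
    have "0 \<le> (\<sigma>l ^ j) powr \<alpha> * S \<omega>' k \<alpha>"
      using level_sum_pos[OF \<omega>' \<alpha>, of k] by simp
    then show ?thesis
      using sum_summand(1)[OF that] by linarith
  qed
  have "(\<Sum>v\<in>level \<omega>' k. sv_function \<alpha> (?W u \<circ> ?V v)) \<le> S \<omega> (j + k) \<alpha>"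
    unfolding level_sum_neck
    using member_le_sum[OF u _ finite_level[OF \<omega>], of "\<lambda>u. \<Sum>v\<in>level \<omega>' k. sv_function \<alpha> (?W u \<circ> ?V v)"] nonneg
    by auto
  then show "(\<sigma>l ^ j) powr \<alpha> * S \<omega>' k \<alpha> \<le> S \<omega> (j + k) \<alpha>"
    using sum_summand(1)[OF u] by linarith
  have "S \<omega> (j + k) \<alpha> \<le> real (card (level \<omega> j)) * S \<omega>' k \<alpha>"
    unfolding level_sum_neck by (intro sum_bounded_above sum_summand)
  also have "\<dots> \<le> real (M ^ j) * S \<omega>' k \<alpha>"
    using card_level[OF \<omega>, of j] level_sum_pos[OF \<omega>' \<alpha>, of k]
    by (intro mult_right_mono) (auto simp del: of_nat_power)
  finally show "S \<omega> (j + k) \<alpha> \<le> real (M ^ j) * S \<omega>' k \<alpha>" .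
qed

end

text \<open>After division by \<open>k\<close> the two slopes no longer depend on \<open>k\<close>
  or on the tree: the lower one gives equicontinuity in the exponent, the upper one strict decrease
  in the limit.\<close>

lemma level_sum_exponent:
  assumes \<omega>: "\<omega> \<in> trees" and \<alpha>: "0 \<le> \<alpha>" "\<alpha> \<le> \<beta>"
  shows "real k * (\<beta> - \<alpha>) * ln \<sigma>l \<le> ln (S \<omega> k \<beta>) - ln (S \<omega> k \<alpha>)"
    and "ln (S \<omega> k \<beta>) - ln (S \<omega> k \<alpha>) \<le> real k * (\<beta> - \<alpha>) * ln \<sigma>u"
proof -
  have \<beta>: "0 \<le> \<beta>"
    using \<alpha> by simp
  note pos = level_sum_pos[OF \<omega> \<alpha>(1), of k] level_sum_pos[OF \<omega> \<beta>, of k]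
  have bounds: "(\<sigma>l ^ k) powr (\<beta> - \<alpha>) * sv_function \<alpha> (word_map T \<omega> w) \<le> sv_function \<beta> (word_map T \<omega> w)"
    "sv_function \<beta> (word_map T \<omega> w) \<le> (\<sigma>u ^ k) powr (\<beta> - \<alpha>) * sv_function \<alpha> (word_map T \<omega> w)"
    if w: "w \<in> level \<omega> k" for w
    using sv_function_exponent_bounds[OF word_map_linear[OF \<omega> w] word_map_bij[OF \<omega> w] \<alpha>
        sigma_power(2)[of k] _ word_map_upper[OF \<omega> w]] word_map_lower[OF \<omega> w] by auto
  have "(\<sigma>l ^ k) powr (\<beta> - \<alpha>) * S \<omega> k \<alpha> \<le> S \<omega> k \<beta>"
    unfolding level_sum_level sum_distrib_left by (intro sum_mono bounds)
  then have "ln ((\<sigma>l ^ k) powr (\<beta> - \<alpha>) * S \<omega> k \<alpha>) \<le> ln (S \<omega> k \<beta>)"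
    using pos sigma_range by simp
  then show "real k * (\<beta> - \<alpha>) * ln \<sigma>l \<le> ln (S \<omega> k \<beta>) - ln (S \<omega> k \<alpha>)"
    using pos sigma_range by (simp add: ln_mult ln_powr ln_realpow mult_ac)
  have "S \<omega> k \<beta> \<le> (\<sigma>u ^ k) powr (\<beta> - \<alpha>) * S \<omega> k \<alpha>"
    unfolding level_sum_level sum_distrib_left by (intro sum_mono bounds)
  then have "ln (S \<omega> k \<beta>) \<le> ln ((\<sigma>u ^ k) powr (\<beta> - \<alpha>) * S \<omega> k \<alpha>)"
    using pos by simp
  then show "ln (S \<omega> k \<beta>) - ln (S \<omega> k \<alpha>) \<le> real k * (\<beta> - \<alpha>) * ln \<sigma>u"
    using pos sigma_range by (simp add: ln_mult ln_powr ln_realpow mult_ac)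
qed

lemma level_sum_exponent_0:
  assumes \<omega>: "\<omega> \<in> trees"
  shows "0 \<le> ln (S \<omega> k 0)"
proof -
  have "S \<omega> k 0 = (\<Sum>w\<in>level \<omega> k. 1)"
    unfolding level_sum_level
    by (intro sum.cong sv_function_0 word_map_linear[OF \<omega>] word_map_bij[OF \<omega>]) auto
  moreover have "1 \<le> card (level \<omega> k)"
    using finite_level[OF \<omega>] level_nonempty[OF \<omega>] by (simp add: Suc_le_eq card_gt_0_iff)
  ultimately show ?thesis
    by simp
qed

end

section \<open>Limits along subsequences\<close>

lemma tendsto_over_subsequence:
  fixes h :: "nat \<Rightarrow> real" and N :: "nat \<Rightarrow> nat"
  assumes lip: "\<And>j k. \<bar>h (j + k) - h j\<bar> \<le> C * real k"
    and N: "strict_mono N" "N 0 = 0"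
    and NE: "(\<lambda>m. real (N m) / real m) \<longlonglongrightarrow> E" and E: "E \<noteq> 0"
    and hF: "(\<lambda>m. h (N m) / real m) \<longlonglongrightarrow> F"
  shows "(\<lambda>k. h k / real k) \<longlonglongrightarrow> F / E"
proof -
  \<comment> \<open>Subtracting the expected drift keeps a Lipschitz bound, with constant
    \<open>C'\<close>, and reduces the claim to \<open>g k / real k\<close> tending to 0.\<close>
  define g where "g k = h k - F / E * real k" for k
  define C' where "C' = C + \<bar>F / E\<bar>"
  have g_lip: "\<bar>g (j + k) - g j\<bar> \<le> C' * real k" for j k
  proof -
    have "g (j + k) - g j = (h (j + k) - h j) - F / E * real k"
      by (simp add: g_def distrib_left)
    then have "\<bar>g (j + k) - g j\<bar> \<le> \<bar>h (j + k) - h j\<bar> + \<bar>F / E * real k\<bar>"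
      by linarith
    also have "\<dots> \<le> C * real k + \<bar>F / E\<bar> * real k"
      using lip[of j k] by (simp add: abs_mult)
    finally show ?thesis
      by (simp add: C'_def distrib_right)
  qed
  have C': "0 \<le> C'"
    using g_lip[of 0 1] by simp
  \<comment> \<open>The block that contains \<open>k\<close>. By \<open>N 0 = 0\<close> there is one
    also for \<open>k\<close> below \<open>N 1\<close>.\<close>
  have "\<exists>m. N m \<le> k \<and> k < N (Suc m)" for k
  proof (induction k)
    case 0
    show ?case
      using N strict_monoD[OF N(1), of 0 1] by (intro exI[of _ 0]) simp
  next
    case (Suc k)
    then obtain m where m: "N m \<le> k" "k < N (Suc m)"
      by blast
    show ?case
    proof (cases "Suc k < N (Suc m)")
      case True
      then show ?thesis
        using m by (intro exI[of _ m]) simp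
    next
      case False
      then have "Suc k = N (Suc m)"
        using m by simp
      then show ?thesis
        using strict_monoD[OF N(1), of "Suc m" "Suc (Suc m)"] by (intro exI[of _ "Suc m"]) simp
    qed
  qed
  then obtain m where m: "\<And>k. N (m k) \<le> k" "\<And>k. k < N (Suc (m k))"
    by metis
  have m_lim: "filterlim m at_top sequentially"
    unfolding filterlim_at_top
  proof
    fix j
    have "j \<le> m k" if "N j \<le> k" for k
      using strict_mono_less[OF N(1), of j "Suc (m k)"] m(2)[of k] that by simp
    then show "\<forall>\<^sub>F k in sequentially. j \<le> m k"
      using eventually_ge_at_top[of "N j"] by (rule eventually_mono[rotated])
  qed
  have "(\<lambda>i. g (N i) / real i) \<longlonglongrightarrow> F - F / E * E"
  proof -
    have "(\<lambda>i. h (N i) / real i - F / E * (real (N i) / real i)) \<longlonglongrightarrow> F - F / E * E"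
      by (intro tendsto_intros hF NE)
    then show ?thesis
      by (simp add: g_def diff_divide_distrib)
  qed
  then have gN: "(\<lambda>i. \<bar>g (N i) / real i\<bar>) \<longlonglongrightarrow> 0"
    using E tendsto_rabs_zero[of "\<lambda>i. g (N i) / real i" sequentially] by simp
  \<comment> \<open>The gap divided by \<open>i\<close> is a difference of two sequences with the
    common limit \<open>E\<close>.\<close>
  have "(\<lambda>i. real (N (Suc i)) / real (Suc i) * (real (Suc i) / real i) - real (N i) / real i) \<longlonglongrightarrow> E * 1 - E"
    by (intro tendsto_intros LIMSEQ_Suc[OF NE] NE LIMSEQ_Suc_n_over_n)
  moreover have "\<forall>\<^sub>F i in sequentially. real (N (Suc i)) / real (Suc i) * (real (Suc i) / real i) - real (N i) / real i
      = (real (N (Suc i)) - real (N i)) / real i"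
    using eventually_gt_at_top[of 0] by eventually_elim (simp add: diff_divide_distrib del: of_nat_Suc)
  ultimately have "(\<lambda>i. (real (N (Suc i)) - real (N i)) / real i) \<longlonglongrightarrow> E * 1 - E"
    by (rule Lim_transform_eventually)
  then have gaps: "(\<lambda>i. (real (N (Suc i)) - real (N i)) / real i) \<longlonglongrightarrow> 0"
    by simp
  have "(\<lambda>i. \<bar>g (N i) / real i\<bar> + C' * ((real (N (Suc i)) - real (N i)) / real i)) \<longlonglongrightarrow> 0 + C' * 0"
    by (intro tendsto_intros gN gaps)
  then have bound: "(\<lambda>k. \<bar>g (N (m k)) / real (m k)\<bar>
      + C' * ((real (N (Suc (m k))) - real (N (m k))) / real (m k))) \<longlonglongrightarrow> 0"
    using filterlim_compose[OF _ m_lim] by simp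
  have "(\<lambda>k. g k / real k) \<longlonglongrightarrow> 0"
  proof (rule Lim_null_comparison[OF _ bound])
    have "\<forall>\<^sub>F k in sequentially. 1 \<le> m k"
      using m_lim by (simp add: filterlim_at_top)
    then show "\<forall>\<^sub>F k in sequentially. norm (g k / real k) \<le> \<bar>g (N (m k)) / real (m k)\<bar>
      + C' * ((real (N (Suc (m k))) - real (N (m k))) / real (m k))"
    proof eventually_elim
      case (elim k)
      \<comment> \<open>A strictly increasing \<open>N\<close> satisfies \<open>m \<le> N m\<close>,
        so dividing by \<open>m k\<close> in place of \<open>k\<close> only weakens the
        bound.\<close>
      have mk: "m k \<le> k"
        using strict_mono_imp_increasing[OF N(1), of "m k"] m(1)[of k] by simp
      have "\<bar>g k\<bar> \<le> \<bar>g (N (m k))\<bar> + C' * (real k - real (N (m k)))"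
        using g_lip[of "N (m k)" "k - N (m k)"] m(1)[of k] by simp
      also have "\<dots> \<le> \<bar>g (N (m k))\<bar> + C' * (real (N (Suc (m k))) - real (N (m k)))"
        using m(2)[of k] C' by (intro add_left_mono mult_left_mono) auto
      finally have "\<bar>g k\<bar> / real k \<le> (\<bar>g (N (m k))\<bar> + C' * (real (N (Suc (m k))) - real (N (m k)))) / real (m k)"
        using mk elim by (intro frac_le) auto
      then show ?case
        by (simp add: add_divide_distrib)
    qed
  qed
  then have "(\<lambda>k. g k / real k + F / E) \<longlonglongrightarrow> 0 + F / E"
    by (intro tendsto_intros)
  moreover have "\<forall>\<^sub>F k in sequentially. g k / real k + F / E = h k / real k"
    using eventually_gt_at_top[of 0] by eventually_elim (simp add: g_def diff_divide_distrib)
  ultimately have "(\<lambda>k. h k / real k) \<longlonglongrightarrow> 0 + F / E"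
    by (rule Lim_transform_eventually)
  then show ?thesis
    by simp
qed

text \<open>Compare with a rational \<open>r\<close> within \<open>e / (3 * c)\<close> of
  \<open>\<alpha>\<close>: moving from \<open>\<alpha>\<close> to \<open>r\<close> costs less than
  \<open>e / 3\<close> in \<open>q k\<close> and in \<open>F\<close>, and convergence at
  \<open>r\<close> supplies the last third.\<close>

lemma tendsto_of_rational_lipschitz:
  fixes q :: "nat \<Rightarrow> real \<Rightarrow> real"
  assumes rat: "\<And>r. r \<in> \<rat> \<Longrightarrow> 0 \<le> r \<Longrightarrow> (\<lambda>k. q k r) \<longlonglongrightarrow> F r"
    and q_lip: "\<And>k \<alpha> \<beta>. 0 < k \<Longrightarrow> 0 \<le> \<alpha> \<Longrightarrow> \<alpha> \<le> \<beta> \<Longrightarrow> \<bar>q k \<beta> - q k \<alpha>\<bar> \<le> c * (\<beta> - \<alpha>)"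
    and F_lip: "\<And>\<alpha> \<beta>. 0 \<le> \<alpha> \<Longrightarrow> \<alpha> \<le> \<beta> \<Longrightarrow> \<bar>F \<beta> - F \<alpha>\<bar> \<le> c * (\<beta> - \<alpha>)"
    and c: "0 < c" and \<alpha>: "0 \<le> \<alpha>"
  shows "(\<lambda>k. q k \<alpha>) \<longlonglongrightarrow> F \<alpha>"
proof (rule tendstoI)
  fix e :: real assume e: "0 < e"
  obtain r where r: "r \<in> \<rat>" "\<alpha> < r" "r < \<alpha> + e / (3 * c)"
    using Rats_dense_in_real[of \<alpha> "\<alpha> + e / (3 * c)"] e c by auto
  have cr: "c * (r - \<alpha>) < e / 3"
    using r(3) c by (simp add: field_simps)
  have "\<forall>\<^sub>F k in sequentially. dist (q k r) (F r) < e / 3"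
    using rat[OF r(1)] r(2) \<alpha> e by (intro tendstoD) auto
  then show "\<forall>\<^sub>F k in sequentially. dist (q k \<alpha>) (F \<alpha>) < e"
    using eventually_gt_at_top[of 0]
  proof eventually_elim
    case (elim k)
    have "\<bar>q k r - q k \<alpha>\<bar> \<le> c * (r - \<alpha>)" "\<bar>F r - F \<alpha>\<bar> \<le> c * (r - \<alpha>)"
      using q_lip[OF elim(2) \<alpha>, of r] F_lip[OF \<alpha>, of r] r(2) by auto
    then show ?case
      using elim(1) cr unfolding dist_real_def by arith
  qed
qed

section \<open>Neck trees and their topology\<close>

text \<open>Equality of partial maps includes being undefined at the same words, so the separate
  clause on domains is absorbed; exchanging the two words of length \<open>N m\<close> covers words
  outside the domain. Domains are closed under prefixes, which lets \<open>level\<close> express the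
  premises.\<close>

lemma neck_trees_iff:
  "(\<omega>, N) \<in> neck_trees \<Lambda> Mb \<longleftrightarrow> \<omega> \<in> code_trees \<Lambda> Mb \<and> N 0 = 0 \<and> strict_mono N \<and>
     (\<forall>m\<ge>1. \<forall>u v w. u \<in> level \<omega> (N m) \<longrightarrow> v \<in> level \<omega> (N m) \<longrightarrow> \<omega> (u @ w) = \<omega> (v @ w))"
  (is "?L \<longleftrightarrow> ?A \<and> ?B \<and> ?C \<and> ?D") if bdd: "bdd_above (Mb ` \<Lambda>)"
proof -
  have 1: "?L \<longleftrightarrow> ?A \<and> ?B \<and> ?C \<and>
    (\<forall>m\<ge>1. \<forall>i i' j. length i = N m \<longrightarrow> length i' = N m \<longrightarrow> i @ j \<in> dom \<omega> \<longrightarrow> i' \<in> dom \<omega> \<longrightarrow>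
           i' @ j \<in> dom \<omega> \<and> \<omega> (i @ j) = \<omega> (i' @ j))" (is "_ \<longleftrightarrow> ?A \<and> ?B \<and> ?C \<and> ?D'")
    unfolding neck_trees_def mem_Collect_eq prod.case by (rule refl)
  have 2: "?D' \<longleftrightarrow> ?D" if A: ?A
  proof
    assume D': ?D'
    show ?D
    proof (intro allI impI)
      fix m u v w assume m: "1 \<le> m" and u: "u \<in> level \<omega> (N m)" and v: "v \<in> level \<omega> (N m)"
      show "\<omega> (u @ w) = \<omega> (v @ w)"
      proof (cases "u @ w \<in> dom \<omega>")
        case True
        then show ?thesis
          using D'[rule_format, of m u v w] m u v by (simp add: level_def)
      next
        case False
        then have "v @ w \<notin> dom \<omega>"
          using D'[rule_format, of m v u w] m u v by (auto simp: level_def)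
        then show ?thesis
          using False by (simp add: domIff)
      qed
    qed
  next
    assume D: ?D
    show ?D'
    proof (intro allI impI)
      fix m i i' j assume m: "1 \<le> m" and i: "length i = N m" "length i' = N m" "i @ j \<in> dom \<omega>" "i' \<in> dom \<omega>"
      have "i \<in> dom \<omega>"
        using code_tree_prefix[OF bdd A i(3)] .
      then have "\<omega> (i @ j) = \<omega> (i' @ j)"
        using i by (intro D[rule_format, OF m]) (simp_all add: level_def)
      then show "i' @ j \<in> dom \<omega> \<and> \<omega> (i @ j) = \<omega> (i' @ j)"
        using i(3) by (simp add: domIff)
    qed
  qed
  show ?thesis
  proof (cases ?A)
    case True
    then show ?thesis
      using 1 2[OF True] by (simp only:)
  next
    case False
    then show ?thesis
      using 1 by (simp only: simp_thms)
  qed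
qed

context code_tree_system
begin

lemmas neck_iff = neck_trees_iff[OF Mb_bdd]

lemma
  assumes "(\<omega>, N) \<in> neck_trees \<Lambda> Mb"
  shows neck_tree: "\<omega> \<in> trees" and neck_0: "N 0 = 0" and neck_mono: "strict_mono N"
    and neck_eq: "1 \<le> m \<Longrightarrow> u \<in> level \<omega> (N m) \<Longrightarrow> v \<in> level \<omega> (N m) \<Longrightarrow> \<omega> (u @ w) = \<omega> (v @ w)"
  using assms unfolding neck_iff by blast+

lemma neck_shift_eq:
  assumes x: "(\<omega>, N) \<in> neck_trees \<Lambda> Mb" and u: "u \<in> level \<omega> (N 1)"
  shows "neck_shift (\<omega>, N) = (\<lambda>w. \<omega> (u @ w), \<lambda>m. N (Suc m) - N 1)"
proof -
  let ?i = "SOME i. i \<in> dom \<omega> \<and> length i = N 1"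
  have "?i \<in> dom \<omega> \<and> length ?i = N 1"
    by (rule someI[of _ u]) (use u in \<open>simp add: level_def\<close>)
  then have "?i \<in> level \<omega> (N 1)"
    by (simp add: level_def)
  then have "\<omega> (?i @ w) = \<omega> (u @ w)" for w
    by (intro neck_eq[OF x, of 1] u) simp_all
  then show ?thesis
    unfolding neck_shift_def by simp
qed

lemma neck_shift_in:
  assumes x: "x \<in> neck_trees \<Lambda> Mb"
  shows "neck_shift x \<in> neck_trees \<Lambda> Mb"
proof -
  obtain \<omega> N where xe: "x = (\<omega>, N)"
    by (cases x)
  note x' = x[unfolded xe]
  obtain u where u: "u \<in> level \<omega> (N 1)"
    using level_nonempty[OF neck_tree[OF x']] by blast
  have le: "N 1 \<le> N (Suc m)" for m
    using strict_mono_less_eq[OF neck_mono[OF x']] by simp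
  have "(\<lambda>w. \<omega> (u @ w), \<lambda>m. N (Suc m) - N 1) \<in> neck_trees \<Lambda> Mb"
    unfolding neck_iff
  proof (intro conjI allI impI)
    show "(\<lambda>w. \<omega> (u @ w)) \<in> trees"
      using u by (intro tree_subtree neck_tree[OF x']) (simp add: level_def)
    show "strict_mono (\<lambda>m. N (Suc m) - N 1)"
    proof (rule strict_monoI)
      fix a b :: nat assume "a < b"
      then have "N (Suc a) < N (Suc b)"
        using strict_monoD[OF neck_mono[OF x']] by simp
      then show "N (Suc a) - N 1 < N (Suc b) - N 1"
        using le[of a] by simp
    qed
    fix m v v' w
    assume v: "1 \<le> m" "v \<in> level (\<lambda>w. \<omega> (u @ w)) (N (Suc m) - N 1)"
      "v' \<in> level (\<lambda>w. \<omega> (u @ w)) (N (Suc m) - N 1)"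
    have "u @ v \<in> level \<omega> (N (Suc m))" "u @ v' \<in> level \<omega> (N (Suc m))"
      using v u le[of m] by (auto simp: level_def dom_def)
    then show "\<omega> (u @ v @ w) = \<omega> (u @ v' @ w)"
      using neck_eq[OF x', of "Suc m" "u @ v" "u @ v'" w] by simp
  qed simp
  then show ?thesis
    by (simp add: xe neck_shift_eq[OF x' u])
qed

lemma neck_funpow_in: "x \<in> neck_trees \<Lambda> Mb \<Longrightarrow> (neck_shift ^^ m) x \<in> neck_trees \<Lambda> Mb"
  by (induction m) (auto intro: neck_shift_in)

text \<open>In the induction step \<open>u\<close> is cut at length \<open>N m\<close>. The
  \<open>m\<close>-fold shift gives the subtree at the first piece, whose first neck level
  \<open>N (m + 1) - N m\<close> is the length of the second.\<close>

lemma neck_funpow_eq: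
  assumes x: "(\<omega>, N) \<in> neck_trees \<Lambda> Mb" and u: "u \<in> level \<omega> (N m)"
  shows "(neck_shift ^^ m) (\<omega>, N) = (\<lambda>w. \<omega> (u @ w), \<lambda>i. N (m + i) - N m)"
  using u
proof (induction m arbitrary: u)
  case 0
  then show ?case
    by (simp add: level_def neck_0[OF x])
next
  case (Suc m)
  let ?v = "take (N m) u" and ?w = "drop (N m) u"
  have le: "N m \<le> N (Suc m)"
    using strict_mono_less_eq[OF neck_mono[OF x]] by simp
  have "?v \<in> dom \<omega>"
    using Suc.prems by (intro tree_prefix[OF neck_tree[OF x], of ?v ?w]) (simp add: level_def)
  then have v: "?v \<in> level \<omega> (N m)"
    using Suc.prems le by (simp add: level_def)
  note IH = Suc.IH[OF v]
  have in': "(\<lambda>w. \<omega> (?v @ w), \<lambda>i. N (m + i) - N m) \<in> neck_trees \<Lambda> Mb"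
    using neck_funpow_in[OF x, of m] by (simp add: IH)
  have w: "?w \<in> level (\<lambda>w. \<omega> (?v @ w)) (N (m + 1) - N m)"
    using Suc.prems by (auto simp: level_def dom_def)
  have "(neck_shift ^^ Suc m) (\<omega>, N)
      = (\<lambda>w. \<omega> (?v @ ?w @ w), \<lambda>i. N (m + Suc i) - N m - (N (m + 1) - N m))"
    using neck_shift_eq[OF in' w] by (simp add: IH)
  moreover have "N (m + Suc i) - N m - (N (m + 1) - N m) = N (Suc m + i) - N (Suc m)" for i
    using le by simp
  ultimately show ?case
    by (simp add: append_assoc[symmetric] del: append_assoc)
qed

section \<open>Cylinders, open sets and measurability\<close>

lemma neck_cylinder_iff:
  "(\<omega>', N') \<in> neck_cylinder \<Lambda> Mb (\<omega>, N) m \<longleftrightarrow> (\<omega>', N') \<in> neck_trees \<Lambda> Mb \<and>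
     (\<forall>i\<in>{1..m}. N' i = N i) \<and> (\<forall>w. length w < N m \<longrightarrow> \<omega>' w = \<omega> w)"
  by (simp add: neck_cylinder_def)

lemma neck_cylinder_self: "x \<in> neck_trees \<Lambda> Mb \<Longrightarrow> x \<in> neck_cylinder \<Lambda> Mb x m"
  by (cases x) (simp add: neck_cylinder_iff)

lemma neck_cylinder_anti:
  assumes "x \<in> neck_trees \<Lambda> Mb" "m \<le> m'"
  shows "neck_cylinder \<Lambda> Mb x m' \<subseteq> neck_cylinder \<Lambda> Mb x m"
proof -
  obtain \<omega> N where x: "x = (\<omega>, N)"
    by (cases x)
  have "N m \<le> N m'"
    using strict_mono_less_eq[OF neck_mono] assms x by blast
  then show ?thesis
    using assms(2) by (auto simp: x neck_cylinder_iff)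
qed

lemma neck_cylinder_subset:
  assumes "y \<in> neck_cylinder \<Lambda> Mb x m" "m \<ge> 1"
  shows "neck_cylinder \<Lambda> Mb y m \<subseteq> neck_cylinder \<Lambda> Mb x m"
proof -
  obtain \<omega> N \<omega>' N' where xy: "x = (\<omega>, N)" "y = (\<omega>', N')"
    by (cases x, cases y)
  have "N' m = N m"
    using assms unfolding xy neck_cylinder_iff by auto
  then show ?thesis
    using assms(1) unfolding xy by (auto simp: neck_cylinder_iff)
qed

text \<open>The cylinders form a base: those around one point are nested, and each point of a
  cylinder may serve as its centre.\<close>

lemma openin_neck_iff:
  "openin (neck_topology \<Lambda> Mb) U \<longleftrightarrow>
     U \<subseteq> neck_trees \<Lambda> Mb \<and> (\<forall>x\<in>U. \<exists>m\<ge>1. neck_cylinder \<Lambda> Mb x m \<subseteq> U)"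
proof
  assume U: "openin (neck_topology \<Lambda> Mb) U"
  have sub: "U \<subseteq> neck_trees \<Lambda> Mb"
    using openin_subset[OF U] by (simp add: topspace_neck_topology)
  have "generate_topology_on {neck_cylinder \<Lambda> Mb x m | x m. x \<in> neck_trees \<Lambda> Mb \<and> m \<ge> 1} U"
    using U unfolding neck_topology_def openin_topology_generated_by_iff .
  \<comment> \<open>Restricted to points of \<open>neck_trees\<close>, because nestedness is known
    only around such points and the induction does not carry the inclusion along.\<close>
  then have "\<forall>x\<in>U \<inter> neck_trees \<Lambda> Mb. \<exists>m\<ge>1. neck_cylinder \<Lambda> Mb x m \<subseteq> U"
  proof induction
    case Empty
    then show ?case by simp
  next
    case (Int A B)
    show ?case
    proof
      fix x assume x: "x \<in> A \<inter> B \<inter> neck_trees \<Lambda> Mb"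
      then have xA: "x \<in> A \<inter> neck_trees \<Lambda> Mb" and xB: "x \<in> B \<inter> neck_trees \<Lambda> Mb"
        and xt: "x \<in> neck_trees \<Lambda> Mb"
        by simp_all
      obtain m where m: "m \<ge> 1" "neck_cylinder \<Lambda> Mb x m \<subseteq> A"
        using bspec[OF Int.IH(1) xA] by (elim exE conjE)
      obtain m' where m': "m' \<ge> 1" "neck_cylinder \<Lambda> Mb x m' \<subseteq> B"
        using bspec[OF Int.IH(2) xB] by (elim exE conjE)
      have "neck_cylinder \<Lambda> Mb x (max m m') \<subseteq> A \<inter> B"
      proof (rule Int_greatest)
        show "neck_cylinder \<Lambda> Mb x (max m m') \<subseteq> A"
          by (rule subset_trans[OF neck_cylinder_anti[OF xt max.cobounded1] m(2)])
        show "neck_cylinder \<Lambda> Mb x (max m m') \<subseteq> B"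
          by (rule subset_trans[OF neck_cylinder_anti[OF xt max.cobounded2] m'(2)])
      qed
      moreover have "max m m' \<ge> 1"
        using m(1) by simp
      ultimately show "\<exists>m\<ge>1. neck_cylinder \<Lambda> Mb x m \<subseteq> A \<inter> B"
        by (intro exI conjI)
    qed
  next
    case (UN K)
    show ?case
    proof
      fix x assume "x \<in> \<Union>K \<inter> neck_trees \<Lambda> Mb"
      then obtain A where A: "A \<in> K" "x \<in> A \<inter> neck_trees \<Lambda> Mb"
        by blast
      obtain m where m: "m \<ge> 1" "neck_cylinder \<Lambda> Mb x m \<subseteq> A"
        using bspec[OF UN.IH[OF A(1)] A(2)] by (elim exE conjE)
      show "\<exists>m\<ge>1. neck_cylinder \<Lambda> Mb x m \<subseteq> \<Union>K"
        by (intro exI[of _ m] conjI m(1) subset_trans[OF m(2) Union_upper[OF A(1)]])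
    qed
  next
    case (Basis s)
    then obtain y m where y: "s = neck_cylinder \<Lambda> Mb y m" "1 \<le> m"
      unfolding mem_Collect_eq by (elim exE conjE)
    show ?case
    proof
      fix x assume "x \<in> s \<inter> neck_trees \<Lambda> Mb"
      then show "\<exists>m\<ge>1. neck_cylinder \<Lambda> Mb x m \<subseteq> s"
        unfolding y(1) by (intro exI[of _ m] conjI y(2) neck_cylinder_subset) simp_all
    qed
  qed
  then show "U \<subseteq> neck_trees \<Lambda> Mb \<and> (\<forall>x\<in>U. \<exists>m\<ge>1. neck_cylinder \<Lambda> Mb x m \<subseteq> U)"
    using sub by (simp only: Int_absorb2 simp_thms)
next
  assume U: "U \<subseteq> neck_trees \<Lambda> Mb \<and> (\<forall>x\<in>U. \<exists>m\<ge>1. neck_cylinder \<Lambda> Mb x m \<subseteq> U)"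
  show "openin (neck_topology \<Lambda> Mb) U"
  proof (subst openin_subopen, intro ballI)
    fix x assume x: "x \<in> U"
    with U obtain m where m: "m \<ge> 1" "neck_cylinder \<Lambda> Mb x m \<subseteq> U"
      by auto
    have "openin (neck_topology \<Lambda> Mb) (neck_cylinder \<Lambda> Mb x m)"
      unfolding neck_topology_def using U x m(1) by (intro topology_generated_by_Basis CollectI exI[of _ x] exI[of _ m] conjI refl) auto
    then show "\<exists>V. openin (neck_topology \<Lambda> Mb) V \<and> x \<in> V \<and> V \<subseteq> U"
      using m(2) neck_cylinder_self[of x m] U x by (intro exI[of _ "neck_cylinder \<Lambda> Mb x m"] conjI) auto
  qed
qed

lemma openin_neck_subset: "openin (neck_topology \<Lambda> Mb) U \<Longrightarrow> U \<subseteq> neck_trees \<Lambda> Mb"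
  using openin_subset[of "neck_topology \<Lambda> Mb" U] by (simp only: topspace_neck_topology)

lemma space_neck_borel: "space (neck_borel \<Lambda> Mb) = neck_trees \<Lambda> Mb"
  and sets_neck_borel: "sets (neck_borel \<Lambda> Mb) = sigma_sets (neck_trees \<Lambda> Mb) {U. openin (neck_topology \<Lambda> Mb) U}"
proof -
  have "{U. openin (neck_topology \<Lambda> Mb) U} \<subseteq> Pow (neck_trees \<Lambda> Mb)"
    using openin_neck_subset by blast
  then show "space (neck_borel \<Lambda> Mb) = neck_trees \<Lambda> Mb"
    "sets (neck_borel \<Lambda> Mb) = sigma_sets (neck_trees \<Lambda> Mb) {U. openin (neck_topology \<Lambda> Mb) U}"
    by (simp_all add: neck_borel_def)
qed

text \<open>The preimage of any set is a union of cylinders of depth \<open>m\<close>, hence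
  open.\<close>

lemma locally_constant_measurable:
  assumes m: "1 \<le> m"
    and const: "\<And>x y. x \<in> neck_trees \<Lambda> Mb \<Longrightarrow> y \<in> neck_cylinder \<Lambda> Mb x m \<Longrightarrow> f y = f x"
  shows "f \<in> borel_measurable (neck_borel \<Lambda> Mb)"
proof (rule measurableI)
  fix A
  have "openin (neck_topology \<Lambda> Mb) (f -` A \<inter> neck_trees \<Lambda> Mb)"
    unfolding openin_neck_iff
  proof (intro conjI ballI exI[of _ m])
    fix x assume x: "x \<in> f -` A \<inter> neck_trees \<Lambda> Mb"
    show "neck_cylinder \<Lambda> Mb x m \<subseteq> f -` A \<inter> neck_trees \<Lambda> Mb"
    proof
      fix y assume y: "y \<in> neck_cylinder \<Lambda> Mb x m"
      then have "y \<in> neck_trees \<Lambda> Mb"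
        by (cases x, cases y) (simp add: neck_cylinder_iff)
      then show "y \<in> f -` A \<inter> neck_trees \<Lambda> Mb"
        using const[OF _ y] x by simp
    qed
  qed (use m in auto)
  then show "f -` A \<inter> space (neck_borel \<Lambda> Mb) \<in> sets (neck_borel \<Lambda> Mb)"
    unfolding space_neck_borel sets_neck_borel by (intro sigma_sets.Basic) simp
qed simp

text \<open>The shift consumes one neck level. Depth \<open>Suc m\<close> fixes the labels below
  length \<open>N (Suc m)\<close>; once \<open>N 1\<close> letters are removed, these are the labels
  below the \<open>m\<close>-th neck level of the shifted tree.\<close>

lemma neck_shift_cylinder:
  assumes x: "x \<in> neck_trees \<Lambda> Mb" and y: "y \<in> neck_cylinder \<Lambda> Mb x (Suc m)" and m: "1 \<le> m"
  shows "neck_shift y \<in> neck_cylinder \<Lambda> Mb (neck_shift x) m"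
proof -
  obtain \<omega> N \<omega>' N' where xy: "x = (\<omega>, N)" "y = (\<omega>', N')"
    by (cases x, cases y)
  note x' = x[unfolded xy(1)]
  have y': "(\<omega>', N') \<in> neck_trees \<Lambda> Mb" "\<And>i. 1 \<le> i \<Longrightarrow> i \<le> Suc m \<Longrightarrow> N' i = N i"
    "\<And>w. length w < N (Suc m) \<Longrightarrow> \<omega>' w = \<omega> w"
    using y unfolding xy neck_cylinder_iff by auto
  obtain u where u: "u \<in> level \<omega> (N 1)"
    using level_nonempty[OF neck_tree[OF x']] by blast
  have lt: "N 1 < N (Suc m)"
    using strict_monoD[OF neck_mono[OF x'], of 1 "Suc m"] m by simp
  have u': "u \<in> level \<omega>' (N' 1)"
    using u y'(2)[of 1] y'(3)[of u] lt by (auto simp: level_def dom_def)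
  have "neck_shift y \<in> neck_trees \<Lambda> Mb"
    using neck_shift_in y'(1) by (simp add: xy)
  then show ?thesis
    unfolding xy neck_shift_eq[OF x' u] neck_shift_eq[OF y'(1) u'] neck_cylinder_iff
  proof (intro conjI ballI allI impI)
    show "N' (Suc i) - N' 1 = N (Suc i) - N 1" if "i \<in> {1..m}" for i
      using y'(2)[of 1] y'(2)[of "Suc i"] that by simp
    show "\<omega>' (u @ w) = \<omega> (u @ w)" if "length w < N (Suc m) - N 1" for w
      using y'(3)[of "u @ w"] that u lt by (simp add: level_def)
  qed
qed

lemma neck_shift_measurable: "neck_shift \<in> neck_borel \<Lambda> Mb \<rightarrow>\<^sub>M neck_borel \<Lambda> Mb"
proof (rule measurable_sigma_sets[OF sets_neck_borel])
  show "{U. openin (neck_topology \<Lambda> Mb) U} \<subseteq> Pow (neck_trees \<Lambda> Mb)"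
    using openin_neck_subset by blast
  show "neck_shift \<in> space (neck_borel \<Lambda> Mb) \<rightarrow> neck_trees \<Lambda> Mb"
    by (auto simp: space_neck_borel neck_shift_in simp del: split_paired_All)
  fix U assume "U \<in> {U. openin (neck_topology \<Lambda> Mb) U}"
  then have U: "\<forall>x\<in>U. \<exists>m\<ge>1. neck_cylinder \<Lambda> Mb x m \<subseteq> U"
    by (simp add: openin_neck_iff)
  have "openin (neck_topology \<Lambda> Mb) (neck_shift -` U \<inter> neck_trees \<Lambda> Mb)"
    unfolding openin_neck_iff
  proof (intro conjI ballI)
    fix x assume x: "x \<in> neck_shift -` U \<inter> neck_trees \<Lambda> Mb"
    then obtain m where m: "m \<ge> 1" "neck_cylinder \<Lambda> Mb (neck_shift x) m \<subseteq> U"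
      using U by blast
    have "neck_cylinder \<Lambda> Mb x (Suc m) \<subseteq> neck_shift -` U \<inter> neck_trees \<Lambda> Mb"
    proof
      fix y assume y: "y \<in> neck_cylinder \<Lambda> Mb x (Suc m)"
      then have "y \<in> neck_trees \<Lambda> Mb"
        by (cases x, cases y) (simp add: neck_cylinder_iff)
      then show "y \<in> neck_shift -` U \<inter> neck_trees \<Lambda> Mb"
        using neck_shift_cylinder[OF _ y m(1)] m(2) x by blast
    qed
    then show "\<exists>m\<ge>1. neck_cylinder \<Lambda> Mb x m \<subseteq> neck_shift -` U \<inter> neck_trees \<Lambda> Mb"
      by (intro exI[of _ "Suc m"]) simp
  qed simp
  then show "neck_shift -` U \<inter> space (neck_borel \<Lambda> Mb) \<in> sets (neck_borel \<Lambda> Mb)"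
    unfolding space_neck_borel sets_neck_borel by (intro sigma_sets.Basic) simp
qed

end

section \<open>The pressure\<close>

locale neck_measure = code_tree_system \<Lambda> Mb T \<sigma>l \<sigma>u + ergodic_system P neck_shift
  for \<Lambda> :: "'l set" and Mb :: "'l \<Rightarrow> nat"
    and T :: "'l \<Rightarrow> nat \<Rightarrow> real ^ 'n \<Rightarrow> real ^ 'n" and \<sigma>l \<sigma>u :: real
    and P :: "((nat list \<rightharpoonup> 'l) \<times> (nat \<Rightarrow> nat)) measure" +
  assumes P_sets: "sets P = sets (neck_borel \<Lambda> Mb)"
    and P_N1: "(\<integral>\<^sup>+ x. ennreal (real (snd x 1)) \<partial>P) < \<infinity>"
begin

lemma space_P: "space P = neck_trees \<Lambda> Mb"
  using sets_eq_imp_space_eq[OF P_sets] by (simp only: space_neck_borel)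

lemma locally_constant_measurable_P:
  assumes "1 \<le> m" "\<And>x y. x \<in> neck_trees \<Lambda> Mb \<Longrightarrow> y \<in> neck_cylinder \<Lambda> Mb x m \<Longrightarrow> f y = f x"
  shows "f \<in> borel_measurable P"
  using locally_constant_measurable[of m f] assms
  by (simp only: measurable_cong_sets[OF P_sets refl])

definition log_sum :: "real \<Rightarrow> nat \<Rightarrow> (nat list \<rightharpoonup> 'l) \<times> (nat \<Rightarrow> nat) \<Rightarrow> real" where
  "log_sum \<alpha> m x = ln (S (fst x) (snd x m) \<alpha>)"

text \<open>Depth \<open>Suc m\<close> in place of \<open>m\<close>, since a cylinder of depth
  \<open>m\<close> fixes labels only strictly below length \<open>N m\<close>, whereas the level sum
  at \<open>N m\<close> also depends on which words of that length belong to the tree.\<close>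

lemma neck_cylinder_agree:
  assumes x: "x \<in> neck_trees \<Lambda> Mb" and y: "y \<in> neck_cylinder \<Lambda> Mb x (Suc m)"
  shows "snd y m = snd x m" and "length w \<le> snd x m \<Longrightarrow> fst y w = fst x w"
proof -
  obtain \<omega> N \<omega>' N' where xy: "x = (\<omega>, N)" "y = (\<omega>', N')"
    by (cases x, cases y)
  have y': "(\<omega>', N') \<in> neck_trees \<Lambda> Mb" "\<And>i. 1 \<le> i \<Longrightarrow> i \<le> Suc m \<Longrightarrow> N' i = N i"
    "\<And>w. length w < N (Suc m) \<Longrightarrow> \<omega>' w = \<omega> w"
    using y unfolding xy neck_cylinder_iff by auto
  show "snd y m = snd x m"
    using neck_0[OF y'(1)] neck_0[OF x[unfolded xy(1)]] y'(2)[of m] by (cases "m = 0") (simp_all add: xy)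
  have "N m < N (Suc m)"
    using strict_monoD[OF neck_mono[OF x[unfolded xy(1)]]] by simp
  then show "length w \<le> snd x m \<Longrightarrow> fst y w = fst x w"
    using y'(3)[of w] by (simp add: xy)
qed

lemma N_measurable: "(\<lambda>x. real (snd x m)) \<in> borel_measurable P"
  by (rule locally_constant_measurable_P[of "Suc m"]) (simp_all add: neck_cylinder_agree(1))

lemma log_sum_measurable: "log_sum \<alpha> m \<in> borel_measurable P"
proof (rule locally_constant_measurable_P[of "Suc m"])
  fix x y assume xy: "x \<in> neck_trees \<Lambda> Mb" "y \<in> neck_cylinder \<Lambda> Mb x (Suc m)"
  have "S (fst y) (snd x m) \<alpha> = S (fst x) (snd x m) \<alpha>"
    by (rule level_sum_cong) (rule neck_cylinder_agree(2)[OF xy])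
  then show "log_sum \<alpha> m y = log_sum \<alpha> m x"
    by (simp add: log_sum_def neck_cylinder_agree(1)[OF xy])
qed simp

lemma neck_split:
  assumes x: "(\<omega>, N) \<in> neck_trees \<Lambda> Mb"
  obtains \<omega>' where "\<omega>' \<in> trees" "(neck_shift ^^ m) (\<omega>, N) = (\<omega>', \<lambda>i. N (m + i) - N m)"
    "\<And>u w. u \<in> level \<omega> (N m) \<Longrightarrow> \<omega> (u @ w) = \<omega>' w"
proof -
  obtain u where u: "u \<in> level \<omega> (N m)"
    using level_nonempty[OF neck_tree[OF x]] by blast
  have "\<omega> (v @ w) = \<omega> (u @ w)" if v: "v \<in> level \<omega> (N m)" for v w
  \<comment> \<open>The neck condition starts at \<open>m = 1\<close>; level \<open>0\<close>
    consists of the empty word alone.\<close>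
  proof (cases "m = 0")
    case True
    then show ?thesis
      using u v neck_0[OF x] by (simp add: level_def)
  next
    case False
    then show ?thesis
      by (intro neck_eq[OF x _ v u]) simp
  qed
  moreover have "(\<lambda>w. \<omega> (u @ w)) \<in> trees"
    using u by (intro tree_subtree neck_tree[OF x]) (simp add: level_def)
  ultimately show thesis
    using that[of "\<lambda>w. \<omega> (u @ w)"] neck_funpow_eq[OF x u] by simp
qed

lemma N1_integrable: "integrable P (\<lambda>x. real (snd x 1))"
  using P_N1 by (intro integrableI_bounded N_measurable) simp

lemma N_limit:
  "\<exists>E>0. AE x in P. (\<lambda>m. real (snd x m) / real m) \<longlonglongrightarrow> E"
proof (intro exI conjI)
  let ?E = "\<integral>x. real (snd x 1) \<partial>P"
  \<comment> \<open>The gaps between neck levels are the first neck levels of the shifted trees, so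
    their Birkhoff sum telescopes, starting from \<open>N 0 = 0\<close>.\<close>
  have sum: "(\<Sum>j<m. real (snd ((neck_shift ^^ j) x) 1)) = real (snd x m)" if "x \<in> neck_trees \<Lambda> Mb" for x m
  proof -
    obtain \<omega> N where x: "x = (\<omega>, N)"
      by (cases x)
    note x' = that[unfolded x]
    have "real (snd ((neck_shift ^^ j) (\<omega>, N)) 1) = real (N (Suc j)) - real (N j)" for j
    proof -
      obtain \<omega>' where "(neck_shift ^^ j) (\<omega>, N) = (\<omega>', \<lambda>i. N (j + i) - N j)"
        using neck_split[OF x', of j] by blast
      then show ?thesis
        using strict_mono_less_eq[OF neck_mono[OF x'], of j "Suc j"] by simp
    qed
    then show ?thesis
      using neck_0[OF x'] sum_lessThan_telescope[of "\<lambda>j. real (N j)" m] by (simp add: x)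
  qed
  have "1 \<le> real (snd x 1)" if "x \<in> space P" for x
  proof -
    have "strict_mono (snd x)"
      using neck_mono[of "fst x" "snd x"] that by (simp add: space_P)
    then have "snd x 0 < snd x 1"
      by (rule strict_monoD) simp
    then show ?thesis
      by simp
  qed
  then have "1 \<le> ?E"
    by (intro integral_ge_const N1_integrable AE_I2)
  then show "0 < ?E"
    by simp
  have "AE x in P. (\<lambda>m. (\<Sum>j<m. real (snd ((neck_shift ^^ j) x) 1)) / real m) \<longlonglongrightarrow> ?E"
    by (rule birkhoff[OF N1_integrable]) simp
  then show "AE x in P. (\<lambda>m. real (snd x m) / real m) \<longlonglongrightarrow> ?E"
    using AE_space by eventually_elim (simp only: sum space_P)
qed

text \<open>
  \<open>S\<close> is submultiplicative along neck levels for \<open>\<alpha> < D\<close> and supermultiplicative for \<open>\<alpha> \<ge> D\<close>; adding a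
  multiple of \<open>N\<close>, which is additive, makes \<open>\<plusminus>log_sum\<close> monotone.
\<close>

lemma log_sum_limit:
  assumes \<alpha>: "0 \<le> \<alpha>"
  shows "\<exists>L. AE x in P. (\<lambda>m. log_sum \<alpha> m x / real m) \<longlonglongrightarrow> L"
proof -
  \<comment> \<open>The sign that makes \<open>s * log_sum\<close> subadditive in both regimes;
    multiplying by it once more at the end removes it.\<close>
  define s :: real where "s = (if \<alpha> < real CARD('n) then 1 else - 1)"
  have s: "s = 1 \<or> s = - 1" "s * s = 1"
    by (auto simp: s_def)
  define C where "C = ln (real M) - \<alpha> * ln \<sigma>l"
  obtain x0 where "x0 \<in> neck_trees \<Lambda> Mb"
    using not_empty space_P by blast
  then have "fst x0 \<in> trees"
    using neck_tree[of "fst x0" "snd x0"] by simp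
  then have C: "0 \<le> C"
    unfolding C_def using \<alpha> by (rule log_rate_nonneg)
  define f where "f m x = C * real (snd x m) + s * log_sum \<alpha> m x" for m x
  have f0: "f 0 x = 0" if "x \<in> space P" for x
    using neck_0[of "fst x" "snd x"] neck_tree[of "fst x" "snd x"] that \<alpha>
    by (simp add: f_def log_sum_def space_P level_sum_0)
  have sub: "f (m + n) x \<le> f m x + f n ((neck_shift ^^ m) x)" if "x \<in> space P" for m n x
  proof -
    obtain \<omega> N where xe: "x = (\<omega>, N)"
      by (cases x)
    have x: "(\<omega>, N) \<in> neck_trees \<Lambda> Mb"
      using that by (simp only: space_P xe)
    obtain \<omega>' where \<omega>': "\<omega>' \<in> trees" "(neck_shift ^^ m) (\<omega>, N) = (\<omega>', \<lambda>i. N (m + i) - N m)"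
      "\<And>u w. u \<in> level \<omega> (N m) \<Longrightarrow> \<omega> (u @ w) = \<omega>' w"
      using neck_split[OF x, of m] by metis
    note \<omega> = neck_tree[OF x]
    define j k where "j = N m" and "k = N (m + n) - N m"
    have jk: "N (m + n) = j + k"
      using strict_mono_less_eq[OF neck_mono[OF x], of m "m + n"] by (simp add: j_def k_def)
    have neck: "\<And>u w. u \<in> level \<omega> j \<Longrightarrow> \<omega> (u @ w) = \<omega>' w"
      using \<omega>'(3) by (simp add: j_def)
    note pos = level_sum_pos[OF \<omega> \<alpha>] level_sum_pos[OF \<omega>'(1) \<alpha>]
    have "s * ln (S \<omega> (j + k) \<alpha>) \<le> s * ln (S \<omega> j \<alpha> * S \<omega>' k \<alpha>)"
    proof (cases "\<alpha> < real CARD('n)")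
      case True
      then have "S \<omega> (j + k) \<alpha> \<le> S \<omega> j \<alpha> * S \<omega>' k \<alpha>"
        by (intro level_sum_neck_submult \<omega> \<omega>'(1) neck \<alpha>)
      then show ?thesis
        using pos True by (simp add: s_def)
    next
      case False
      then have "S \<omega> j \<alpha> * S \<omega>' k \<alpha> \<le> S \<omega> (j + k) \<alpha>"
        by (intro level_sum_neck_supermult \<omega> \<omega>'(1) neck) simp_all
      then show ?thesis
        using pos False by (simp add: s_def)
    qed
    also have "\<dots> = s * ln (S \<omega> j \<alpha>) + s * ln (S \<omega>' k \<alpha>)"
      using pos(1)[of j] pos(2)[of k] by (simp add: ln_mult distrib_left)
    finally show ?thesis
      unfolding f_def log_sum_def xe \<omega>'(2) fst_conv snd_conv jk k_def[symmetric] j_def[symmetric]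
      by (simp add: distrib_left)
  qed
  have f_Suc: "f m x \<le> f (Suc m) x" if "x \<in> space P" for m x
  proof -
    obtain \<omega> N where xe: "x = (\<omega>, N)"
      by (cases x)
    have x: "(\<omega>, N) \<in> neck_trees \<Lambda> Mb"
      using that by (simp only: space_P xe)
    define j k where "j = N m" and "k = N (Suc m) - N m"
    have jk: "N (Suc m) = j + k"
      using strict_mono_less_eq[OF neck_mono[OF x], of m "Suc m"] by (simp add: j_def k_def)
    have "\<bar>ln (S \<omega> (j + k) \<alpha>) - ln (S \<omega> j \<alpha>)\<bar> \<le> C * real k"
      unfolding C_def by (rule level_sum_extend[OF neck_tree[OF x] \<alpha>])
    then show ?thesis
      using s(1) unfolding f_def log_sum_def xe fst_conv snd_conv jk j_def[symmetric]
      by (auto simp: distrib_left)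
  qed
  have f_shift: "f m (neck_shift x) \<le> f (Suc m) x" if "x \<in> space P" for m x
  proof -
    obtain \<omega> N where xe: "x = (\<omega>, N)"
      by (cases x)
    have x: "(\<omega>, N) \<in> neck_trees \<Lambda> Mb"
      using that by (simp only: space_P xe)
    obtain \<omega>' where \<omega>': "\<omega>' \<in> trees" "(neck_shift ^^ 1) (\<omega>, N) = (\<omega>', \<lambda>i. N (1 + i) - N 1)"
      "\<And>u w. u \<in> level \<omega> (N 1) \<Longrightarrow> \<omega> (u @ w) = \<omega>' w"
      using neck_split[OF x, of 1] by metis
    define j k where "j = N 1" and "k = N (1 + m) - N 1"
    have jk: "N (Suc m) = j + k"
      using strict_mono_less_eq[OF neck_mono[OF x], of 1 "Suc m"] by (simp add: j_def k_def)
    have "\<bar>ln (S \<omega> (j + k) \<alpha>) - ln (S \<omega>' k \<alpha>)\<bar> \<le> C * real j"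
      unfolding C_def by (rule level_sum_neck_shift[OF neck_tree[OF x] \<omega>'(1) _ \<alpha>]) (simp add: j_def \<omega>'(3))
    moreover have "neck_shift (\<omega>, N) = (\<omega>', \<lambda>i. N (1 + i) - N 1)"
      using \<omega>'(2) by simp
    ultimately show ?thesis
      using s(1) unfolding f_def log_sum_def xe
      by (auto simp: distrib_left jk[unfolded Suc_eq_plus1_left] jk j_def[symmetric] simp del: One_nat_def)
  qed
  have f_meas: "f m \<in> borel_measurable P" for m
    unfolding f_def by (intro borel_measurable_add borel_measurable_times borel_measurable_const N_measurable log_sum_measurable)
  have f1_bound: "\<bar>f 1 x\<bar> \<le> 2 * C * real (snd x 1)" if "x \<in> space P" for x
  proof -
    \<comment> \<open>Extension from level \<open>0\<close>, where the level sum is 1 and its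
      logarithm vanishes.\<close>
    have "\<bar>ln (S (fst x) (0 + snd x 1) \<alpha>) - ln (S (fst x) 0 \<alpha>)\<bar> \<le> C * real (snd x 1)"
      unfolding C_def using neck_tree[of "fst x" "snd x"] that
      by (intro level_sum_extend \<alpha>) (simp add: space_P)
    then have "\<bar>log_sum \<alpha> 1 x\<bar> \<le> C * real (snd x 1)"
      using neck_tree[of "fst x" "snd x"] that \<alpha> by (simp add: log_sum_def level_sum_0 space_P)
    moreover have "\<bar>s * log_sum \<alpha> 1 x\<bar> = \<bar>log_sum \<alpha> 1 x\<bar>"
      using s(1) by auto
    moreover have "0 \<le> C * real (snd x 1)"
      using C by simp
    ultimately show ?thesis
      unfolding f_def by linarith
  qed
  have f1_int: "integrable P (f 1)"
  proof (rule Bochner_Integration.integrable_bound)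
    show "integrable P (\<lambda>x. 2 * C * real (snd x 1))"
      using N1_integrable by (rule integrable_mult_right)
    show "AE x in P. norm (f 1 x) \<le> norm (2 * C * real (snd x 1))"
      using f1_bound by (intro AE_I2) (simp add: order_trans[OF _ abs_ge_self])
  qed (rule f_meas)
  obtain L where L: "AE x in P. (\<lambda>m. f m x / real m) \<longlonglongrightarrow> L"
    using kingman[OF f_meas f1_int f0 sub f_Suc f_shift] by blast
  obtain E where E: "AE x in P. (\<lambda>m. real (snd x m) / real m) \<longlonglongrightarrow> E"
    using N_limit by blast
  have "AE x in P. (\<lambda>m. log_sum \<alpha> m x / real m) \<longlonglongrightarrow> s * (L - C * E)"
    using L E
  proof eventually_elim
    case (elim x)
    have "(\<lambda>m. s * (f m x / real m - C * (real (snd x m) / real m))) \<longlonglongrightarrow> s * (L - C * E)"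
      by (intro tendsto_intros elim)
    moreover have "s * (f m x / real m - C * (real (snd x m) / real m)) = log_sum \<alpha> m x / real m" for m
    proof -
      have "s * (f m x / real m - C * (real (snd x m) / real m)) = (s * s) * log_sum \<alpha> m x / real m"
        by (simp add: f_def add_divide_distrib)
      then show ?thesis
        by (simp add: s(2))
    qed
    ultimately show ?case
      by simp
  qed
  then show ?thesis ..
qed

text \<open>\<open>L\<close> is the growth of \<open>ln S\<close> per neck block and
  \<open>E\<close> the mean length of a block, so the growth per level is
  \<open>L / E\<close>.\<close>

lemma pressure_limit:
  assumes \<alpha>: "0 \<le> \<alpha>"
  shows "\<exists>F. AE x in P. (\<lambda>k. 1 / real k * ln (S (fst x) k \<alpha>)) \<longlonglongrightarrow> F"
proof -
  obtain L where L: "AE x in P. (\<lambda>m. log_sum \<alpha> m x / real m) \<longlonglongrightarrow> L"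
    using log_sum_limit[OF \<alpha>] by blast
  obtain E where E: "E > 0" "AE x in P. (\<lambda>m. real (snd x m) / real m) \<longlonglongrightarrow> E"
    using N_limit by blast
  have "AE x in P. (\<lambda>k. 1 / real k * ln (S (fst x) k \<alpha>)) \<longlonglongrightarrow> L / E"
    using L E(2) AE_space
  proof eventually_elim
    case (elim x)
    then have x: "(fst x, snd x) \<in> neck_trees \<Lambda> Mb"
      by (simp add: space_P)
    have "(\<lambda>k. ln (S (fst x) k \<alpha>) / real k) \<longlonglongrightarrow> L / E"
      by (rule tendsto_over_subsequence[OF level_sum_extend[OF neck_tree[OF x] \<alpha>] neck_mono[OF x] neck_0[OF x] elim(2)])
        (use E(1) elim(1) in \<open>simp_all add: log_sum_def\<close>)
    then show ?case
      by simp
  qed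
  then show ?thesis ..
qed

text \<open>Each \<open>\<alpha>\<close> first gets its own limit and its own null set. The slope
  bounds pass to \<open>F\<close> at any tree where two given limits hold; with them, the countably
  many null sets of rational exponents suffice.\<close>

lemma pressure_function:
  obtains F where "AE x in P. \<forall>\<alpha>\<ge>0. (\<lambda>k. 1 / real k * ln (S (fst x) k \<alpha>)) \<longlonglongrightarrow> F \<alpha>"
    and "0 \<le> F 0"
    and "\<And>\<alpha> \<beta>. 0 \<le> \<alpha> \<Longrightarrow> \<alpha> \<le> \<beta> \<Longrightarrow> (\<beta> - \<alpha>) * ln \<sigma>l \<le> F \<beta> - F \<alpha>"
    and "\<And>\<alpha> \<beta>. 0 \<le> \<alpha> \<Longrightarrow> \<alpha> \<le> \<beta> \<Longrightarrow> F \<beta> - F \<alpha> \<le> (\<beta> - \<alpha>) * ln \<sigma>u"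
proof -
  define q where "q x k \<alpha> = 1 / real k * ln (S (fst x) k \<alpha>)" for x :: "(nat list \<rightharpoonup> 'l) \<times> (nat \<Rightarrow> nat)" and k \<alpha>
  have "\<forall>\<alpha>. \<exists>L. 0 \<le> \<alpha> \<longrightarrow> (AE x in P. (\<lambda>k. q x k \<alpha>) \<longlonglongrightarrow> L)"
    unfolding q_def using pressure_limit by blast
  then obtain F where F: "\<And>\<alpha>. 0 \<le> \<alpha> \<Longrightarrow> AE x in P. (\<lambda>k. q x k \<alpha>) \<longlonglongrightarrow> F \<alpha>"
    by metis
  have tree: "fst x \<in> trees" if "x \<in> space P" for x
    using neck_tree[of "fst x" "snd x"] that by (simp add: space_P)
  have q_bounds: "(\<beta> - \<alpha>) * ln \<sigma>l \<le> q x k \<beta> - q x k \<alpha>" "q x k \<beta> - q x k \<alpha> \<le> (\<beta> - \<alpha>) * ln \<sigma>u"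
    if "x \<in> space P" "0 \<le> \<alpha>" "\<alpha> \<le> \<beta>" "0 < k" for x k \<alpha> \<beta>
    using level_sum_exponent[OF tree[OF that(1)] that(2,3), of k] that(4)
    by (simp_all add: q_def field_simps)
  have F_lower: "(\<beta> - \<alpha>) * ln \<sigma>l \<le> F \<beta> - F \<alpha>" and F_upper: "F \<beta> - F \<alpha> \<le> (\<beta> - \<alpha>) * ln \<sigma>u"
    if \<alpha>: "0 \<le> \<alpha>" "\<alpha> \<le> \<beta>" for \<alpha> \<beta>
  proof -
    have \<beta>: "0 \<le> \<beta>"
      using \<alpha> by simp
    have "AE x in P. (\<beta> - \<alpha>) * ln \<sigma>l \<le> F \<beta> - F \<alpha> \<and> F \<beta> - F \<alpha> \<le> (\<beta> - \<alpha>) * ln \<sigma>u"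
      using F[OF \<alpha>(1)] F[OF \<beta>] AE_space
    proof eventually_elim
      case (elim x)
      have lim: "(\<lambda>k. q x k \<beta> - q x k \<alpha>) \<longlonglongrightarrow> F \<beta> - F \<alpha>"
        by (intro tendsto_diff elim)
      show ?case
      proof
        show "(\<beta> - \<alpha>) * ln \<sigma>l \<le> F \<beta> - F \<alpha>"
          by (rule LIMSEQ_le_const[OF lim]) (use q_bounds(1)[OF elim(3) \<alpha>] in \<open>auto intro!: exI[of _ 1]\<close>)
        show "F \<beta> - F \<alpha> \<le> (\<beta> - \<alpha>) * ln \<sigma>u"
          by (rule LIMSEQ_le_const2[OF lim]) (use q_bounds(2)[OF elim(3) \<alpha>] in \<open>auto intro!: exI[of _ 1]\<close>)
      qed
    qed
    \<comment> \<open>Both assertions do not mention \<open>x\<close>, so on a probability space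
      holding almost everywhere means holding.\<close>
    then show "(\<beta> - \<alpha>) * ln \<sigma>l \<le> F \<beta> - F \<alpha>" "F \<beta> - F \<alpha> \<le> (\<beta> - \<alpha>) * ln \<sigma>u"
      by (simp_all only: AE_const)
  qed
  have "AE x in P. 0 \<le> F 0"
    using F[of 0, OF order_refl] AE_space
  proof eventually_elim
    case (elim x)
    show ?case
      by (rule LIMSEQ_le_const[OF elim(1)])
        (use level_sum_exponent_0[OF tree[OF elim(2)]] in \<open>simp add: q_def\<close>)
  qed
  then have F_0: "0 \<le> F 0"
    by (simp only: AE_const)
  have "ln \<sigma>l < 0" "ln \<sigma>u < 0"
    using sigma_range by auto
  have "countable (\<rat> \<inter> {0::real..})"
    using countable_rat by blast
  moreover have "\<forall>r\<in>\<rat> \<inter> {0..}. AE x in P. (\<lambda>k. q x k r) \<longlonglongrightarrow> F r"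
    using F by auto
  ultimately have "AE x in P. \<forall>r\<in>\<rat> \<inter> {0..}. (\<lambda>k. q x k r) \<longlonglongrightarrow> F r"
    by (simp only: AE_ball_countable)
  then have "AE x in P. \<forall>\<alpha>\<ge>0. (\<lambda>k. q x k \<alpha>) \<longlonglongrightarrow> F \<alpha>"
    using AE_space
  proof eventually_elim
    case (elim x)
    have neg: "(\<beta> - \<alpha>) * ln \<sigma>u \<le> 0" if "\<alpha> \<le> \<beta>" for \<alpha> \<beta>
      using \<open>ln \<sigma>u < 0\<close> that by (intro mult_nonneg_nonpos) auto
    show ?case
    proof (intro allI impI)
      fix \<alpha> :: real assume "0 \<le> \<alpha>"
      then show "(\<lambda>k. q x k \<alpha>) \<longlonglongrightarrow> F \<alpha>"
      proof (rule tendsto_of_rational_lipschitz[where c = "- ln \<sigma>l", rotated -1])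
        show "\<bar>q x k \<beta> - q x k \<alpha>\<bar> \<le> - ln \<sigma>l * (\<beta> - \<alpha>)" if "0 < k" "0 \<le> \<alpha>" "\<alpha> \<le> \<beta>" for k \<alpha> \<beta>
          using q_bounds[OF elim(2) that(2,3,1)] neg[OF that(3)] by (simp add: abs_le_iff mult.commute)
        show "\<bar>F \<beta> - F \<alpha>\<bar> \<le> - ln \<sigma>l * (\<beta> - \<alpha>)" if "0 \<le> \<alpha>" "\<alpha> \<le> \<beta>" for \<alpha> \<beta>
          using F_lower[OF that] F_upper[OF that] neg[OF that(2)] by (simp add: abs_le_iff mult.commute)
      qed (use elim(1) \<open>ln \<sigma>l < 0\<close> in auto)
    qed
  qed
  then show thesis
    using that[of F] F_0 F_lower F_upper by (simp only: q_def)
qed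

theorem pressure_exists_strict_antimono_zero:
  "(\<exists>p :: real \<Rightarrow> real. AE x in P. \<forall>\<alpha>\<ge>0.
      pressure_exists T (fst x) \<alpha> \<and> pressure T (fst x) \<alpha> = p \<alpha>) \<and>
   (AE x in P. strict_antimono_on {0..} (pressure T (fst x))) \<and>
   (\<exists>!\<alpha>\<^sub>0. 0 \<le> \<alpha>\<^sub>0 \<and> (AE x in P. pressure T (fst x) \<alpha>\<^sub>0 = 0))"
proof -
  obtain F where F: "AE x in P. \<forall>\<alpha>\<ge>0. (\<lambda>k. 1 / real k * ln (S (fst x) k \<alpha>)) \<longlonglongrightarrow> F \<alpha>"
    and F_0: "0 \<le> F 0"
    and F_lower: "\<And>\<alpha> \<beta>. 0 \<le> \<alpha> \<Longrightarrow> \<alpha> \<le> \<beta> \<Longrightarrow> (\<beta> - \<alpha>) * ln \<sigma>l \<le> F \<beta> - F \<alpha>"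
    and F_upper: "\<And>\<alpha> \<beta>. 0 \<le> \<alpha> \<Longrightarrow> \<alpha> \<le> \<beta> \<Longrightarrow> F \<beta> - F \<alpha> \<le> (\<beta> - \<alpha>) * ln \<sigma>u"
    using pressure_function by blast
  have lnu: "ln \<sigma>u < 0"
    using sigma_range by simp
  have F_strict: "F \<beta> < F \<alpha>" if "0 \<le> \<alpha>" "\<alpha> < \<beta>" for \<alpha> \<beta>
  proof -
    have "(\<beta> - \<alpha>) * ln \<sigma>u < 0"
      using lnu that by (intro mult_pos_neg) auto
    then show ?thesis
      using F_upper[of \<alpha> \<beta>] that by linarith
  qed
  have ex: "AE x in P. \<forall>\<alpha>\<ge>0. pressure_exists T (fst x) \<alpha> \<and> pressure T (fst x) \<alpha> = F \<alpha>"
    using F by eventually_elim (auto simp: pressure_exists_def pressure_def convergent_def limI)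
  have anti: "AE x in P. strict_antimono_on {0..} (pressure T (fst x))"
    using ex by eventually_elim (auto simp: monotone_on_def F_strict)
  \<comment> \<open>For a fixed exponent the almost sure statement is one about \<open>F\<close>,
    where existence and uniqueness of the zero can be argued without null sets.\<close>
  have zero_iff: "(AE x in P. pressure T (fst x) \<alpha> = 0) \<longleftrightarrow> F \<alpha> = 0" if "0 \<le> \<alpha>" for \<alpha>
  proof -
    have "AE x in P. pressure T (fst x) \<alpha> = F \<alpha>"
      using ex by eventually_elim (use that in simp)
    then have "(AE x in P. pressure T (fst x) \<alpha> = 0) \<longleftrightarrow> (AE x in P. F \<alpha> = 0)"
      by (intro eventually_subst) (auto elim: eventually_mono)
    then show ?thesis
      by simp
  qed
  have "(- ln \<sigma>l)-lipschitz_on {0..} F"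
  proof (rule lipschitz_on_leI)
    fix \<alpha> \<beta> :: real assume ab: "\<alpha> \<in> {0..}" "\<beta> \<in> {0..}" "\<alpha> \<le> \<beta>"
    then have "(\<beta> - \<alpha>) * ln \<sigma>u \<le> 0"
      using lnu by (intro mult_nonneg_nonpos) auto
    then show "dist (F \<alpha>) (F \<beta>) \<le> - ln \<sigma>l * dist \<alpha> \<beta>"
      using F_lower[of \<alpha> \<beta>] F_upper[of \<alpha> \<beta>] ab by (simp add: dist_real_def mult.commute)
  qed (use sigma_range in auto)
  then have cont: "continuous_on {0..} F"
    by (rule lipschitz_on_continuous_on)
  \<comment> \<open>The slope of \<open>F\<close> is at most \<open>ln \<sigma>u < 0\<close>, so
    starting from \<open>F 0 \<ge> 0\<close> it has reached a value of at most 0 at this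
    \<open>b\<close>; continuity then gives a zero in between.\<close>
  define b where "b = F 0 / - ln \<sigma>u"
  have b: "0 \<le> b" "b * ln \<sigma>u = - F 0"
    using F_0 lnu by (auto simp: b_def divide_nonneg_neg)
  have "F b \<le> 0"
    using F_upper[of 0 b] b by simp
  then obtain z where z: "0 \<le> z" "F z = 0"
    using IVT2'[of F b 0 0] F_0 b(1) continuous_on_subset[OF cont, of "{0..b}"] by auto
  have "\<exists>!\<alpha>\<^sub>0. 0 \<le> \<alpha>\<^sub>0 \<and> F \<alpha>\<^sub>0 = 0"
  proof (rule ex1I[of _ z])
    fix y assume "0 \<le> y \<and> F y = 0"
    then show "y = z"
      using F_strict[of y z] F_strict[of z y] z by (cases y z rule: linorder_cases) auto
  qed (use z in simp)
  then have "\<exists>!\<alpha>\<^sub>0. 0 \<le> \<alpha>\<^sub>0 \<and> (AE x in P. pressure T (fst x) \<alpha>\<^sub>0 = 0)"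
    by (simp add: zero_iff cong: conj_cong)
  then show ?thesis
    using ex anti by blast
qed

end

theorem theorem4p3:
  fixes \<Lambda> :: "'l set"
    and Mb :: "'l \<Rightarrow> nat"
    and T :: "'l \<Rightarrow> nat \<Rightarrow> real ^ 'n \<Rightarrow> real ^ 'n"
    and \<sigma>l \<sigma>u :: real
    and P :: "((nat list \<rightharpoonup> 'l) \<times> (nat \<Rightarrow> nat)) measure"
  assumes Mb_pos: "\<And>l. l \<in> \<Lambda> \<Longrightarrow> 1 \<le> Mb l"
    and Mb_bdd: "bdd_above (Mb ` \<Lambda>)"
    and T_linear: "\<And>l i. l \<in> \<Lambda> \<Longrightarrow> 1 \<le> i \<Longrightarrow> i \<le> Mb l \<Longrightarrow> linear (T l i)"
    and T_nonsing: "\<And>l i. l \<in> \<Lambda> \<Longrightarrow> 1 \<le> i \<Longrightarrow> i \<le> Mb l \<Longrightarrow> bij (T l i)"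
    and sigma_range: "0 < \<sigma>l" "\<sigma>l \<le> \<sigma>u" "\<sigma>u < 1"
    and T_sigma: "\<And>l i. l \<in> \<Lambda> \<Longrightarrow> 1 \<le> i \<Longrightarrow> i \<le> Mb l \<Longrightarrow>
        \<sigma>l \<le> singular_value (T l i) CARD('n) \<and>
        singular_value (T l i) CARD('n) \<le> singular_value (T l i) 1 \<and>
        singular_value (T l i) 1 \<le> \<sigma>u"
    and P_prob: "prob_space P"
    and P_sets: "sets P = sets (neck_borel \<Lambda> Mb)"
    and P_inv: "invariant_measure neck_shift P"
    and P_erg: "ergodic_measure neck_shift P"
    and P_N1: "(\<integral>\<^sup>+ x. ennreal (real (snd x 1)) \<partial>P) < \<infinity>"
  shows "(\<exists>p :: real \<Rightarrow> real. AE x in P. \<forall>\<alpha>\<ge>0.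
            pressure_exists T (fst x) \<alpha> \<and> pressure T (fst x) \<alpha> = p \<alpha>) \<and>
         (AE x in P. strict_antimono_on {0..} (pressure T (fst x))) \<and>
         (\<exists>!\<alpha>\<^sub>0. 0 \<le> \<alpha>\<^sub>0 \<and> (AE x in P. pressure T (fst x) \<alpha>\<^sub>0 = 0))"
proof -
  interpret P: prob_space P
    by (rule P_prob)
  interpret code_tree_system \<Lambda> Mb T \<sigma>l \<sigma>u
  proof (rule code_tree_system.intro)
    fix l i assume li: "l \<in> \<Lambda>" "1 \<le> i" "i \<le> Mb l"
    show "\<sigma>l \<le> singular_value (T l i) CARD('n)" "singular_value (T l i) 1 \<le> \<sigma>u"
      using T_sigma[OF li] by simp_all
  qed (rule Mb_pos Mb_bdd T_linear T_nonsing sigma_range; assumption)+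
  interpret neck_measure \<Lambda> Mb T \<sigma>l \<sigma>u P
  proof
    show "neck_shift \<in> P \<rightarrow>\<^sub>M P"
      using neck_shift_measurable by (simp only: measurable_cong_sets[OF P_sets P_sets])
  qed (rule P_inv P_erg P_sets P_N1)+
  show ?thesis
    by (rule pressure_exists_strict_antimono_zero)
qed

end
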